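(* Let $0<s<1$. There exists a constant $\mu_0>0$ such that for every $0<\mu\leq\mu_0$ the following holds. Suppose that $\{\omega_n\}_{n=1}^\infty$ is a sequence such that $$\omega_n\geq0,\quad\omega_n\in L^1(\Pi)\cap L^{p_s}(\Pi),\quad\int_\Pi\omega_n\,dx\leq1,\quad\|\omega_n\|_{p_s}\leq C\qquad\forall\,n\geq1$$ for some constant $C$ independent of $n$, $$\mu_n=\int_\Pi x_2\omega_n\,dx\to\mu\quad\text{and}\quad\mathcal{E}(\omega_n)\to S^s_\mu\qquad\text{as }n\to\infty.$$ Then there exist $\omega\in\Sigma^s_\mu$, a subsequence $\{\omega_{n_k}\}_{k=1}^\infty$ and a sequence of real numbers $\{c_k\}_{k=1}^\infty$ such that, as $k\to\infty$, $$\omega_{n_k}(\cdot+c_k\mathbf{e}_1)\to\omega\ \text{ strongly in }L^2(\Pi),\qquad x_2\omega_{n_k}(\cdot+c_k\mathbf{e}_1)\to x_2\omega\ \text{ strongly in }L^1(\Pi).$$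
   Context: Let $\Pi=\{x\in\mathbb{R}^2\mid x_2>0\}$, $\mathbf{e}_1=(1,0)$, $\bar y=(y_1,-y_2)$, $p_s=\infty$ if $0<s\le1/2$ and $p_s=2$ if $1/2<s<1$. Let $c_{2,s}=\pi^{-1}2^{-2s}\Gamma(1-s)/\Gamma(s)$ ($\Gamma$ the Euler gamma function), $$G_\Pi(x,y)=c_{2,s}\Big(\frac{1}{|x-y|^{2-2s}}-\frac{1}{|x-\bar y|^{2-2s}}\Big),\quad\mathcal{G}_s\omega(x)=\int_\Pi G_\Pi(x,y)\omega(y)\,dy,$$ $$E(\omega)=\frac12\int_\Pi\omega\,\mathcal{G}_s\omega\,dx,\qquad\mathcal{E}(\omega)=E(\omega)-\frac12\int_\Pi\omega^2\,dx .$$ If $1/2<s<1$, $\mathcal{A}^s_\mu=\{\omega\in L^2(\Pi)\mid\omega\ge0,\ \int_\Pi x_2\omega\,dx=\mu,\ \int_\Pi\omega\,dx\le1\}$; if $0<s\le1/2$, the same with $L^2(\Pi)$ replaced by $L^\infty(\Pi)$. $S^s_\mu=\sup_{\omega\in\mathcal{A}^s_\mu}\mathcal{E}(\omega)$ and $\Sigma^s_\mu=\{\omega\in\mathcal{A}^s_\mu\mid\mathcal{E}(\omega)=S^s_\mu\}$. *)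

theory Defs
  imports "HOL-Analysis.Analysis" "HOL-Probability.Essential_Supremum"
begin

text \<open>
  Lebesgue spaces, with functions rather than classes modulo null sets as elements.  The norm is
  extended-valued, so that it is meaningful for every measurable function; the exponent is meant
  to satisfy \<open>1 \<le> p \<le> \<infinity>\<close>.
\<close>

definition Lp_norm :: "'a measure \<Rightarrow> ennreal \<Rightarrow> ('a \<Rightarrow> real) \<Rightarrow> ennreal" where
  "Lp_norm M p f =
     (if p = \<infinity> then esssup M (\<lambda>x. ennreal \<bar>f x\<bar>)
      else (let I = (\<integral>\<^sup>+x. ennreal (\<bar>f x\<bar> powr enn2real p) \<partial>M)
            in if I = \<infinity> then \<infinity> else ennreal (enn2real I powr (1 / enn2real p))))"

definition Lp :: "'a measure \<Rightarrow> ennreal \<Rightarrow> ('a \<Rightarrow> real) set" where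
  "Lp M p = {f \<in> borel_measurable M. Lp_norm M p f < \<infinity>}"

definition tendsto_Lp ::
    "'a measure \<Rightarrow> ennreal \<Rightarrow> (nat \<Rightarrow> 'a \<Rightarrow> real) \<Rightarrow> ('a \<Rightarrow> real) \<Rightarrow> bool" where
  "tendsto_Lp M p f g \<longleftrightarrow>
     (\<forall>k. f k \<in> Lp M p) \<and> g \<in> Lp M p \<and> (\<lambda>k. Lp_norm M p (\<lambda>x. f k x - g x)) \<longlonglongrightarrow> 0"

definition half_plane :: "(real^2) set" where
  "half_plane = {x. x $ 2 > 0}"

text \<open>
  Functions on the half plane are represented by total functions on the plane; only their values
  on the half plane matter, because every notion below refers to this restricted measure.
\<close>

abbreviation half_plane_measure :: "(real^2) measure" where
  "half_plane_measure \<equiv> lebesgue_on half_plane"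

definition e1 :: "real^2" where
  "e1 = vector [1, 0]"

definition reflect :: "real^2 \<Rightarrow> real^2" where
  "reflect y = vector [y $ 1, - (y $ 2)]"

definition p_exp :: "real \<Rightarrow> ennreal" where
  "p_exp s = (if s \<le> 1/2 then \<infinity> else 2)"

definition c2 :: "real \<Rightarrow> real" where
  "c2 s = inverse pi * 2 powr (- 2 * s) * Gamma (1 - s) / Gamma s"

text \<open>On the diagonal, a null set, the singular term takes the value \<open>1 / 0 = 0\<close>.\<close>

definition green :: "real \<Rightarrow> real^2 \<Rightarrow> real^2 \<Rightarrow> real" where
  "green s x y =
     c2 s * (1 / norm (x - y) powr (2 - 2 * s) - 1 / norm (x - reflect y) powr (2 - 2 * s))"

definition green_op :: "real \<Rightarrow> (real^2 \<Rightarrow> real) \<Rightarrow> real^2 \<Rightarrow> real" where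
  "green_op s \<omega> x = (\<integral>y. green s x y * \<omega> y \<partial>half_plane_measure)"

text \<open>
  The integrals below are Bochner integrals.  They converge for all nonnegative functions in
  \<open>L\<^sup>1 \<inter> L\<^sup>p\<close> with \<open>p = p_exp s\<close>, because then \<open>green_op s \<omega>\<close> is bounded and \<open>\<omega>\<^sup>2\<close> is integrable.
\<close>

definition kinetic_energy :: "real \<Rightarrow> (real^2 \<Rightarrow> real) \<Rightarrow> real" where
  "kinetic_energy s \<omega> = 1/2 * (\<integral>x. \<omega> x * green_op s \<omega> x \<partial>half_plane_measure)"

definition energy :: "real \<Rightarrow> (real^2 \<Rightarrow> real) \<Rightarrow> real" where
  "energy s \<omega> = kinetic_energy s \<omega> - 1/2 * (\<integral>x. (\<omega> x)\<^sup>2 \<partial>half_plane_measure)"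

text \<open>
  Mass and impulse are only used for almost everywhere nonnegative functions; as integrals with
  values in \<open>[0, \<infinity>]\<close> they need no separate integrability assumption.
\<close>

definition mass :: "(real^2 \<Rightarrow> real) \<Rightarrow> ennreal" where
  "mass \<omega> = (\<integral>\<^sup>+x. ennreal (\<omega> x) \<partial>half_plane_measure)"

definition impulse :: "(real^2 \<Rightarrow> real) \<Rightarrow> ennreal" where
  "impulse \<omega> = (\<integral>\<^sup>+x. ennreal (x $ 2 * \<omega> x) \<partial>half_plane_measure)"

definition admissible :: "real \<Rightarrow> real \<Rightarrow> (real^2 \<Rightarrow> real) set" where
  "admissible s \<mu> =
     {\<omega> \<in> Lp half_plane_measure (p_exp s).
        (AE x in half_plane_measure. \<omega> x \<ge> 0) \<and> impulse \<omega> = ennreal \<mu> \<and> mass \<omega> \<le> 1}"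

definition max_energy :: "real \<Rightarrow> real \<Rightarrow> ereal" where
  "max_energy s \<mu> = (SUP \<omega>\<in>admissible s \<mu>. ereal (energy s \<omega>))"

definition maximizers :: "real \<Rightarrow> real \<Rightarrow> (real^2 \<Rightarrow> real) set" where
  "maximizers s \<mu> = {\<omega> \<in> admissible s \<mu>. ereal (energy s \<omega>) = max_energy s \<mu>}"

end

theory Submission
  imports Defs "HOL-Complex_Analysis.Great_Picard" "HOL-Library.Diagonal_Subsequence"
begin

text \<open>
  The energy is a quadratic functional of the vorticity.  If the bound on the mass is dropped, the
  supremum of the energy for impulse \<open>\<mu>\<close> is therefore \<open>cstar * \<mu>\<^sup>2\<close>, where \<open>cstar\<close> is the supremum for impulse
  one.  It is finite although the mass is unrestricted: the Green function is the sum of a singular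
  near part of small integral, which the term \<open>- \<integral>\<omega>\<^sup>2\<close> absorbs, and a far part that is bounded by a multiple
  of the product of the heights and hence controlled by the impulse (\<open>kern_far_diff\<close>, \<open>far_le\<close>).

  The square is strictly superadditive, which forces maximizing sequences to stay together.  A part that
  interacts weakly with the whole can be removed at little cost, so it carries little impulse
  (\<open>removal\<close>); this applies to what lies very high above the boundary (\<open>vertical_tightness\<close>).  In the
  horizontal direction, among many adjacent slabs one carries little impulse; cutting there leaves two
  distant pieces whose energies nearly add, and this is compatible with maximality only if one of the
  pieces is negligible (\<open>gap_splitting\<close>).  Centred at a median, the sequence is tight.

  Strong convergence comes from the parallelogram identity.  It shows that the difference \<open>d\<close> of two
  near-maximizers satisfies \<open>sqn d \<le> bil kern d d\<close> up to a small error (\<open>quadratic_defect\<close>).  The near part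
  of the kernel is absorbed on the left, and the far part is a compact operator on tight families by
  the theorem of Arzela and Ascoli.  So a subsequence is Cauchy in \<open>L\<^sup>2\<close>, and its limit is a maximizer
  (\<open>maximizing_compactness\<close>).

  It remains to account for the mass.  A maximizer of the homogeneous problem has finite mass, because its
  squared norm decays geometrically along the boundary (\<open>maximizer_integrable\<close>).  Scaled to a small
  impulse, its mass falls below one.  For small \<open>\<mu>\<close> the constrained supremum is thus again
  \<open>cstar * \<mu>\<^sup>2\<close> (\<open>max_energy_eq\<close>), and the compactness result for the homogeneous problem gives the theorem.
\<close>

section \<open>The Green kernel and its splitting\<close>

lemma reflect_nth [simp]: "reflect y $ 1 = y $ 1" "reflect y $ 2 = - (y $ 2)"
  by (simp_all add: reflect_def)

lemma norm_vec2_power2: "(norm x)\<^sup>2 = (x $ 1)\<^sup>2 + (x $ 2)\<^sup>2" for x :: "real^2"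
  unfolding power2_norm_eq_inner inner_vec_def by (simp add: sum_2 power2_eq_square)

text \<open>
  The two distances in the Green function are tied to the product of the heights; every weighted
  bound of the kernel comes from this identity.
\<close>

lemma norm_diff_reflect_power2:
  "(norm (x - reflect y))\<^sup>2 = (norm (x - y))\<^sup>2 + 4 * (x $ 2 * y $ 2)"
  unfolding norm_vec2_power2 by (simp add: power2_eq_square algebra_simps)

lemma norm_diff_reflect_commute: "norm (x - reflect y) = norm (y - reflect x)"
  by (rule power2_eq_imp_eq) (simp_all add: norm_diff_reflect_power2 norm_minus_commute mult.commute)

lemma norm_diff_le_reflect:
  assumes "0 < x $ 2" "0 < y $ 2"
  shows "norm (x - y) \<le> norm (x - reflect y)"
proof (rule power2_le_imp_le)
  show "(norm (x - y))\<^sup>2 \<le> (norm (x - reflect y))\<^sup>2"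
    using assms by (simp add: norm_diff_reflect_power2)
qed simp

lemma reflect_diff: "reflect x - reflect y = reflect (x - y)"
  by (simp add: vec_eq_iff forall_2)

lemma norm_reflect: "norm (reflect x) = norm x"
  by (rule power2_eq_imp_eq) (simp_all add: norm_vec2_power2)

lemma reflect_measurable [measurable]: "reflect \<in> borel_measurable borel"
proof -
  have "continuous_on UNIV reflect"
  proof (rule continuous_on_eq[OF _ refl])
    have "\<forall>x y. dist (reflect x) (reflect y) \<le> 1 * dist x y"
      by (simp add: dist_norm reflect_diff norm_reflect)
    then have "1-lipschitz_on UNIV reflect" by (auto intro!: lipschitz_onI)
    then show "continuous_on UNIV reflect" by (rule lipschitz_on_continuous_on)
  qed
  then show ?thesis by (rule borel_measurable_continuous_onI)
qed

lemma nth_measurable_vec [measurable]: "(\<lambda>x::real^2. x $ i) \<in> borel_measurable borel"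
  by (rule borel_measurable_continuous_onI) (intro continuous_intros)

lemma powr_neg_lipschitz:
  fixes p q r e :: real
  assumes "0 < r" "r \<le> p" "r \<le> q" "e \<le> 0"
  shows "\<bar>p powr e - q powr e\<bar> \<le> - e * r powr (e - 1) * \<bar>p - q\<bar>"
proof -
  have *: "\<bar>p powr e - q powr e\<bar> \<le> - e * r powr (e - 1) * \<bar>p - q\<bar>"
    if pq: "r \<le> p" "p < q" for p q
  proof -
    have "\<exists>z>p. z < q \<and> q powr e - p powr e = (q - p) * (e * z powr (e - 1))"
    proof (rule MVT2)
      show "p < q" using pq by simp
      show "DERIV (\<lambda>x. x powr e) x :> e * x powr (e - 1)" if "p \<le> x" "x \<le> q" for x
        using that assms pq by (auto intro!: derivative_eq_intros)
    qed
    then obtain z where z: "z > p" "q powr e - p powr e = (q - p) * (e * z powr (e - 1))" by blast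
    have "\<bar>p powr e - q powr e\<bar> = \<bar>(q - p) * (e * z powr (e - 1))\<bar>"
      using z by (metis abs_minus_commute)
    also have "\<dots> = (q - p) * (- e * z powr (e - 1))"
      using pq assms by (simp add: abs_mult)
    also have "\<dots> \<le> (q - p) * (- e * r powr (e - 1))"
      using z pq assms by (intro mult_left_mono powr_mono2') auto
    finally show ?thesis using pq by (simp add: mult_ac)
  qed
  show ?thesis
    using *[of p q] *[of q p] assms by (cases p q rule: linorder_cases) (auto simp: abs_minus_commute)
qed

locale half_plane_kernel =
  fixes s :: real
  assumes s_pos: "0 < s" and s_less: "s < 1"
begin

lemma c2_pos: "0 < c2 s"
  using s_pos s_less by (auto simp: c2_def intro!: mult_pos_pos divide_pos_pos Gamma_real_pos)

text \<open>
  On the diagonal \<open>green\<close> is negative, because its singular term is \<open>1 / 0 = 0\<close> there.  The value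
  \<open>0\<close> makes the kernel nonnegative on the whole half plane.
\<close>

definition kern :: "real^2 \<Rightarrow> real^2 \<Rightarrow> real" where
  "kern x y = (if x = y then 0 else green s x y)"

text \<open>
  Replacing both distances by their maximum with \<open>r\<close> removes the singularity and leaves the kernel
  unchanged for points at distance at least \<open>r\<close>.
\<close>

definition far :: "real \<Rightarrow> real^2 \<Rightarrow> real^2 \<Rightarrow> real" where
  "far r x y = c2 s * (max r (norm (x - y)) powr (2 * s - 2)
                       - max r (norm (x - reflect y)) powr (2 * s - 2))"

text \<open>
  This dominates the error of the replacement.  The maximum matters at \<open>z = 0\<close> only, where
  \<open>0 powr (2 * s - 2) = 0\<close> would not dominate the value of the far part on the diagonal.
\<close>

definition near :: "real \<Rightarrow> real^2 \<Rightarrow> real" where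
  "near r z = (if norm z < r then c2 s * max (norm z powr (2 * s - 2)) (r powr (2 * s - 2)) else 0)"

definition far_const :: "real \<Rightarrow> real" where
  "far_const r = 4 * c2 s * (2 - 2 * s) * r powr (2 * s - 4)"

lemma near_nonneg: "0 \<le> near r z"
  using c2_pos by (simp add: near_def max_def)

lemma near_minus: "near r (x - y) = near r (y - x)"
  by (simp add: near_def norm_minus_commute)

lemma far_const_nonneg: "0 \<le> far_const r"
  using c2_pos s_less by (auto simp: far_const_def)

lemma green_eq: "green s x y = c2 s * (norm (x - y) powr (2 * s - 2) - norm (x - reflect y) powr (2 * s - 2))"
proof -
  have "2 * s - 2 = - (2 - 2 * s)" by simp
  then show ?thesis unfolding green_def by (simp only: powr_minus_divide)
qed

lemma kern_commute: "kern x y = kern y x"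
  by (auto simp: kern_def green_eq norm_minus_commute norm_diff_reflect_commute[of x y])

lemma kern_measurable [measurable]: "(\<lambda>p. kern (fst p) (snd p)) \<in> borel_measurable (borel \<Otimes>\<^sub>M borel)"
  unfolding kern_def green_def by measurable

lemma far_measurable [measurable]: "(\<lambda>p. far r (fst p) (snd p)) \<in> borel_measurable (borel \<Otimes>\<^sub>M borel)"
  unfolding far_def by measurable

lemma near_measurable [measurable]: "near r \<in> borel_measurable borel"
  unfolding near_def by measurable

lemma kern_nonneg:
  assumes "0 < x $ 2" "0 < y $ 2"
  shows "0 \<le> kern x y"
proof (cases "x = y")
  case False
  have "norm (x - reflect y) powr (2 * s - 2) \<le> norm (x - y) powr (2 * s - 2)"
    using False norm_diff_le_reflect[OF assms] s_less by (intro powr_mono2') auto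
  then show ?thesis using False c2_pos by (simp add: kern_def green_eq)
qed (simp add: kern_def)

lemma far_nonneg:
  assumes "0 < x $ 2" "0 < y $ 2" "0 < r"
  shows "0 \<le> far r x y"
proof -
  have "max r (norm (x - reflect y)) powr (2 * s - 2) \<le> max r (norm (x - y)) powr (2 * s - 2)"
    using norm_diff_le_reflect[of x y] assms s_less by (intro powr_mono2') auto
  then show ?thesis using c2_pos by (simp add: far_def)
qed

text \<open>
  The power has slope of order \<open>r powr (2 * s - 3)\<close> beyond \<open>r\<close>, and the two distances differ by at
  most \<open>4 * (x $ 2 * y $ 2) / r\<close> when the larger one exceeds \<open>r\<close>.  The product of the heights is what
  allows interactions to be bounded by impulses, without any bound on the mass.
\<close>

lemma far_le:
  assumes "0 < x $ 2" "0 < y $ 2" "0 < r"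
  shows "far r x y \<le> far_const r * (x $ 2 * y $ 2)"
proof (cases "norm (x - reflect y) \<le> r")
  case True
  then have "far r x y = 0"
    using norm_diff_le_reflect[of x y] assms by (simp add: far_def max_absorb1)
  then show ?thesis using far_const_nonneg assms by simp
next
  case False
  define a where "a = norm (x - y)"
  define b where "b = norm (x - reflect y)"
  have ab: "a \<le> b" using norm_diff_le_reflect assms by (simp add: a_def b_def)
  have "0 \<le> a" "b > r" using False by (auto simp: a_def b_def)
  have sq: "b\<^sup>2 - a\<^sup>2 = 4 * (x $ 2 * y $ 2)"
    using norm_diff_reflect_power2[of x y] by (simp add: a_def b_def)
  have "b * (b - a) \<le> (b + a) * (b - a)"
    using ab \<open>0 \<le> a\<close> by (intro mult_right_mono) auto
  also have "\<dots> = 4 * (x $ 2 * y $ 2)" using sq by (simp add: power2_eq_square algebra_simps)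
  finally have "r * (b - a) \<le> 4 * (x $ 2 * y $ 2)"
    using ab \<open>b > r\<close> mult_right_mono[of r b "b - a"] by linarith
  then have ba: "b - a \<le> 4 * (x $ 2 * y $ 2) / r"
    using assms by (simp add: field_simps)
  have "max r a powr (2 * s - 2) - b powr (2 * s - 2)
        \<le> - (2 * s - 2) * r powr (2 * s - 2 - 1) * \<bar>max r a - b\<bar>"
    using powr_neg_lipschitz[of r "max r a" b "2 * s - 2"] \<open>b > r\<close> assms s_less by auto
  also have "\<dots> \<le> (2 - 2 * s) * r powr (2 * s - 3) * (4 * (x $ 2 * y $ 2) / r)"
  proof -
    have "\<bar>max r a - b\<bar> \<le> 4 * (x $ 2 * y $ 2) / r" using ab ba \<open>b > r\<close> by (auto simp: max_def)
    then have "(2 - 2 * s) * r powr (2 * s - 3) * \<bar>max r a - b\<bar>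
        \<le> (2 - 2 * s) * r powr (2 * s - 3) * (4 * (x $ 2 * y $ 2) / r)"
      using s_less by (intro mult_left_mono) auto
    then show ?thesis by simp
  qed
  also have "\<dots> = 4 * (2 - 2 * s) * r powr (2 * s - 4) * (x $ 2 * y $ 2)"
  proof -
    have "r powr (2 * s - 3) = r powr (2 * s - 4) * r"
      using assms powr_add[of r "2 * s - 4" 1] by simp
    then show ?thesis using assms by simp
  qed
  finally have "c2 s * (max r a powr (2 * s - 2) - b powr (2 * s - 2))
      \<le> c2 s * (4 * (2 - 2 * s) * r powr (2 * s - 4) * (x $ 2 * y $ 2))"
    using c2_pos by (intro mult_left_mono) auto
  moreover have "max r b = b" using \<open>b > r\<close> by simp
  ultimately show ?thesis
    by (simp add: far_def far_const_def a_def b_def mult_ac)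
qed

lemma far_le_const:
  assumes "0 < r"
  shows "\<bar>far r x y\<bar> \<le> c2 s * r powr (2 * s - 2)"
proof -
  have *: "0 \<le> max r t powr (2 * s - 2)" "max r t powr (2 * s - 2) \<le> r powr (2 * s - 2)" for t
    using assms s_less by (auto intro!: powr_mono2')
  have "\<bar>max r (norm (x - y)) powr (2 * s - 2) - max r (norm (x - reflect y)) powr (2 * s - 2)\<bar>
     \<le> r powr (2 * s - 2)"
    using *[of "norm (x - y)"] *[of "norm (x - reflect y)"] by linarith
  then show ?thesis
    using c2_pos by (auto simp: far_def abs_mult intro!: mult_left_mono)
qed

lemma far_lipschitz:
  assumes "0 < r"
  shows "\<bar>far r x z - far r y z\<bar> \<le> 2 * c2 s * (2 - 2 * s) * r powr (2 * s - 3) * norm (x - y)"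
proof -
  define L where "L = (2 - 2 * s) * r powr (2 * s - 3)"
  have L: "L \<ge> 0" using s_less by (simp add: L_def)
  have *: "\<bar>max r (norm (x - w)) powr (2 * s - 2) - max r (norm (y - w)) powr (2 * s - 2)\<bar>
      \<le> L * norm (x - y)" for w
  proof -
    have "\<bar>max r (norm (x - w)) powr (2 * s - 2) - max r (norm (y - w)) powr (2 * s - 2)\<bar>
      \<le> L * \<bar>max r (norm (x - w)) - max r (norm (y - w))\<bar>"
      using powr_neg_lipschitz[of r "max r (norm (x - w))" "max r (norm (y - w))" "2 * s - 2"] assms s_less
      by (simp add: L_def)
    moreover have "\<bar>max r (norm (x - w)) - max r (norm (y - w))\<bar> \<le> norm (x - y)"
    proof -
      have "\<bar>norm (x - w) - norm (y - w)\<bar> \<le> norm (x - y)"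
        using norm_triangle_ineq3[of "x - w" "y - w"] by simp
      then show ?thesis by (auto simp: max_def)
    qed
    ultimately show ?thesis using L by (meson mult_left_mono order_trans)
  qed
  define X where "X w = max r (norm (x - w)) powr (2 * s - 2) - max r (norm (y - w)) powr (2 * s - 2)" for w
  have "far r x z - far r y z = c2 s * (X z - X (reflect z))"
    by (simp add: far_def X_def algebra_simps)
  then have "\<bar>far r x z - far r y z\<bar> = c2 s * \<bar>X z - X (reflect z)\<bar>"
    using c2_pos by (simp add: abs_mult)
  also have "\<dots> \<le> c2 s * (\<bar>X z\<bar> + \<bar>X (reflect z)\<bar>)"
    using c2_pos by (intro mult_left_mono abs_triangle_ineq4) auto
  also have "\<dots> \<le> c2 s * (L * norm (x - y) + L * norm (x - y))"
    using *[of z] *[of "reflect z"] c2_pos by (intro mult_left_mono add_mono) (auto simp: X_def)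
  finally show ?thesis by (simp add: L_def algebra_simps)
qed

text \<open>
  Off the diagonal the difference consists of one nonnegative correction for each of the two
  distances, with opposite signs.  The correction for the smaller distance is the larger one, hence bounds the difference.
\<close>

lemma kern_far_diff:
  assumes "0 < x $ 2" "0 < y $ 2" "0 < r"
  shows "\<bar>kern x y - far r x y\<bar> \<le> near r (x - y)"
proof -
  define a where "a = norm (x - y)"
  define b where "b = norm (x - reflect y)"
  define e where "e = 2 * s - 2"
  have ab: "a \<le> b" "0 \<le> a" using norm_diff_le_reflect assms by (auto simp: a_def b_def)
  have "0 < x $ 2 * y $ 2" using assms by simp
  then have "b\<^sup>2 > 0" using norm_diff_reflect_power2[of x y] zero_le_power2[of "norm (x - y)"]
    unfolding b_def by linarith
  then have b0: "b > 0" using ab by (cases "b = 0") auto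
  have e: "e \<le> 0" using s_less by (simp add: e_def)
  have mono: "p powr e \<ge> q powr e" if "0 < p" "p \<le> q" for p q :: real
    using that e by (intro powr_mono2') auto
  show ?thesis
  proof (cases "a < r")
    case False
    then show ?thesis using ab assms
      by (auto simp: kern_def green_eq far_def near_def a_def b_def max_absorb2)
  next
    case True
    then have near: "near r (x - y) = c2 s * max (a powr e) (r powr e)"
      by (simp add: near_def a_def e_def)
    show ?thesis
    proof (cases "x = y")
      case True
      then have "\<bar>kern x y - far r x y\<bar> \<le> c2 s * r powr e"
        using far_le_const[OF assms(3), of x y] by (simp add: kern_def e_def)
      also have "\<dots> \<le> near r (x - y)" unfolding near using c2_pos by simp
      finally show ?thesis .
    next
      case False
      then have a0: "a > 0" by (simp add: a_def)
      have k: "kern x y = c2 s * (a powr e - b powr e)"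
        using False by (simp add: kern_def green_eq a_def b_def e_def)
      have f: "far r x y = c2 s * (r powr e - max r b powr e)"
        using \<open>a < r\<close> by (simp add: far_def a_def b_def e_def)
      have "\<bar>(a powr e - b powr e) - (r powr e - max r b powr e)\<bar> \<le> a powr e"
      proof (cases "b \<le> r")
        case True
        then show ?thesis
          using mono[OF a0 ab(1)] powr_ge_zero[of b e] by (simp add: max_absorb1)
      next
        case False
        then show ?thesis
          using mono[OF a0, of r] \<open>a < r\<close> powr_ge_zero[of r e] by (simp add: max_absorb2)
      qed
      then have "c2 s * \<bar>(a powr e - b powr e) - (r powr e - max r b powr e)\<bar> \<le> c2 s * a powr e"
        using c2_pos by (intro mult_left_mono) auto
      moreover have "\<bar>kern x y - far r x y\<bar>
          = c2 s * \<bar>(a powr e - b powr e) - (r powr e - max r b powr e)\<bar>"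
        unfolding k f right_diff_distrib[symmetric] using c2_pos by (simp add: abs_mult)
      moreover have "c2 s * a powr e \<le> near r (x - y)" unfolding near using c2_pos by simp
      ultimately show ?thesis by linarith
    qed
  qed
qed

lemma kern_le_near_far:
  assumes "0 < x $ 2" "0 < y $ 2" "0 < r"
  shows "kern x y \<le> near r (x - y) + far_const r * (x $ 2 * y $ 2)"
  using kern_far_diff[OF assms] far_le[OF assms] by linarith

lemma kern_le_separated:
  assumes "0 < x $ 2" "0 < y $ 2" "0 < r" "r \<le> norm (x - y)"
  shows "kern x y \<le> far_const r * (x $ 2 * y $ 2)"
  using kern_le_near_far[OF assms(1-3)] assms(4) by (simp add: near_def)

lemma far_const_small:
  assumes "0 < \<delta>"
  shows "\<exists>R>0. far_const R \<le> \<delta>"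
proof -
  have "((\<lambda>r. far_const r) \<longlongrightarrow> 4 * c2 s * (2 - 2 * s) * 0) at_top"
    unfolding far_const_def using s_less
    by (intro tendsto_intros tendsto_neg_powr filterlim_ident) auto
  then have "eventually (\<lambda>r. far_const r < \<delta>) at_top"
    using assms by (auto dest!: order_tendstoD(2)[where a = \<delta>])
  then have "eventually (\<lambda>r. far_const r < \<delta> \<and> r > 0) at_top"
    using eventually_gt_at_top by (rule eventually_conj)
  then obtain R where "far_const R < \<delta>" "R > 0"
    by (auto dest!: eventually_happens)
  then show ?thesis by (intro exI[of _ R]) auto
qed

text \<open>
  For points at distance at least \<open>R\<close> the constant \<open>far_const R\<close> is small.  For closer points both
  heights are large when \<open>x\<close> is high, so the bounded far part is dominated by a small multiple of the
  product of the heights.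
\<close>

lemma kern_le_high:
  assumes "0 < r" "0 < \<delta>"
  shows "\<exists>H. \<forall>x y. H < x $ 2 \<longrightarrow> 0 < x $ 2 \<longrightarrow> 0 < y $ 2 \<longrightarrow>
           kern x y \<le> near r (x - y) + \<delta> * (x $ 2 * y $ 2)"
proof -
  obtain R where R: "R > 0" "far_const R \<le> \<delta>" using far_const_small assms by blast
  define A where "A = c2 s * r powr (2 * s - 2)"
  have A: "A \<ge> 0" using c2_pos by (simp add: A_def)
  define H where "H = max (R + 1) (A / \<delta>)"
  have "kern x y \<le> near r (x - y) + \<delta> * (x $ 2 * y $ 2)" if xy: "H < x $ 2" "0 < x $ 2" "0 < y $ 2" for x y
  proof (cases "R \<le> norm (x - y)")
    case True
    have "kern x y \<le> far_const R * (x $ 2 * y $ 2)"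
      using kern_le_separated xy R True by blast
    also have "\<dots> \<le> \<delta> * (x $ 2 * y $ 2)" using xy R by (intro mult_right_mono) auto
    finally show ?thesis using near_nonneg[of r "x - y"] by linarith
  next
    case False
    have "\<bar>(x - y) $ 2\<bar> \<le> norm (x - y)" by (rule component_le_norm_cart)
    then have "y $ 2 \<ge> 1" using False xy by (auto simp: H_def)
    then have "x $ 2 \<le> x $ 2 * y $ 2" using xy by simp
    moreover have "A \<le> \<delta> * x $ 2" using xy assms by (simp add: H_def field_simps)
    ultimately have "A \<le> \<delta> * (x $ 2 * y $ 2)"
      using assms by (meson mult_left_mono order_trans less_imp_le)
    moreover have "kern x y \<le> near r (x - y) + A"
      using kern_far_diff[of x y r] far_le_const[of r x y] xy assms by (simp add: A_def)
    ultimately show ?thesis by linarith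
  qed
  then show ?thesis by blast
qed

end

section \<open>Smallness of the near part\<close>

lemma lborel_integrable_translate:
  fixes f :: "'a::euclidean_space \<Rightarrow> real"
  assumes "f \<in> borel_measurable borel"
  shows "integrable lborel (\<lambda>x. f (x + t)) \<longleftrightarrow> integrable lborel f"
proof -
  have "integrable lborel f \<longleftrightarrow> integrable (distr lborel borel ((+) t)) f"
    by (simp add: lborel_distr_plus)
  also have "\<dots> \<longleftrightarrow> integrable lborel (\<lambda>x. f (t + x))"
    using assms by (intro integrable_distr_eq) auto
  finally show ?thesis by (simp add: add.commute)
qed

lemma lborel_integral_translate:
  fixes f :: "'a::euclidean_space \<Rightarrow> real"
  assumes "f \<in> borel_measurable borel"
  shows "(\<integral>x. f (x + t) \<partial>lborel) = (\<integral>x. f x \<partial>lborel)"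
proof -
  have "(\<integral>x. f x \<partial>lborel) = (\<integral>x. f x \<partial>distr lborel borel ((+) t))"
    by (simp add: lborel_distr_plus)
  also have "\<dots> = (\<integral>x. f (t + x) \<partial>lborel)"
    using assms by (intro integral_distr) auto
  finally show ?thesis by (simp add: add.commute)
qed

context half_plane_kernel
begin

text \<open>
  On the annulus between the radii \<open>r / 2 ^ Suc k\<close> and \<open>r / 2 ^ k\<close> the term with index \<open>k\<close> dominates
  already.
\<close>

lemma near_le_dyadic:
  assumes "0 < r"
  shows "ennreal (near r z) \<le> (\<Sum>k. ennreal (c2 s * (r / 2 ^ Suc k) powr (2 * s - 2)) * indicator (ball 0 (r / 2 ^ k)) z)"
    (is "_ \<le> (\<Sum>k. ?t k)")
proof (cases "norm z < r")
  case False
  then show ?thesis by (simp add: near_def)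
next
  case True
  have "\<exists>k. norm z < r / 2 ^ k \<and> (z = 0 \<or> r / 2 ^ Suc k \<le> norm z)"
  proof (cases "z = 0")
    case False
    define P where "P = (\<lambda>n. r / 2 ^ n \<le> norm z)"
    have "(\<lambda>n. r * (1/2) ^ n) \<longlonglongrightarrow> r * 0"
      by (intro tendsto_intros LIMSEQ_power_zero) auto
    then have "eventually (\<lambda>n. r * (1/2) ^ n < norm z) sequentially"
      using False by (auto dest!: order_tendstoD(2)[where a = "norm z"])
    then obtain n where "r * (1/2) ^ n < norm z" by (auto dest!: eventually_happens)
    then have "P n" by (simp add: P_def power_one_over field_simps)
    then have "P (LEAST n. P n)" by (rule LeastI)
    moreover have "\<not> P 0" using \<open>norm z < r\<close> by (simp add: P_def)
    ultimately obtain k where k: "(LEAST n. P n) = Suc k" by (cases "LEAST n. P n") auto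
    then have "\<not> P k" using not_less_Least[of k P] by simp
    moreover have "P (Suc k)" using \<open>P (LEAST n. P n)\<close> k by simp
    ultimately show ?thesis by (auto simp: P_def intro!: exI[of _ k])
  qed (use assms in \<open>auto intro!: exI[of _ 0]\<close>)
  then obtain k where k: "norm z < r / 2 ^ k" "z = 0 \<or> r / 2 ^ Suc k \<le> norm z" by blast
  have pos: "0 < r / 2 ^ Suc k" using assms by simp
  have "r powr (2 * s - 2) \<le> (r / 2 ^ Suc k) powr (2 * s - 2)"
  proof (intro powr_mono2')
    have "r * 1 \<le> r * 2 ^ Suc k" using assms by (intro mult_left_mono one_le_power) auto
    then show "r / 2 ^ Suc k \<le> r" by (simp add: divide_le_eq)
  qed (use s_less pos in auto)
  moreover have "norm z powr (2 * s - 2) \<le> (r / 2 ^ Suc k) powr (2 * s - 2)"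
  proof (cases "z = 0")
    case False
    then show ?thesis using k pos s_less by (intro powr_mono2') auto
  qed simp
  ultimately have "near r z \<le> c2 s * (r / 2 ^ Suc k) powr (2 * s - 2)"
    using True c2_pos by (simp add: near_def)
  then have "ennreal (near r z) \<le> ?t k" using k by (simp add: ennreal_leI)
  also have "\<dots> \<le> (\<Sum>k. ?t k)"
  proof -
    define T where "T = ?t"
    have "T k \<le> suminf T" using sum_le_suminf[of T "{k}"] by simp
    then show ?thesis by (simp only: T_def)
  qed
  finally show ?thesis .
qed

text \<open>
  The dyadic bound integrates to a geometric series with ratio \<open>(1/2) powr (2 * s)\<close>: the singularity
  is integrable because the dimension exceeds the exponent \<open>2 - 2 * s\<close> by \<open>2 * s\<close>.
\<close>

lemma near_nn_integral:
  "\<exists>C>0. \<forall>r>0. (\<integral>\<^sup>+z. ennreal (near r z) \<partial>lborel) \<le> ennreal (C * r powr (2 * s))"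
proof -
  define V where "V = unit_ball_vol (real DIM(real^2))"
  have V: "V > 0" by (simp add: V_def)
  define q where "q = (1/2) powr (2 * s)"
  have q: "0 < q" "q < 1" using s_pos using powr_less_mono2[of "2 * s" "1/2" 1] by (simp_all add: q_def)
  define D where "D = c2 s * (1/2) powr (2 * s - 2) * V"
  have D: "D > 0" using c2_pos V by (simp add: D_def)
  have "(\<integral>\<^sup>+z. ennreal (near r z) \<partial>lborel) \<le> ennreal (D / (1 - q) * r powr (2 * s))" if "r > 0" for r
  proof -
    let ?t = "\<lambda>k z. ennreal (c2 s * (r / 2 ^ Suc k) powr (2 * s - 2)) * indicator (ball (0::real^2) (r / 2 ^ k)) z"
    have "(\<integral>\<^sup>+z. ennreal (near r z) \<partial>lborel) \<le> (\<integral>\<^sup>+z. (\<Sum>k. ?t k z) \<partial>lborel)"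
      using near_le_dyadic[OF \<open>r > 0\<close>] by (intro nn_integral_mono) auto
    also have "\<dots> = (\<Sum>k. \<integral>\<^sup>+z. ?t k z \<partial>lborel)"
    proof (rule nn_integral_suminf)
      show "?t k \<in> borel_measurable lborel" for k
        by (rule borel_measurable_times_ennreal[OF borel_measurable_const borel_measurable_indicator]) simp
    qed
    also have "\<dots> = (\<Sum>k. ennreal (D * r powr (2 * s) * q ^ k))"
    proof (intro suminf_cong)
      fix k
      define m where "m = r / 2 ^ k"
      have m: "m > 0" using that by (simp add: m_def)
      have "(\<integral>\<^sup>+z. ?t k z \<partial>lborel) = ennreal (c2 s * (m / 2) powr (2 * s - 2)) * emeasure lborel (ball (0::real^2) m)"
        by (subst nn_integral_cmult_indicator) (simp_all add: m_def mult.commute)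
      also have "\<dots> = ennreal (c2 s * (m / 2) powr (2 * s - 2) * (V * m ^ 2))"
        using m c2_pos by (simp add: emeasure_ball V_def flip: ennreal_mult)
      also have "c2 s * (m / 2) powr (2 * s - 2) * (V * m ^ 2) = D * m powr (2 * s)"
      proof -
        have "(m / 2) powr (2 * s - 2) = (1/2) powr (2 * s - 2) * m powr (2 * s - 2)"
          using m powr_mult[of "1/2" m "2 * s - 2"] by (simp add: powr_mult[symmetric])
        moreover have "m powr (2 * s - 2) * m ^ 2 = m powr (2 * s)"
        proof -
          have "m powr (2 * s - 2) * m powr 2 = m powr (2 * s)" by (simp flip: powr_add)
          then show ?thesis using m by (simp add: powr_numeral)
        qed
        ultimately show ?thesis by (simp add: D_def algebra_simps)
      qed
      also have "m powr (2 * s) = r powr (2 * s) * q ^ k"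
      proof -
        have "m = r * (1/2) ^ k" by (simp add: m_def power_one_over field_simps)
        then have "m powr (2 * s) = r powr (2 * s) * ((1/2) ^ k) powr (2 * s)"
          using that by (simp add: powr_mult)
        also have "((1/2::real) ^ k) powr (2 * s) = q ^ k"
          by (simp add: q_def powr_powr powr_realpow[symmetric] mult.commute)
        finally show ?thesis .
      qed
      finally show "(\<integral>\<^sup>+z. ?t k z \<partial>lborel) = ennreal (D * r powr (2 * s) * q ^ k)"
        by (simp add: mult_ac)
    qed
    also have "\<dots> = ennreal (D * r powr (2 * s) * (1 / (1 - q)))"
    proof (rule suminf_ennreal_eq)
      show "(\<lambda>k. D * r powr (2 * s) * q ^ k) sums (D * r powr (2 * s) * (1 / (1 - q)))"
        using q by (intro sums_mult geometric_sums) auto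
    qed (use D q in auto)
    finally show ?thesis by (simp add: mult_ac)
  qed
  then show ?thesis using D q by (intro exI[of _ "D / (1 - q)"]) auto
qed

definition near_mass :: "real \<Rightarrow> real" where
  "near_mass r = (\<integral>z. near r z \<partial>lborel)"

lemma near_integrable:
  assumes "0 < r"
  shows "integrable lborel (near r)"
proof (rule integrableI_bounded)
  show "(\<integral>\<^sup>+z. ennreal (norm (near r z)) \<partial>lborel) < \<infinity>"
    using near_nn_integral assms by (auto simp: near_nonneg abs_of_nonneg top.not_eq_extremum intro: le_less_trans)
qed simp

lemma near_mass_nonneg: "0 \<le> near_mass r"
  unfolding near_mass_def by (intro Bochner_Integration.integral_nonneg) (simp add: near_nonneg)

lemma near_mass_small:
  assumes "0 < \<epsilon>"
  shows "\<exists>r>0. near_mass r \<le> \<epsilon>"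
proof -
  obtain C where C: "C > 0" "\<And>r. r > 0 \<Longrightarrow> (\<integral>\<^sup>+z. ennreal (near r z) \<partial>lborel) \<le> ennreal (C * r powr (2 * s))"
    using near_nn_integral by blast
  define r where "r = (\<epsilon> / C) powr (1 / (2 * s))"
  have r: "r > 0" using C assms by (simp add: r_def)
  have "C * r powr (2 * s) = \<epsilon>" using C assms s_pos by (simp add: r_def powr_powr)
  then have "ennreal (near_mass r) \<le> ennreal \<epsilon>"
    using C(2)[OF r] near_integrable[OF r]
    by (simp add: near_mass_def nn_integral_eq_integral near_nonneg)
  then show ?thesis using r assms by auto
qed

lemma near_mass_translate:
  "(\<integral>y. near r (x - y) \<partial>lborel) = near_mass r"
  using lborel_integral_translate[of "near r" "- x"] by (simp add: near_mass_def near_minus[of r x])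

lemma near_integrable_translate:
  assumes "0 < r" shows "integrable lborel (\<lambda>y. near r (x - y))"
  using lborel_integrable_translate[of "near r" "- x"] near_integrable[OF assms] by (simp add: near_minus[of r x])

end

section \<open>Profiles and bilinear forms\<close>

text \<open>
  The functions on which the energy is finite without any bound on the mass.  They are Borel
  measurable, so that product measures are available, and may change sign, so that differences of
  vorticities are included.
\<close>

definition profile :: "(real^2 \<Rightarrow> real) \<Rightarrow> bool" where
  "profile f \<longleftrightarrow> f \<in> borel_measurable borel \<and> (\<forall>x. x $ 2 \<le> 0 \<longrightarrow> f x = 0) \<and>
     integrable lborel (\<lambda>x. (f x)\<^sup>2) \<and> integrable lborel (\<lambda>x. x $ 2 * f x)"

text \<open>
  The square of the \<open>L\<^sup>2\<close> norm, and the impulse of the absolute value.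
\<close>

definition sqn :: "(real^2 \<Rightarrow> real) \<Rightarrow> real" where
  "sqn f = (\<integral>x. (f x)\<^sup>2 \<partial>lborel)"

definition wt :: "(real^2 \<Rightarrow> real) \<Rightarrow> real" where
  "wt f = (\<integral>x. x $ 2 * \<bar>f x\<bar> \<partial>lborel)"

definition bil :: "(real^2 \<Rightarrow> real^2 \<Rightarrow> real) \<Rightarrow> (real^2 \<Rightarrow> real) \<Rightarrow> (real^2 \<Rightarrow> real) \<Rightarrow> real" where
  "bil k f g = (\<integral>p. f (fst p) * k (fst p) (snd p) * g (snd p) \<partial>(lborel \<Otimes>\<^sub>M lborel))"

lemma profileD [dest]:
  assumes "profile f"
  shows "f \<in> borel_measurable borel" "\<And>x. x $ 2 \<le> 0 \<Longrightarrow> f x = 0"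
    "integrable lborel (\<lambda>x. (f x)\<^sup>2)" "integrable lborel (\<lambda>x. x $ 2 * f x)"
  using assms by (auto simp: profile_def)

lemma profile_pos: "profile f \<Longrightarrow> f x \<noteq> 0 \<Longrightarrow> 0 < x $ 2"
  using profileD(2) by (metis not_le)

lemma profile_abs_weight: "profile f \<Longrightarrow> x $ 2 * \<bar>f x\<bar> = \<bar>x $ 2 * f x\<bar>"
  using profileD(2)[of f x] by (cases "x $ 2 \<le> 0") (auto simp: abs_mult)

lemma profile_integrable_wt: "profile f \<Longrightarrow> integrable lborel (\<lambda>x. x $ 2 * \<bar>f x\<bar>)"
  using profileD(4)[THEN integrable_abs] by (simp add: profile_abs_weight)

lemma profile_wt_nonneg_pt: "profile f \<Longrightarrow> 0 \<le> x $ 2 * \<bar>f x\<bar>"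
  by (simp add: profile_abs_weight)

lemma sqn_nonneg [simp]: "0 \<le> sqn f"
  unfolding sqn_def by (intro Bochner_Integration.integral_nonneg) auto

lemma wt_nonneg: "profile f \<Longrightarrow> 0 \<le> wt f"
  unfolding wt_def by (intro Bochner_Integration.integral_nonneg) (simp add: profile_abs_weight)

lemma profile_integrable_mult:
  assumes "profile f" "profile g"
  shows "integrable lborel (\<lambda>x. f x * g x)"
proof (rule Bochner_Integration.integrable_bound)
  show "integrable lborel (\<lambda>x. ((f x)\<^sup>2 + (g x)\<^sup>2) / 2)"
    using assms by (intro integrable_divide Bochner_Integration.integrable_add) auto
  show "(\<lambda>x. f x * g x) \<in> borel_measurable lborel"
    using assms[THEN profileD(1)] by simp
  show "AE x in lborel. norm (f x * g x) \<le> norm (((f x)\<^sup>2 + (g x)\<^sup>2) / 2)"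
  proof (intro AE_I2)
    fix x
    have "\<bar>f x * g x\<bar> \<le> ((f x)\<^sup>2 + (g x)\<^sup>2) / 2"
      using sum_squares_bound[of "\<bar>f x\<bar>" "\<bar>g x\<bar>"] by (simp add: abs_mult)
    then show "norm (f x * g x) \<le> norm (((f x)\<^sup>2 + (g x)\<^sup>2) / 2)" by simp
  qed
qed

lemma profile_lincomb:
  assumes "profile f" "profile g"
  shows "profile (\<lambda>x. a * f x + b * g x)"
proof -
  have [measurable]: "f \<in> borel_measurable borel" "g \<in> borel_measurable borel" using assms by auto
  have "integrable lborel (\<lambda>x. a\<^sup>2 * (f x)\<^sup>2 + (2 * a * b) * (f x * g x) + b\<^sup>2 * (g x)\<^sup>2)"
    using assms profile_integrable_mult[OF assms]
    by (intro Bochner_Integration.integrable_add integrable_mult_right) auto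
  then have "integrable lborel (\<lambda>x. (a * f x + b * g x)\<^sup>2)"
    by (rule Bochner_Integration.integrable_cong[THEN iffD1, rotated 2])
       (auto simp: power2_eq_square algebra_simps)
  moreover have "integrable lborel (\<lambda>x. a * (x $ 2 * f x) + b * (x $ 2 * g x))"
    using assms by (intro Bochner_Integration.integrable_add integrable_mult_right) auto
  then have "integrable lborel (\<lambda>x. x $ 2 * (a * f x + b * g x))"
    by (rule Bochner_Integration.integrable_cong[THEN iffD1, rotated 2]) (auto simp: algebra_simps)
  ultimately show ?thesis using assms by (auto simp: profile_def)
qed

lemma profile_cmult: "profile f \<Longrightarrow> profile (\<lambda>x. a * f x)"
  using profile_lincomb[of f f a 0] by simp

lemma profile_add: "profile f \<Longrightarrow> profile g \<Longrightarrow> profile (\<lambda>x. f x + g x)"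
  using profile_lincomb[of f g 1 1] by simp

lemma profile_diff: "profile f \<Longrightarrow> profile g \<Longrightarrow> profile (\<lambda>x. f x - g x)"
  using profile_lincomb[of f g 1 "-1"] by simp

lemma profile_dominated:
  assumes "profile f" and [measurable]: "g \<in> borel_measurable borel"
    and le: "\<And>x. \<bar>g x\<bar> \<le> \<bar>f x\<bar>"
  shows "profile g"
  unfolding profile_def
proof (intro conjI allI impI)
  have [measurable]: "f \<in> borel_measurable borel" using assms by auto
  show "g x = 0" if "x $ 2 \<le> 0" for x using le[of x] profileD(2)[OF assms(1) that] by simp
  show "integrable lborel (\<lambda>x. (g x)\<^sup>2)"
    by (rule Bochner_Integration.integrable_bound[OF profileD(3)[OF assms(1)]])
       (auto simp: abs_le_square_iff[symmetric] le)
  show "integrable lborel (\<lambda>x. x $ 2 * g x)"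
    by (rule Bochner_Integration.integrable_bound[OF profileD(4)[OF assms(1)]])
       (auto simp: abs_mult intro!: mult_left_mono le)
qed fact

lemma profile_restrict:
  assumes "profile f" "A \<in> sets borel"
  shows "profile (\<lambda>x. f x * indicator A x)"
  using profileD(1)[OF assms(1)] assms by (intro profile_dominated[OF assms(1)]) (auto simp: indicator_def)

context half_plane_kernel
begin

text \<open>
  Bounds that make \<open>bil\<close> converge on profiles; both the Green kernel and its far part obey them.
\<close>

definition controlled :: "(real^2 \<Rightarrow> real^2 \<Rightarrow> real) \<Rightarrow> bool" where
  "controlled k \<longleftrightarrow> (\<lambda>p. k (fst p) (snd p)) \<in> borel_measurable (borel \<Otimes>\<^sub>M borel) \<and>
     (\<exists>r>0. \<exists>\<theta>\<ge>0. \<exists>\<delta>\<ge>0. \<forall>x y. 0 < x $ 2 \<longrightarrow> 0 < y $ 2 \<longrightarrow>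
        \<bar>k x y\<bar> \<le> \<theta> * near r (x - y) + \<delta> * (x $ 2 * y $ 2))"

lemma near_product:
  fixes u :: "real^2 \<Rightarrow> real"
  assumes u: "integrable lborel u" and r: "0 < r"
  shows "integrable (lborel \<Otimes>\<^sub>M lborel) (\<lambda>p. u (fst p) * near r (fst p - snd p))"
    and "(\<integral>p. u (fst p) * near r (fst p - snd p) \<partial>(lborel \<Otimes>\<^sub>M lborel)) = near_mass r * (\<integral>x. u x \<partial>lborel)"
proof -
  have [measurable]: "u \<in> borel_measurable borel" using u by auto
  show int: "integrable (lborel \<Otimes>\<^sub>M lborel) (\<lambda>p. u (fst p) * near r (fst p - snd p))"
  proof (rule lborel_pair.Fubini_integrable)
    have "(\<integral>y. norm (u (fst (x, y)) * near r (fst (x, y) - snd (x, y))) \<partial>lborel) = near_mass r * \<bar>u x\<bar>" for x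
      by (simp add: abs_mult near_nonneg near_mass_translate)
    then show "integrable lborel (\<lambda>x. \<integral>y. norm (u (fst (x, y)) * near r (fst (x, y) - snd (x, y))) \<partial>lborel)"
      using u by simp
    show "AE x in lborel. integrable lborel (\<lambda>y. u (fst (x, y)) * near r (fst (x, y) - snd (x, y)))"
      using near_integrable_translate[OF r] by simp
  qed measurable
  have "(\<integral>p. u (fst p) * near r (fst p - snd p) \<partial>(lborel \<Otimes>\<^sub>M lborel))
      = (\<integral>x. \<integral>y. u x * near r (x - y) \<partial>lborel \<partial>lborel)"
    using lborel_pair.integral_fst'[OF int] by simp
  also have "\<dots> = (\<integral>x. u x * near_mass r \<partial>lborel)" by (simp add: near_mass_translate)
  finally show "(\<integral>p. u (fst p) * near r (fst p - snd p) \<partial>(lborel \<Otimes>\<^sub>M lborel)) = near_mass r * (\<integral>x. u x \<partial>lborel)"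
    by (simp add: mult.commute)
qed

lemma near_product_snd:
  fixes u :: "real^2 \<Rightarrow> real"
  assumes u: "integrable lborel u" and r: "0 < r"
  shows "integrable (lborel \<Otimes>\<^sub>M lborel) (\<lambda>p. u (snd p) * near r (fst p - snd p))"
    and "(\<integral>p. u (snd p) * near r (fst p - snd p) \<partial>(lborel \<Otimes>\<^sub>M lborel)) = near_mass r * (\<integral>x. u x \<partial>lborel)"
proof -
  have [measurable]: "u \<in> borel_measurable borel" using u by auto
  have eq: "(\<lambda>(x, y). u (fst (y, x)) * near r (fst (y, x) - snd (y, x))) = (\<lambda>p. u (snd p) * near r (fst p - snd p))"
    by (auto simp: near_minus[of r])
  show "integrable (lborel \<Otimes>\<^sub>M lborel) (\<lambda>p. u (snd p) * near r (fst p - snd p))"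
    using lborel_pair.integrable_product_swap[OF near_product(1)[OF assms]] unfolding eq .
  have "(\<integral>(x, y). u (fst (y, x)) * near r (fst (y, x) - snd (y, x)) \<partial>(lborel \<Otimes>\<^sub>M lborel))
      = (\<integral>p. u (fst p) * near r (fst p - snd p) \<partial>(lborel \<Otimes>\<^sub>M lborel))"
    by (rule lborel_pair.integral_product_swap) measurable
  then show "(\<integral>p. u (snd p) * near r (fst p - snd p) \<partial>(lborel \<Otimes>\<^sub>M lborel)) = near_mass r * (\<integral>x. u x \<partial>lborel)"
    unfolding eq near_product(2)[OF assms] .
qed

lemma lborel_product:
  fixes u v :: "real^2 \<Rightarrow> real"
  assumes u: "integrable lborel u" and v: "integrable lborel v"
  shows "integrable (lborel \<Otimes>\<^sub>M lborel) (\<lambda>p. u (fst p) * v (snd p))"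
    and "(\<integral>p. u (fst p) * v (snd p) \<partial>(lborel \<Otimes>\<^sub>M lborel)) = (\<integral>x. u x \<partial>lborel) * (\<integral>x. v x \<partial>lborel)"
proof -
  have [measurable]: "u \<in> borel_measurable borel" "v \<in> borel_measurable borel" using u v by auto
  show int: "integrable (lborel \<Otimes>\<^sub>M lborel) (\<lambda>p. u (fst p) * v (snd p))"
    using u v by (intro lborel_pair.Fubini_integrable) (auto simp: abs_mult)
  show "(\<integral>p. u (fst p) * v (snd p) \<partial>(lborel \<Otimes>\<^sub>M lborel)) = (\<integral>x. u x \<partial>lborel) * (\<integral>x. v x \<partial>lborel)"
    using lborel_pair.integral_fst'[OF int] by simp
qed

text \<open>
  In the near part, \<open>\<bar>f x\<bar> * \<bar>g y\<bar>\<close> is at most the mean of \<open>(f x)\<^sup>2\<close> and \<open>(g y)\<^sup>2\<close>, and integrating out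
  the other variable leaves the factor \<open>near_mass r\<close>.  The weighted part is an integral of a product.
\<close>

lemma bil_bound:
  assumes f: "profile f" and g: "profile g"
    and k [measurable]: "(\<lambda>p. k (fst p) (snd p)) \<in> borel_measurable (borel \<Otimes>\<^sub>M borel)"
    and r: "0 < r"
    and le: "\<And>x y. f x \<noteq> 0 \<Longrightarrow> g y \<noteq> 0 \<Longrightarrow> 0 < x $ 2 \<Longrightarrow> 0 < y $ 2 \<Longrightarrow>
       \<bar>k x y\<bar> \<le> \<theta> * near r (x - y) + \<delta> * (x $ 2 * y $ 2)"
    and \<theta>: "0 \<le> \<theta>"
  shows "integrable (lborel \<Otimes>\<^sub>M lborel) (\<lambda>p. f (fst p) * k (fst p) (snd p) * g (snd p))"
    and "\<bar>bil k f g\<bar> \<le> \<theta> * near_mass r / 2 * (sqn f + sqn g) + \<delta> * (wt f * wt g)"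
proof -
  have [measurable]: "f \<in> borel_measurable borel" "g \<in> borel_measurable borel" using f g by auto
  define h where "h p = \<theta> / 2 * ((f (fst p))\<^sup>2 * near r (fst p - snd p))
      + \<theta> / 2 * ((g (snd p))\<^sup>2 * near r (fst p - snd p))
      + \<delta> * ((fst p $ 2 * \<bar>f (fst p)\<bar>) * (snd p $ 2 * \<bar>g (snd p)\<bar>))" for p
  note ints = near_product[OF profileD(3)[OF f] r] near_product_snd[OF profileD(3)[OF g] r]
    lborel_product[OF profile_integrable_wt[OF f] profile_integrable_wt[OF g]]
  have "has_bochner_integral (lborel \<Otimes>\<^sub>M lborel) h
     (\<theta> / 2 * (near_mass r * sqn f) + \<theta> / 2 * (near_mass r * sqn g) + \<delta> * (wt f * wt g))"
    unfolding h_def using ints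
    by (intro has_bochner_integral_add has_bochner_integral_mult_right)
       (simp_all add: has_bochner_integral_iff sqn_def wt_def)
  then have h: "integrable (lborel \<Otimes>\<^sub>M lborel) h"
    and hint: "(\<integral>p. h p \<partial>(lborel \<Otimes>\<^sub>M lborel)) = \<theta> * near_mass r / 2 * (sqn f + sqn g) + \<delta> * (wt f * wt g)"
    by (simp_all add: has_bochner_integral_iff field_simps)
  have pt: "\<bar>f x * k x y * g y\<bar> \<le> h (x, y)" for x y
  proof (cases "f x = 0 \<or> g y = 0")
    case True
    then show ?thesis
      using \<theta> by (auto simp: h_def near_nonneg)
  next
    case False
    then have pos: "0 < x $ 2" "0 < y $ 2" using f g profile_pos by blast+
    have "\<bar>f x * k x y * g y\<bar> = \<bar>k x y\<bar> * (\<bar>f x\<bar> * \<bar>g y\<bar>)" by (simp add: abs_mult)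
    also have "\<dots> \<le> (\<theta> * near r (x - y) + \<delta> * (x $ 2 * y $ 2)) * (\<bar>f x\<bar> * \<bar>g y\<bar>)"
      using le[of x y] False pos by (intro mult_right_mono) auto
    also have "\<dots> = \<theta> * near r (x - y) * (\<bar>f x\<bar> * \<bar>g y\<bar>) + \<delta> * ((x $ 2 * \<bar>f x\<bar>) * (y $ 2 * \<bar>g y\<bar>))"
      by (simp add: algebra_simps)
    also have "\<theta> * near r (x - y) * (\<bar>f x\<bar> * \<bar>g y\<bar>) \<le> \<theta> * near r (x - y) * (((f x)\<^sup>2 + (g y)\<^sup>2) / 2)"
      using sum_squares_bound[of "\<bar>f x\<bar>" "\<bar>g y\<bar>"] \<theta> by (intro mult_left_mono) (auto simp: near_nonneg)
    finally show ?thesis by (simp add: h_def field_simps)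
  qed
  show int: "integrable (lborel \<Otimes>\<^sub>M lborel) (\<lambda>p. f (fst p) * k (fst p) (snd p) * g (snd p))"
  proof (rule Bochner_Integration.integrable_bound[OF h])
    show "AE p in lborel \<Otimes>\<^sub>M lborel. norm (f (fst p) * k (fst p) (snd p) * g (snd p)) \<le> norm (h p)"
    proof (intro AE_I2)
      fix p :: "(real^2) \<times> (real^2)"
      show "norm (f (fst p) * k (fst p) (snd p) * g (snd p)) \<le> norm (h p)"
        using pt[of "fst p" "snd p"] by simp
    qed
  qed measurable
  have "\<bar>bil k f g\<bar> \<le> (\<integral>p. \<bar>f (fst p) * k (fst p) (snd p) * g (snd p)\<bar> \<partial>(lborel \<Otimes>\<^sub>M lborel))"
    unfolding bil_def by (rule integral_abs_bound)
  also have "\<dots> \<le> (\<integral>p. h p \<partial>(lborel \<Otimes>\<^sub>M lborel))"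
    using int h pt by (intro integral_mono) (auto intro: order_trans)
  finally show "\<bar>bil k f g\<bar> \<le> \<theta> * near_mass r / 2 * (sqn f + sqn g) + \<delta> * (wt f * wt g)"
    unfolding hint .
qed

lemma controlled_integrable:
  assumes "controlled k" "profile f" "profile g"
  shows "integrable (lborel \<Otimes>\<^sub>M lborel) (\<lambda>p. f (fst p) * k (fst p) (snd p) * g (snd p))"
proof -
  obtain r \<theta> \<delta> where *: "r > 0" "\<theta> \<ge> 0" "\<delta> \<ge> 0"
    "\<And>x y. 0 < x $ 2 \<Longrightarrow> 0 < y $ 2 \<Longrightarrow> \<bar>k x y\<bar> \<le> \<theta> * near r (x - y) + \<delta> * (x $ 2 * y $ 2)"
    and k: "(\<lambda>p. k (fst p) (snd p)) \<in> borel_measurable (borel \<Otimes>\<^sub>M borel)"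
    using assms(1) unfolding controlled_def by blast
  show ?thesis by (rule bil_bound(1)[OF assms(2,3) k *(1) *(4) *(2)])
qed

lemma controlledI:
  assumes "(\<lambda>p. k (fst p) (snd p)) \<in> borel_measurable (borel \<Otimes>\<^sub>M borel)" "0 < r" "0 \<le> \<theta>" "0 \<le> \<delta>"
    and "\<And>x y. 0 < x $ 2 \<Longrightarrow> 0 < y $ 2 \<Longrightarrow> \<bar>k x y\<bar> \<le> \<theta> * near r (x - y) + \<delta> * (x $ 2 * y $ 2)"
  shows "controlled k"
  unfolding controlled_def using assms by blast

lemma controlled_kern: "controlled kern"
proof (rule controlledI[of _ 1 1 "far_const 1"])
  show "\<bar>kern x y\<bar> \<le> 1 * near 1 (x - y) + far_const 1 * (x $ 2 * y $ 2)" if "0 < x $ 2" "0 < y $ 2" for x y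
    using kern_le_near_far[OF that, of 1] kern_nonneg[OF that] by simp
qed (auto simp: far_const_nonneg)

lemma controlled_far:
  assumes "0 < r" shows "controlled (far r)"
proof (rule controlledI[of _ 1 0 "far_const r"])
  show "\<bar>far r x y\<bar> \<le> 0 * near 1 (x - y) + far_const r * (x $ 2 * y $ 2)" if "0 < x $ 2" "0 < y $ 2" for x y
    using far_le[OF that assms] far_nonneg[OF that assms] by simp
qed (auto simp: far_const_nonneg)

lemma bil_lincomb_left:
  assumes "controlled k" "profile f" "profile g" "profile h"
  shows "bil k (\<lambda>x. a * f x + b * g x) h = a * bil k f h + b * bil k g h"
proof -
  have "bil k (\<lambda>x. a * f x + b * g x) h =
     (\<integral>p. a * (f (fst p) * k (fst p) (snd p) * h (snd p)) + b * (g (fst p) * k (fst p) (snd p) * h (snd p))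
        \<partial>(lborel \<Otimes>\<^sub>M lborel))"
    unfolding bil_def by (intro Bochner_Integration.integral_cong) (auto simp: algebra_simps)
  also have "\<dots> = a * bil k f h + b * bil k g h"
    unfolding bil_def using assms controlled_integrable by (subst Bochner_Integration.integral_add) auto
  finally show ?thesis .
qed

lemma bil_lincomb_right:
  assumes "controlled k" "profile f" "profile g" "profile h"
  shows "bil k h (\<lambda>x. a * f x + b * g x) = a * bil k h f + b * bil k h g"
proof -
  have "bil k h (\<lambda>x. a * f x + b * g x) =
     (\<integral>p. a * (h (fst p) * k (fst p) (snd p) * f (snd p)) + b * (h (fst p) * k (fst p) (snd p) * g (snd p))
        \<partial>(lborel \<Otimes>\<^sub>M lborel))"
    unfolding bil_def by (intro Bochner_Integration.integral_cong) (auto simp: algebra_simps)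
  also have "\<dots> = a * bil k h f + b * bil k h g"
    unfolding bil_def using assms controlled_integrable by (subst Bochner_Integration.integral_add) auto
  finally show ?thesis .
qed

lemma bil_commute:
  assumes "profile f" "profile g"
  shows "bil kern f g = bil kern g f"
proof -
  have [measurable]: "f \<in> borel_measurable borel" "g \<in> borel_measurable borel" using assms by auto
  have "bil kern f g = (\<integral>(x, y). f (fst (y, x)) * kern (fst (y, x)) (snd (y, x)) * g (snd (y, x)) \<partial>(lborel \<Otimes>\<^sub>M lborel))"
    unfolding bil_def by (rule lborel_pair.integral_product_swap[symmetric]) measurable
  also have "\<dots> = bil kern g f"
    unfolding bil_def by (intro Bochner_Integration.integral_cong) (auto simp: kern_commute)
  finally show ?thesis .
qed

lemma bil_nonneg:
  assumes "profile f" "profile g" "\<And>x. 0 \<le> f x" "\<And>x. 0 \<le> g x"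
  shows "0 \<le> bil kern f g"
  unfolding bil_def
proof (intro Bochner_Integration.integral_nonneg)
  fix p :: "(real^2) \<times> (real^2)"
  show "0 \<le> f (fst p) * kern (fst p) (snd p) * g (snd p)"
  proof (cases "f (fst p) = 0 \<or> g (snd p) = 0")
    case False
    then have "0 \<le> kern (fst p) (snd p)"
      using profile_pos[OF assms(1)] profile_pos[OF assms(2)] by (intro kern_nonneg) auto
    then show ?thesis using assms(3,4) by simp
  qed auto
qed

lemma bil_translate:
  assumes "profile f" "profile g" "t $ 2 = 0"
  shows "bil kern (\<lambda>x. f (x + t)) (\<lambda>x. g (x + t)) = bil kern f g"
proof -
  have [measurable]: "f \<in> borel_measurable borel" "g \<in> borel_measurable borel" using assms by auto
  define F where "F p = f (fst p) * kern (fst p) (snd p) * g (snd p)" for p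
  have [measurable]: "F \<in> borel_measurable (borel \<Otimes>\<^sub>M borel)" unfolding F_def by measurable
  have F: "F \<in> borel_measurable borel" by (simp flip: borel_prod)
  have "reflect (y + t) = reflect y + t" for y
    using assms(3) by (simp add: vec_eq_iff forall_2)
  then have "kern (x + t) (y + t) = kern x y" for x y
    by (simp add: kern_def green_eq)
  then have "bil kern (\<lambda>x. f (x + t)) (\<lambda>x. g (x + t)) = (\<integral>p. F (p + (t, t)) \<partial>lborel)"
    unfolding bil_def F_def lborel_prod
    by (intro Bochner_Integration.integral_cong) auto
  also have "\<dots> = (\<integral>p. F p \<partial>lborel)" by (rule lborel_integral_translate[OF F])
  finally show ?thesis by (simp add: bil_def F_def lborel_prod)
qed

end

section \<open>The homogeneous variational problem\<close>

lemma sqn_lincomb: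
  assumes "profile f" "profile g"
  shows "sqn (\<lambda>x. a * f x + b * g x) = a\<^sup>2 * sqn f + 2 * a * b * (\<integral>x. f x * g x \<partial>lborel) + b\<^sup>2 * sqn g"
proof -
  have "sqn (\<lambda>x. a * f x + b * g x) = (\<integral>x. a\<^sup>2 * (f x)\<^sup>2 + 2 * a * b * (f x * g x) + b\<^sup>2 * (g x)\<^sup>2 \<partial>lborel)"
    unfolding sqn_def by (intro Bochner_Integration.integral_cong) (auto simp: power2_eq_square algebra_simps)
  also have "\<dots> = a\<^sup>2 * sqn f + 2 * a * b * (\<integral>x. f x * g x \<partial>lborel) + b\<^sup>2 * sqn g"
    unfolding sqn_def using assms profile_integrable_mult[OF assms] profileD(3)
    by (simp add: Bochner_Integration.integral_add)
  finally show ?thesis .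
qed

lemma sqn_cmult: "sqn (\<lambda>x. a * f x) = a\<^sup>2 * sqn f"
  by (simp add: sqn_def power_mult_distrib)

lemma wt_cmult: "wt (\<lambda>x. a * f x) = \<bar>a\<bar> * wt f"
proof -
  have "wt (\<lambda>x. a * f x) = (\<integral>x. \<bar>a\<bar> * (x $ 2 * \<bar>f x\<bar>) \<partial>lborel)"
    unfolding wt_def by (intro Bochner_Integration.integral_cong) (auto simp: abs_mult)
  then show ?thesis by (simp add: wt_def)
qed

lemma wt_mono:
  assumes "profile f" "profile g" "\<And>x. \<bar>f x\<bar> \<le> \<bar>g x\<bar>"
  shows "wt f \<le> wt g"
  unfolding wt_def
proof (rule integral_mono)
  show "x $ 2 * \<bar>f x\<bar> \<le> x $ 2 * \<bar>g x\<bar>" for x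
    using assms(3)[of x] profileD(2)[OF assms(1), of x] profileD(2)[OF assms(2), of x]
    by (cases "x $ 2 \<le> 0") (auto intro: mult_left_mono)
qed (use assms profile_integrable_wt in auto)

lemma wt_triangle:
  assumes "profile f" "profile g" "profile h" "\<And>x. \<bar>h x\<bar> \<le> \<bar>f x\<bar> + \<bar>g x\<bar>"
  shows "wt h \<le> wt f + wt g"
proof -
  have "wt h \<le> (\<integral>x. x $ 2 * \<bar>f x\<bar> + x $ 2 * \<bar>g x\<bar> \<partial>lborel)"
    unfolding wt_def
  proof (rule integral_mono)
    show "x $ 2 * \<bar>h x\<bar> \<le> x $ 2 * \<bar>f x\<bar> + x $ 2 * \<bar>g x\<bar>" for x
    proof (cases "x $ 2 \<le> 0")
      case False
      then have "x $ 2 * \<bar>h x\<bar> \<le> x $ 2 * (\<bar>f x\<bar> + \<bar>g x\<bar>)"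
        using assms(4)[of x] by (intro mult_left_mono) auto
      then show ?thesis by (simp add: distrib_left)
    qed (use profileD(2)[OF assms(1), of x] profileD(2)[OF assms(2), of x] profileD(2)[OF assms(3), of x] in simp)
  qed (use assms profile_integrable_wt in auto)
  then show ?thesis using assms by (simp add: wt_def profile_integrable_wt)
qed

lemma wt_diff_le: "profile f \<Longrightarrow> profile g \<Longrightarrow> wt (\<lambda>x. f x - g x) \<le> wt f + wt g"
  by (rule wt_triangle) (auto intro: profile_diff)

lemma wt_add:
  assumes "profile f" "profile g" "\<And>x. 0 \<le> f x" "\<And>x. 0 \<le> g x"
  shows "wt (\<lambda>x. f x + g x) = wt f + wt g"
proof -
  have "wt (\<lambda>x. f x + g x) = (\<integral>x. x $ 2 * \<bar>f x\<bar> + x $ 2 * \<bar>g x\<bar> \<partial>lborel)"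
    unfolding wt_def using assms(3,4) by (intro Bochner_Integration.integral_cong) (auto simp: distrib_left)
  also have "\<dots> = wt f + wt g"
    unfolding wt_def using assms(1,2) by (intro Bochner_Integration.integral_add profile_integrable_wt)
  finally show ?thesis .
qed

abbreviation cut :: "(real^2 \<Rightarrow> real) \<Rightarrow> (real^2) set \<Rightarrow> real^2 \<Rightarrow> real" where
  "cut f A \<equiv> \<lambda>x. f x * indicator A x"

lemma cut_cases: "f x = cut f A x + cut f (- A) x"
  by (simp add: indicator_def)

lemma wt_disjoint_sum:
  assumes "profile f" "A \<in> sets borel" "B \<in> sets borel" "A \<inter> B = {}"
  shows "wt (cut f (A \<union> B)) = wt (cut f A) + wt (cut f B)"
proof -
  have "wt (cut f (A \<union> B)) = (\<integral>x. x $ 2 * \<bar>cut f A x\<bar> + x $ 2 * \<bar>cut f B x\<bar> \<partial>lborel)"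
    unfolding wt_def using assms(4) by (intro Bochner_Integration.integral_cong) (auto simp: indicator_def)
  then show ?thesis using assms profile_restrict by (simp add: wt_def profile_integrable_wt)
qed

lemma sqn_disjoint_sum:
  assumes "profile f" "A \<in> sets borel" "B \<in> sets borel" "A \<inter> B = {}"
  shows "sqn (cut f (A \<union> B)) = sqn (cut f A) + sqn (cut f B)"
proof -
  have "sqn (cut f (A \<union> B)) = (\<integral>x. (cut f A x)\<^sup>2 + (cut f B x)\<^sup>2 \<partial>lborel)"
    unfolding sqn_def using assms(4) by (intro Bochner_Integration.integral_cong) (auto simp: indicator_def)
  also have "\<dots> = sqn (cut f A) + sqn (cut f B)"
    unfolding sqn_def using assms(1-3) by (intro Bochner_Integration.integral_add profileD(3) profile_restrict)
  finally show ?thesis .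
qed

lemma wt_split:
  assumes "profile f" "A \<in> sets borel"
  shows "wt f = wt (cut f A) + wt (cut f (- A))"
  using wt_disjoint_sum[of f A "- A"] assms by (simp add: Compl_partition)

lemma sqn_split:
  assumes "profile f" "A \<in> sets borel"
  shows "sqn f = sqn (cut f A) + sqn (cut f (- A))"
  using sqn_disjoint_sum[of f A "- A"] assms by (simp add: Compl_partition)

lemma wt_cut_le: "profile f \<Longrightarrow> A \<in> sets borel \<Longrightarrow> wt (cut f A) \<le> wt f"
  using wt_split[of f A] wt_nonneg[OF profile_restrict, of f "- A"] by auto

lemma sqn_cut_le: "profile f \<Longrightarrow> A \<in> sets borel \<Longrightarrow> sqn (cut f A) \<le> sqn f"
  using sqn_split[of f A] by auto

lemma wt_cut_mono:
  assumes "profile f" "A \<in> sets borel" "B \<in> sets borel" "A \<subseteq> B"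
  shows "wt (cut f A) \<le> wt (cut f B)"
  using assms by (intro wt_mono profile_restrict) (auto simp: indicator_def)

context half_plane_kernel
begin

definition En :: "(real^2 \<Rightarrow> real) \<Rightarrow> real" where
  "En f = bil kern f f / 2 - sqn f / 2"

lemma bil_bound_near_far:
  assumes "profile f" "profile g" "0 < r"
  shows "\<bar>bil kern f g\<bar> \<le> near_mass r / 2 * (sqn f + sqn g) + far_const r * (wt f * wt g)"
  using bil_bound(2)[OF assms(1,2) kern_measurable assms(3), of 1 "far_const r"]
    kern_le_near_far kern_nonneg assms(3) by simp

lemma bil_bound_separated:
  assumes "profile f" "profile g" "0 < r" "\<And>x y. f x \<noteq> 0 \<Longrightarrow> g y \<noteq> 0 \<Longrightarrow> r \<le> norm (x - y)"
  shows "\<bar>bil kern f g\<bar> \<le> far_const r * (wt f * wt g)"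
  using bil_bound(2)[OF assms(1,2) kern_measurable assms(3), of 0 "far_const r"]
    kern_le_separated kern_nonneg assms(3,4) by simp

text \<open>
  The near part is small by the choice of \<open>r\<close> alone, uniformly for bounded \<open>sqn\<close>; after that \<open>\<delta>\<close>
  compensates for \<open>far_const r\<close>, which is large for small \<open>r\<close>.
\<close>

lemma bil_small:
  assumes "0 \<le> Q" "0 \<le> M" "0 < \<epsilon>"
  shows "\<exists>\<delta>>0. \<forall>f g. profile f \<longrightarrow> profile g \<longrightarrow> sqn f \<le> Q \<longrightarrow> sqn g \<le> Q \<longrightarrow> wt f \<le> M \<longrightarrow>
    wt g \<le> \<delta> \<longrightarrow> \<bar>bil kern f g\<bar> \<le> \<epsilon>"
proof -
  obtain r where r: "r > 0" "near_mass r \<le> \<epsilon> / (2 * (Q + 1))"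
    using near_mass_small[of "\<epsilon> / (2 * (Q + 1))"] assms by auto
  define \<delta> where "\<delta> = \<epsilon> / (2 * (far_const r + 1) * (M + 1))"
  have fc: "far_const r \<ge> 0" by (rule far_const_nonneg)
  have \<delta>: "\<delta> > 0" using assms fc by (simp add: \<delta>_def)
  have "\<bar>bil kern f g\<bar> \<le> \<epsilon>" if h: "profile f" "profile g" "sqn f \<le> Q" "sqn g \<le> Q" "wt f \<le> M" "wt g \<le> \<delta>" for f g
  proof -
    have "near_mass r / 2 * (sqn f + sqn g) \<le> \<epsilon> / (2 * (Q + 1)) / 2 * (2 * (Q + 1))"
      using r h assms near_mass_nonneg[of r] by (intro mult_mono divide_right_mono) auto
    also have "\<dots> = \<epsilon> / 2"
    proof -
      have "\<epsilon> / (2 * R) / 2 * (2 * R) = \<epsilon> / 2" if "R > 0" for R using that by simp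
      from this[of "Q + 1"] show ?thesis using assms by simp
    qed
    finally have 1: "near_mass r / 2 * (sqn f + sqn g) \<le> \<epsilon> / 2" .
    have "far_const r * (wt f * wt g) \<le> (far_const r + 1) * ((M + 1) * \<delta>)"
      using h fc assms wt_nonneg \<delta> by (intro mult_mono) auto
    also have "\<dots> = \<epsilon> / 2"
    proof -
      have "F * (N * (\<epsilon> / (2 * F * N))) = \<epsilon> / 2" if "F > 0" "N > 0" for F N using that by simp
      from this[of "far_const r + 1" "M + 1"] show ?thesis using assms fc by (simp add: \<delta>_def)
    qed
    finally show ?thesis using 1 bil_bound_near_far[OF h(1,2) r(1)] by linarith
  qed
  then show ?thesis using \<delta> by blast
qed

lemma bil_add_left: "profile f \<Longrightarrow> profile g \<Longrightarrow> profile h \<Longrightarrow>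
    bil kern (\<lambda>x. f x + g x) h = bil kern f h + bil kern g h"
  using bil_lincomb_left[OF controlled_kern, of f g h 1 1] by simp

lemma bil_add_right: "profile f \<Longrightarrow> profile g \<Longrightarrow> profile h \<Longrightarrow>
    bil kern h (\<lambda>x. f x + g x) = bil kern h f + bil kern h g"
  using bil_lincomb_right[OF controlled_kern, of f g h 1 1] by simp

lemma bil_cut_left:
  assumes "profile f" "profile g" "A \<in> sets borel"
  shows "bil kern f g = bil kern (cut f A) g + bil kern (cut f (- A)) g"
proof -
  have "bil kern (\<lambda>x. cut f A x + cut f (- A) x) g = bil kern (cut f A) g + bil kern (cut f (- A)) g"
    using assms by (intro bil_add_left profile_restrict) auto
  then show ?thesis by (simp flip: cut_cases)
qed

lemma bil_cut_right:
  assumes "profile f" "profile g" "A \<in> sets borel"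
  shows "bil kern g f = bil kern g (cut f A) + bil kern g (cut f (- A))"
  using bil_cut_left[OF assms] assms bil_commute profile_restrict by simp

lemma En_cmult:
  assumes "profile f"
  shows "En (\<lambda>x. a * f x) = a\<^sup>2 * En f"
proof -
  have "bil kern (\<lambda>x. a * f x) (\<lambda>x. a * f x) = a * (a * bil kern f f)"
    using assms bil_lincomb_left[OF controlled_kern assms assms, of "\<lambda>x. a * f x" a 0]
      bil_lincomb_right[OF controlled_kern assms assms assms, of a 0] by (simp add: profile_cmult)
  then show ?thesis by (simp add: En_def sqn_cmult power2_eq_square algebra_simps)
qed

text \<open>
  The energy is a quadratic form; this identity compares two near-maximizers with their sum, for which
  the supremum gives an upper bound.
\<close>

lemma En_parallelogram:
  assumes "profile f" "profile g"
  shows "En (\<lambda>x. f x - g x) = 2 * En f + 2 * En g - En (\<lambda>x. f x + g x)"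
proof -
  note bl = bil_lincomb_left[OF controlled_kern assms] bil_lincomb_right[OF controlled_kern assms]
  have "bil kern (\<lambda>x. f x - g x) (\<lambda>x. f x - g x) = bil kern f f - 2 * bil kern f g + bil kern g g"
    using bl(1)[of "\<lambda>x. f x - g x" 1 "-1"] bl(2)[of _ 1 "-1"] assms profile_diff bil_commute[OF assms]
    by simp
  moreover have "bil kern (\<lambda>x. f x + g x) (\<lambda>x. f x + g x) = bil kern f f + 2 * bil kern f g + bil kern g g"
    using bl(1)[of "\<lambda>x. f x + g x" 1 1] bl(2)[of _ 1 1] assms profile_add bil_commute[OF assms]
    by simp
  moreover have "sqn (\<lambda>x. f x - g x) = sqn f - 2 * (\<integral>x. f x * g x \<partial>lborel) + sqn g"
    using sqn_lincomb[OF assms, of 1 "-1"] by simp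
  moreover have "sqn (\<lambda>x. f x + g x) = sqn f + 2 * (\<integral>x. f x * g x \<partial>lborel) + sqn g"
    using sqn_lincomb[OF assms, of 1 1] by simp
  ultimately show ?thesis by (simp add: En_def field_simps)
qed

lemma En_cut:
  assumes "profile f" "A \<in> sets borel"
  shows "En f = En (cut f (- A)) + bil kern f (cut f A) - bil kern (cut f A) (cut f A) / 2 - sqn (cut f A) / 2"
proof -
  have p: "profile (cut f A)" "profile (cut f (- A))" using assms profile_restrict by auto
  show ?thesis
    using bil_cut_left[OF assms(1) assms(1) assms(2)] bil_cut_right[OF assms(1) p(1) assms(2)]
      bil_cut_right[OF assms(1) p(2) assms(2)] bil_cut_left[OF assms(1) p(1) assms(2)]
      sqn_split[OF assms] bil_commute[OF p] by (simp add: En_def field_simps)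
qed

text \<open>
  When \<open>near_mass r \<le> 1/2\<close>, the near part of the interaction uses up only half of the negative term.
\<close>

lemma En_coercive: "\<exists>C\<ge>0. \<forall>f. profile f \<longrightarrow> En f \<le> C * (wt f)\<^sup>2 - sqn f / 4"
proof -
  obtain r where r: "r > 0" "near_mass r \<le> 1/2" using near_mass_small[of "1/2"] by auto
  have "En f \<le> far_const r * (wt f)\<^sup>2 - sqn f / 4" if f: "profile f" for f
  proof -
    have "near_mass r / 2 * (sqn f + sqn f) \<le> 1/2 / 2 * (sqn f + sqn f)"
      using r by (intro mult_right_mono) auto
    then have "bil kern f f \<le> sqn f / 2 + far_const r * (wt f * wt f)"
      using bil_bound_near_far[OF f f r(1)] by simp
    moreover have "0 \<le> far_const r * (wt f * wt f)" using far_const_nonneg by simp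
    ultimately show ?thesis by (simp add: En_def power2_eq_square)
  qed
  then show ?thesis using far_const_nonneg by blast
qed

definition vort :: "(real^2 \<Rightarrow> real) \<Rightarrow> bool" where
  "vort f \<longleftrightarrow> profile f \<and> (\<forall>x. 0 \<le> f x)"

lemma vortD: assumes "vort f" shows "profile f" "\<And>x. 0 \<le> f x"
  using assms by (auto simp: vort_def)

lemma vort_cut: "vort f \<Longrightarrow> A \<in> sets borel \<Longrightarrow> vort (cut f A)"
  by (auto simp: vort_def intro: profile_restrict)

lemma vort_cmult: "vort f \<Longrightarrow> 0 \<le> a \<Longrightarrow> vort (\<lambda>x. a * f x)"
  by (auto simp: vort_def intro: profile_cmult)

lemma vort_add: "vort f \<Longrightarrow> vort g \<Longrightarrow> vort (\<lambda>x. f x + g x)"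
  by (auto simp: vort_def intro: profile_add)

text \<open>
  The supremum for impulse one with no restriction on the mass.  Since the energy is homogeneous of
  degree two, the supremum for impulse \<open>\<mu>\<close> is \<open>cstar * \<mu>\<^sup>2\<close>.
\<close>

definition cstar :: real where
  "cstar = Sup (En ` {f. vort f \<and> wt f = 1})"

lemma cstar_bdd: "bdd_above (En ` {f. vort f \<and> wt f = 1})"
proof -
  obtain C where "\<forall>f. profile f \<longrightarrow> En f \<le> C * (wt f)\<^sup>2 - sqn f / 4" using En_coercive by blast
  then have *: "En f \<le> C * (wt f)\<^sup>2 - sqn f / 4" if "profile f" for f using that by blast
  have "En f \<le> C" if "vort f" "wt f = 1" for f
  proof -
    have "En f \<le> C - sqn f / 4" using *[OF vortD(1)[OF that(1)]] unfolding that(2) by simp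
    then show ?thesis using sqn_nonneg[of f] by linarith
  qed
  then show ?thesis by (auto intro!: bdd_aboveI[of _ C])
qed

lemma En_le_cstar:
  assumes "vort f"
  shows "En f \<le> cstar * (wt f)\<^sup>2"
proof (cases "wt f = 0")
  case True
  obtain C where "\<forall>f. profile f \<longrightarrow> En f \<le> C * (wt f)\<^sup>2 - sqn f / 4" using En_coercive by blast
  then have "En f \<le> C * (wt f)\<^sup>2 - sqn f / 4" using vortD(1)[OF assms] by blast
  then have "En f \<le> - (sqn f / 4)" using True by simp
  then have "En f \<le> 0" using sqn_nonneg[of f] by linarith
  then show ?thesis using True by simp
next
  case False
  then have pos: "wt f > 0" using wt_nonneg[OF vortD(1)[OF assms]] by simp
  have "En (\<lambda>x. inverse (wt f) * f x) \<le> cstar"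
    unfolding cstar_def using assms pos
    by (intro cSup_upper cstar_bdd imageI) (auto simp: wt_cmult intro!: vort_cmult)
  then have "(inverse (wt f))\<^sup>2 * En f \<le> cstar" using En_cmult[OF vortD(1)[OF assms]] by simp
  then show ?thesis using pos by (simp add: field_simps power2_eq_square)
qed

text \<open>
  For the indicator function of a square of side \<open>L\<close> at height \<open>L\<close> the interaction grows like
  \<open>L powr (2 + 2 * s)\<close>, the squared norm only like \<open>L\<^sup>2\<close>.  On such a square the distance to the reflected
  point is at least \<open>sqrt 3\<close> times the distance, so that a fixed fraction of the singular term is left.
\<close>

lemma exists_positive_energy: "\<exists>f. vort f \<and> 0 < En f"
proof -
  define D where "D = c2 s * (1 - 3 powr (s - 1)) * 2 powr (s - 1)"
  have "(3::real) powr (s - 1) < 3 powr 0" using s_less by (intro powr_less_mono) auto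
  then have D: "D > 0" using c2_pos by (simp add: D_def)
  \<comment> \<open>This size makes the lower bound for the interaction equal to \<open>2 * L\<^sup>2\<close>.\<close>
  define L where "L = (2 / D) powr (1 / (2 * s))"
  have L: "L > 0" using D by (simp add: L_def)
  have L2: "L powr (2 * s) = 2 / D" using D s_pos by (simp add: L_def powr_powr)
  define Q where "Q = cbox (vector [0, L] :: real^2) (vector [L, 2 * L])"
  define f where "f = (indicator Q :: real^2 \<Rightarrow> real)"
  have Q: "x \<in> Q \<longleftrightarrow> 0 \<le> x $ 1 \<and> x $ 1 \<le> L \<and> L \<le> x $ 2 \<and> x $ 2 \<le> 2 * L" for x
    by (auto simp: Q_def mem_box_cart forall_2)
  have mQ: "Q \<in> sets borel" by (simp add: Q_def)
  have eQ: "emeasure lborel Q = ennreal (L\<^sup>2)"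
    using L unfolding Q_def
    by (subst emeasure_lborel_cbox) (auto simp: Basis_vec_def UNIV_2 inner_axis power2_eq_square axis_eq_axis)
  have fint: "integrable lborel f" unfolding f_def using eQ mQ by (intro integrable_real_indicator) auto
  have fm [measurable]: "f \<in> borel_measurable borel" using mQ by (simp add: f_def)
  have pf: "profile f"
    unfolding profile_def
  proof (intro conjI allI impI)
    show "f x = 0" if "x $ 2 \<le> 0" for x using that L Q[of x] by (auto simp: f_def indicator_def)
    have "(\<lambda>x. (f x)\<^sup>2) = f" by (auto simp: f_def indicator_def)
    then show "integrable lborel (\<lambda>x. (f x)\<^sup>2)" using fint by simp
    show "integrable lborel (\<lambda>x. x $ 2 * f x)"
      by (rule Bochner_Integration.integrable_bound[OF integrable_mult_right[OF fint, of "2 * L"]])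
         (use Q L in \<open>auto simp: f_def indicator_def\<close>)
  qed (rule fm)
  have f: "vort f" using pf by (auto simp: vort_def f_def)
  have If: "(\<integral>x. f x \<partial>lborel) = L\<^sup>2" unfolding f_def using mQ eQ by (simp add: measure_def)
  have f_idem: "(\<lambda>x. (f x)\<^sup>2) = f" by (auto simp: f_def indicator_def)
  have sq: "sqn f = L\<^sup>2" unfolding sqn_def f_idem by (rule If)
  define m where "m = D * L powr (2 * s - 2)"
  have lower: "m \<le> kern x y" if "x \<in> Q" "y \<in> Q" "x \<noteq> y" for x y
  proof -
    define A where "A = (norm (x - y))\<^sup>2"
    define b where "b = (norm (x - reflect y))\<^sup>2"
    have A: "A > 0" using that by (simp add: A_def)
    have "A = (x $ 1 - y $ 1)\<^sup>2 + (x $ 2 - y $ 2)\<^sup>2" by (simp add: A_def norm_vec2_power2)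
    also have "\<dots> \<le> L\<^sup>2 + L\<^sup>2"
    proof (intro add_mono)
      have "\<bar>x $ 1 - y $ 1\<bar> \<le> \<bar>L\<bar>" "\<bar>x $ 2 - y $ 2\<bar> \<le> \<bar>L\<bar>" using that Q[of x] Q[of y] by auto
      then show "(x $ 1 - y $ 1)\<^sup>2 \<le> L\<^sup>2" "(x $ 2 - y $ 2)\<^sup>2 \<le> L\<^sup>2" by (simp_all add: abs_le_square_iff)
    qed
    finally have A2: "A \<le> 2 * L\<^sup>2" by simp
    have "L * L \<le> x $ 2 * y $ 2" using that Q[of x] Q[of y] L by (intro mult_mono) auto
    then have b: "b \<ge> 3 * A" using A2 norm_diff_reflect_power2[of x y] unfolding A_def b_def power2_eq_square[of L]
      by linarith
    have sq_powr: "t powr (2 * s - 2) = (t\<^sup>2) powr (s - 1)" if "t \<ge> 0" for t :: real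
    proof (cases "t = 0")
      case False
      then have "t\<^sup>2 = t powr 2" using that by (simp add: powr_numeral)
      then have "(t\<^sup>2) powr (s - 1) = t powr (2 * (s - 1))" by (simp add: powr_powr)
      then show ?thesis by (simp add: algebra_simps)
    qed simp
    have "b powr (s - 1) \<le> (3 * A) powr (s - 1)" using b A s_less by (intro powr_mono2') auto
    also have "\<dots> = 3 powr (s - 1) * A powr (s - 1)" using A by (simp add: powr_mult)
    finally have "A powr (s - 1) - b powr (s - 1) \<ge> (1 - 3 powr (s - 1)) * A powr (s - 1)"
      by (simp add: algebra_simps)
    moreover have "(1 - 3 powr (s - 1)) * A powr (s - 1) \<ge> (1 - 3 powr (s - 1)) * (2 * L\<^sup>2) powr (s - 1)"
      using A A2 s_less \<open>(3::real) powr (s - 1) < 3 powr 0\<close> by (intro mult_left_mono powr_mono2') auto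
    moreover have "(2 * L\<^sup>2) powr (s - 1) = 2 powr (s - 1) * L powr (2 * s - 2)"
      using L by (simp add: powr_mult sq_powr)
    ultimately have "c2 s * ((1 - 3 powr (s - 1)) * (2 powr (s - 1) * L powr (2 * s - 2)))
        \<le> c2 s * (A powr (s - 1) - b powr (s - 1))"
      using c2_pos by (intro mult_left_mono) auto
    moreover have "kern x y = c2 s * (A powr (s - 1) - b powr (s - 1))"
      using that by (simp add: kern_def green_eq A_def b_def sq_powr)
    ultimately show ?thesis by (simp add: m_def D_def mult_ac)
  qed
  have "AE p in lborel \<Otimes>\<^sub>M lborel. fst p \<noteq> (snd p :: real^2)"
  proof (rule lborel_pair.AE_pair_measure)
    show "{x \<in> space (lborel \<Otimes>\<^sub>M lborel). fst x \<noteq> (snd x :: real^2)} \<in> sets (lborel \<Otimes>\<^sub>M lborel)"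
      by measurable
    have "AE y in lborel. x \<noteq> y" for x :: "real^2"
      using AE_lborel_singleton[of x] by eventually_elim auto
    then show "AE x in lborel. AE y in lborel. fst (x, y) \<noteq> (snd (x, y) :: real^2)" by simp
  qed
  then have "(\<integral>p. m * (f (fst p) * f (snd p)) \<partial>(lborel \<Otimes>\<^sub>M lborel)) \<le> bil kern f f"
    unfolding bil_def
  proof (intro integral_mono_AE)
    show "integrable (lborel \<Otimes>\<^sub>M lborel) (\<lambda>p. m * (f (fst p) * f (snd p)))"
      using lborel_product[OF fint fint] by auto
    show "integrable (lborel \<Otimes>\<^sub>M lborel) (\<lambda>p. f (fst p) * kern (fst p) (snd p) * f (snd p))"
      by (rule controlled_integrable[OF controlled_kern pf pf])
    assume "AE p in lborel \<Otimes>\<^sub>M lborel. fst p \<noteq> (snd p :: real^2)"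
    then show "AE p in lborel \<Otimes>\<^sub>M lborel. m * (f (fst p) * f (snd p)) \<le> f (fst p) * kern (fst p) (snd p) * f (snd p)"
      by eventually_elim (use lower in \<open>auto simp: f_def indicator_def\<close>)
  qed
  then have "m * (L\<^sup>2 * L\<^sup>2) \<le> bil kern f f" using lborel_product[OF fint fint] If by simp
  moreover have "m * L\<^sup>2 = 2"
  proof -
    have "L powr (2 * s - 2) * L powr 2 = L powr (2 * s)" by (simp flip: powr_add)
    then have "L powr (2 * s - 2) * L\<^sup>2 = 2 / D" using L L2 by (simp add: powr_numeral)
    then show ?thesis using D by (simp add: m_def mult.assoc)
  qed
  ultimately have "2 * L\<^sup>2 \<le> bil kern f f" by (simp only: mult.assoc[symmetric])
  moreover have "0 < L\<^sup>2" using L by simp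
  ultimately have "0 < En f" unfolding En_def sq by linarith
  then show ?thesis using f by blast
qed

lemma cstar_pos: "0 < cstar"
proof -
  obtain f where f: "vort f" "0 < En f" using exists_positive_energy by blast
  then have "0 < cstar * (wt f)\<^sup>2" using En_le_cstar[of f] by linarith
  then show ?thesis by (simp add: zero_less_mult_iff)
qed

text \<open>
  Deleting \<open>A\<close> costs at most the interaction of \<open>f\<close> with its part in \<open>A\<close>, whereas the upper bound for
  the energy drops by at least \<open>cstar * (wt f * wt (cut f A))\<close>.  So a part of a near-maximizer that
  interacts weakly with the whole carries little impulse.
\<close>

lemma removal:
  assumes "vort f" "A \<in> sets borel"
  shows "cstar * (wt f * wt (cut f A)) + sqn (cut f A) / 2 \<le> cstar * (wt f)\<^sup>2 - En f + bil kern f (cut f A)"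
proof -
  define I where "I = wt f"
  define i where "i = wt (cut f A)"
  have p: "vort (cut f A)" "vort (cut f (- A))" using assms vort_cut by auto
  have "wt (cut f (- A)) = I - i" using wt_split[OF vortD(1)[OF assms(1)] assms(2)] by (simp add: I_def i_def)
  then have "En (cut f (- A)) \<le> cstar * (I - i)\<^sup>2" using En_le_cstar[OF p(2)] by simp
  also have "\<dots> \<le> cstar * (I\<^sup>2 - I * i)"
  proof (intro mult_left_mono)
    have "i * i \<le> I * i"
      using wt_cut_le[OF vortD(1)[OF assms(1)] assms(2)] wt_nonneg[OF vortD(1)[OF p(1)]]
      by (intro mult_right_mono) (auto simp: I_def i_def)
    then show "(I - i)\<^sup>2 \<le> I\<^sup>2 - I * i" by (simp add: power2_eq_square algebra_simps)
  qed (use cstar_pos in simp)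
  finally have "En (cut f (- A)) \<le> cstar * I\<^sup>2 - cstar * (I * i)" by (simp add: right_diff_distrib)
  moreover have "0 \<le> bil kern (cut f A) (cut f A)" using p vortD by (intro bil_nonneg) auto
  ultimately show ?thesis
    using En_cut[OF vortD(1)[OF assms(1)] assms(2)] by (simp add: I_def i_def)
qed

end

section \<open>Tightness of maximizing sequences\<close>

lemma e1_nth [simp]: "e1 $ 1 = 1" "e1 $ 2 = 0"
  by (simp_all add: e1_def)

lemma profile_translate:
  assumes "profile f" "v $ 2 = 0"
  shows "profile (\<lambda>x. f (x + v))"
proof -
  have [measurable]: "f \<in> borel_measurable borel" using assms by auto
  have "integrable lborel (\<lambda>x. (f (x + v))\<^sup>2)"
    using lborel_integrable_translate[of "\<lambda>x. (f x)\<^sup>2" v] profileD(3)[OF assms(1)] by simp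
  moreover have "integrable lborel (\<lambda>x. (x + v) $ 2 * f (x + v))"
    using lborel_integrable_translate[of "\<lambda>x. x $ 2 * f x" v] profileD(4)[OF assms(1)] by simp
  ultimately show ?thesis using assms profileD(2)[OF assms(1)] by (simp add: profile_def)
qed

lemma sqn_translate:
  assumes "profile f"
  shows "sqn (\<lambda>x. f (x + v)) = sqn f"
  using lborel_integral_translate[of "\<lambda>x. (f x)\<^sup>2" v] profileD(1)[OF assms] by (simp add: sqn_def)

lemma wt_translate:
  assumes "profile f" "v $ 2 = 0"
  shows "wt (\<lambda>x. f (x + v)) = wt f"
  using lborel_integral_translate[of "\<lambda>x. x $ 2 * \<bar>f x\<bar>" v] profileD(1)[OF assms(1)] assms(2) by (simp add: wt_def)

lemma wt_cut_vanish:
  assumes f: "profile f" and A: "\<And>n. A n \<in> sets borel"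
    and ev: "\<And>x. eventually (\<lambda>n. x \<notin> A n) sequentially"
  shows "(\<lambda>n. wt (cut f (A n))) \<longlonglongrightarrow> 0"
proof -
  have [measurable]: "f \<in> borel_measurable borel" "\<And>n. A n \<in> sets borel" using f A by auto
  have "(\<lambda>n. \<integral>x. x $ 2 * \<bar>cut f (A n) x\<bar> \<partial>lborel) \<longlonglongrightarrow> integral\<^sup>L lborel (\<lambda>x::real^2. 0)"
  proof (rule Bochner_Integration.integral_dominated_convergence[where w = "\<lambda>x. x $ 2 * \<bar>f x\<bar>"])
    show "integrable lborel (\<lambda>x. x $ 2 * \<bar>f x\<bar>)" by (rule profile_integrable_wt[OF f])
    show "AE x in lborel. (\<lambda>n. x $ 2 * \<bar>cut f (A n) x\<bar>) \<longlonglongrightarrow> 0"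
    proof (intro AE_I2)
      fix x
      show "(\<lambda>n. x $ 2 * \<bar>cut f (A n) x\<bar>) \<longlonglongrightarrow> 0"
        by (rule tendsto_eventually) (use ev[of x] in \<open>eventually_elim, simp\<close>)
    qed
    show "AE x in lborel. norm (x $ 2 * \<bar>cut f (A n) x\<bar>) \<le> x $ 2 * \<bar>f x\<bar>" for n
    proof (intro AE_I2)
      fix x
      show "norm (x $ 2 * \<bar>cut f (A n) x\<bar>) \<le> x $ 2 * \<bar>f x\<bar>"
        using profile_wt_nonneg_pt[OF f, of x] by (cases "x \<in> A n") simp_all
    qed
  qed measurable
  then show ?thesis by (simp add: wt_def)
qed

lemma slab_measurable [measurable]:
  "{x::real^2. a < x $ i} \<in> sets borel" "{x::real^2. x $ i \<le> a} \<in> sets borel"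
  "{x::real^2. a < x $ i \<and> x $ i \<le> b} \<in> sets borel" "{x::real^2. a < \<bar>x $ i - b\<bar>} \<in> sets borel"
  "{x::real^2. a < \<bar>x $ i\<bar>} \<in> sets borel"
  by measurable

text \<open>
  Pigeonhole: \<open>L\<close> adjacent slabs of width \<open>l\<close> share the impulse.
\<close>

lemma thin_slab:
  assumes f: "profile f" and "0 < l" and L: "0 < (L::nat)"
  shows "\<exists>j. j < L \<and> wt (cut f {x. a + real j * l < x $ 1 \<and> x $ 1 \<le> a + (real j + 1) * l}) \<le> wt f / L"
proof (rule ccontr)
  define S where "S j = {x::real^2. a + real j * l < x $ 1 \<and> x $ 1 \<le> a + (real j + 1) * l}" for j :: nat
  assume "\<not> ?thesis"
  then have big: "wt f / L < wt (cut f (S j))" if "j < L" for j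
    using that by (auto simp: S_def not_le)
  have "(\<Sum>j<m. wt (cut f (S j))) = wt (cut f {x. a < x $ 1 \<and> x $ 1 \<le> a + m * l})" for m
  proof (induction m)
    case 0
    have "{x::real^2. a < x $ 1 \<and> x $ 1 \<le> a + (0::nat) * l} = {}" by auto
    then show ?case by (simp add: wt_def)
  next
    case (Suc m)
    have "{x::real^2. a < x $ 1 \<and> x $ 1 \<le> a + Suc m * l}
       = {x. a < x $ 1 \<and> x $ 1 \<le> a + m * l} \<union> S m"
    proof -
      have gen: "{x::real^2. a < x $ 1 \<and> x $ 1 \<le> v} = {x. a < x $ 1 \<and> x $ 1 \<le> u} \<union> {x. u < x $ 1 \<and> x $ 1 \<le> v}"
        if "a \<le> u" "u \<le> v" for u v using that by auto
      show ?thesis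
        using gen[of "a + m * l" "a + Suc m * l"] \<open>0 < l\<close> by (simp add: S_def algebra_simps)
    qed
    then show ?case using Suc f
      by (simp only:) (subst wt_disjoint_sum, auto simp: S_def)
  qed
  then have "(\<Sum>j<L. wt (cut f (S j))) \<le> wt f" using f wt_cut_le by simp
  moreover have "(\<Sum>j<L. wt f / L) < (\<Sum>j<L. wt (cut f (S j)))"
    using L big by (intro sum_strict_mono) auto
  ultimately show False using L by simp
qed

text \<open>
  The witness is the smallest integer such that at least half of the impulse lies to its left.  The overlap of width
  one replaces the continuity of the impulse in \<open>t\<close>.
\<close>

lemma median_slab:
  assumes f: "profile f" and pos: "0 < wt f"
  shows "\<exists>t. wt f / 2 \<le> wt (cut f {x. x $ 1 \<le> t}) \<and> wt f / 2 \<le> wt (cut f {x. t - 1 < x $ 1})"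
proof -
  define G where "G t = wt (cut f {x. x $ 1 \<le> t})" for t
  have cmp: "G t + wt (cut f {x. t < x $ 1}) = wt f" for t
  proof -
    have "- {x::real^2. x $ 1 \<le> t} = {x. t < x $ 1}" by auto
    then show ?thesis using wt_split[OF f, of "{x. x $ 1 \<le> t}"] by (simp add: G_def)
  qed
  have "(\<lambda>n. G (- real n)) \<longlonglongrightarrow> 0"
    unfolding G_def
  proof (rule wt_cut_vanish[OF f])
    show "eventually (\<lambda>n. x \<notin> {x::real^2. x $ 1 \<le> - real n}) sequentially" for x
      using eventually_gt_at_top[of "nat \<lceil>- (x $ 1)\<rceil>"] by eventually_elim (auto, linarith)
  qed auto
  then have "eventually (\<lambda>n. G (- real n) < wt f / 2) sequentially"
    using pos by (intro order_tendstoD) auto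
  then obtain n0 where n0: "G (- real n0) < wt f / 2" by (auto dest!: eventually_happens)
  have "(\<lambda>n. wt (cut f {x. real n < x $ 1})) \<longlonglongrightarrow> 0"
  proof (rule wt_cut_vanish[OF f])
    show "eventually (\<lambda>n. x \<notin> {x::real^2. real n < x $ 1}) sequentially" for x
      using eventually_gt_at_top[of "nat \<lceil>x $ 1\<rceil>"] by eventually_elim (auto, linarith)
  qed auto
  then have "eventually (\<lambda>n. wt (cut f {x. real n < x $ 1}) < wt f / 2) sequentially"
    using pos by (intro order_tendstoD) auto
  then obtain n1 where "wt (cut f {x. real n1 < x $ 1}) < wt f / 2" by (auto dest!: eventually_happens)
  then have n1: "wt f / 2 \<le> G (real n1)" using cmp[of "real n1"] by linarith
  define P where "P m \<longleftrightarrow> wt f / 2 \<le> G (real m - real n0)" for m :: nat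
  have "P (n1 + n0)" using n1 by (simp add: P_def)
  then have "P (LEAST m. P m)" by (rule LeastI)
  moreover have "\<not> P 0" using n0 by (simp add: P_def)
  ultimately obtain m where m: "(LEAST m. P m) = Suc m" by (cases "LEAST m. P m") auto
  then have "\<not> P m" using not_less_Least[of m P] by simp
  define t where "t = real (Suc m) - real n0"
  have "wt f / 2 \<le> G t" using \<open>P (LEAST m. P m)\<close> m by (simp add: P_def t_def)
  moreover have "G (t - 1) < wt f / 2" using \<open>\<not> P m\<close> by (simp add: P_def t_def)
  then have "wt f / 2 \<le> wt (cut f {x. t - 1 < x $ 1})" using cmp[of "t - 1"] by linarith
  ultimately show ?thesis by (auto simp: G_def)
qed

context half_plane_kernel
begin

lemma vort_translate: "vort f \<Longrightarrow> v $ 2 = 0 \<Longrightarrow> vort (\<lambda>x. f (x + v))"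
  by (auto simp: vort_def intro: profile_translate)

lemma En_translate: "profile f \<Longrightarrow> v $ 2 = 0 \<Longrightarrow> En (\<lambda>x. f (x + v)) = En f"
  by (simp add: En_def sqn_translate bil_translate)

lemma En_disjoint:
  assumes f: "profile f" and AB: "A \<in> sets borel" "B \<in> sets borel" "A \<inter> B = {}"
  shows "En (cut f (A \<union> B)) = En (cut f A) + En (cut f B) + bil kern (cut f A) (cut f B)"
proof -
  have p: "profile (cut f A)" "profile (cut f B)" using f AB profile_restrict by auto
  have eq: "cut f (A \<union> B) = (\<lambda>x. cut f A x + cut f B x)" using AB(3) by (intro ext) (auto simp: indicator_def)
  show ?thesis
    using sqn_disjoint_sum[OF f AB] p bil_commute[OF p]
    by (simp add: eq En_def bil_add_left bil_add_right profile_add field_simps)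
qed

text \<open>
  This excludes dichotomy.  After deletion of the slab between \<open>a\<close> and \<open>b\<close> the two remaining sides have
  distance \<open>b - a\<close>, so their energies almost add up; but the square of the total impulse exceeds the sum
  of the squares by twice the product.
\<close>

lemma gap_splitting:
  assumes f: "vort f" and "a < b"
  shows "2 * cstar * (wt (cut f {x. x $ 1 \<le> a}) * wt (cut f {x. b < x $ 1}))
    \<le> cstar * (wt f)\<^sup>2 - En f + bil kern f (cut f {x. a < x $ 1 \<and> x $ 1 \<le> b}) + far_const (b - a) * (wt f)\<^sup>2"
proof -
  define A where "A = {x::real^2. x $ 1 \<le> a}"
  define N where "N = {x::real^2. a < x $ 1 \<and> x $ 1 \<le> b}"
  define D where "D = {x::real^2. b < x $ 1}"
  have m: "A \<in> sets borel" "N \<in> sets borel" "D \<in> sets borel" by (simp_all add: A_def N_def D_def)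
  have AD: "A \<inter> D = {}" and cN: "- N = A \<union> D" using \<open>a < b\<close> by (auto simp: A_def D_def N_def)
  have pf: "profile f" using f vortD by auto
  have v: "vort (cut f A)" "vort (cut f N)" "vort (cut f D)" using f m vort_cut by auto
  note p = v[THEN vortD(1)]
  define iA where "iA = wt (cut f A)"
  define iD where "iD = wt (cut f D)"
  have i0: "0 \<le> iA" "0 \<le> iD" using p wt_nonneg by (auto simp: iA_def iD_def)
  have iI: "iA + iD \<le> wt f"
    using wt_disjoint_sum[OF pf m(1,3) AD] wt_cut_le[OF pf, of "A \<union> D"] m by (simp add: iA_def iD_def)
  have "En f \<le> En (cut f (- N)) + bil kern f (cut f N)"
  proof -
    have "0 \<le> bil kern (cut f N) (cut f N)" by (rule bil_nonneg[OF p(2) p(2) vortD(2)[OF v(2)] vortD(2)[OF v(2)]])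
    then show ?thesis using En_cut[OF pf m(2)] sqn_nonneg[of "cut f N"] by linarith
  qed
  also have "En (cut f (- N)) = En (cut f A) + En (cut f D) + bil kern (cut f A) (cut f D)"
    unfolding cN by (rule En_disjoint[OF pf m(1,3) AD])
  finally have 1: "En f \<le> En (cut f A) + En (cut f D) + bil kern (cut f A) (cut f D) + bil kern f (cut f N)"
    by simp
  have "\<bar>bil kern (cut f A) (cut f D)\<bar> \<le> far_const (b - a) * (iA * iD)"
    unfolding iA_def iD_def
  proof (rule bil_bound_separated[OF p(1,3)])
    fix x y
    assume "cut f A x \<noteq> 0" "cut f D y \<noteq> 0"
    then have "x $ 1 \<le> a" "b < y $ 1" by (auto simp: A_def D_def indicator_def split: if_splits)
    moreover have "\<bar>(x - y) $ 1\<bar> \<le> norm (x - y)" by (rule component_le_norm_cart)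
    ultimately show "b - a \<le> norm (x - y)" by simp
  qed (use \<open>a < b\<close> in simp)
  also have "\<dots> \<le> far_const (b - a) * (wt f * wt f)"
    using i0 iI far_const_nonneg by (intro mult_left_mono mult_mono) auto
  finally have 2: "bil kern (cut f A) (cut f D) \<le> far_const (b - a) * (wt f)\<^sup>2" by (simp add: power2_eq_square)
  have "En (cut f A) + En (cut f D) \<le> cstar * (iA\<^sup>2 + iD\<^sup>2)"
    using En_le_cstar[OF v(1)] En_le_cstar[OF v(3)] by (simp add: iA_def iD_def distrib_left)
  also have "\<dots> \<le> cstar * ((wt f)\<^sup>2 - 2 * (iA * iD))"
  proof (intro mult_left_mono)
    have "(iA + iD)\<^sup>2 \<le> (wt f)\<^sup>2" using i0 iI by (intro power_mono) auto
    then show "iA\<^sup>2 + iD\<^sup>2 \<le> (wt f)\<^sup>2 - 2 * (iA * iD)" by (simp add: power2_sum)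
  qed (use cstar_pos in simp)
  finally have "En (cut f A) + En (cut f D) \<le> cstar * (wt f)\<^sup>2 - 2 * cstar * (iA * iD)"
    by (simp add: right_diff_distrib)
  then show ?thesis using 1 2 unfolding iA_def iD_def A_def D_def N_def by linarith
qed

definition maximizing :: "(nat \<Rightarrow> real^2 \<Rightarrow> real) \<Rightarrow> real \<Rightarrow> bool" where
  "maximizing f \<mu> \<longleftrightarrow> (\<forall>n. vort (f n)) \<and> 0 < \<mu> \<and> (\<lambda>n. wt (f n)) \<longlonglongrightarrow> \<mu> \<and> (\<lambda>n. En (f n)) \<longlonglongrightarrow> cstar * \<mu>\<^sup>2"

lemma maximizing_bounded:
  assumes "maximizing f \<mu>"
  shows "\<exists>Q\<ge>0. \<exists>M\<ge>0. \<forall>n. sqn (f n) \<le> Q \<and> wt (f n) \<le> M"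
proof -
  have h: "\<And>n. profile (f n)" "(\<lambda>n. wt (f n)) \<longlonglongrightarrow> \<mu>" "(\<lambda>n. En (f n)) \<longlonglongrightarrow> cstar * \<mu>\<^sup>2"
    using assms by (auto simp: maximizing_def vort_def)
  obtain C where C: "C \<ge> 0" "\<And>f. profile f \<Longrightarrow> En f \<le> C * (wt f)\<^sup>2 - sqn f / 4" using En_coercive by blast
  obtain M where M: "\<And>n. norm (wt (f n)) \<le> M"
    using convergent_imp_Bseq[OF convergentI[OF h(2)]] unfolding Bseq_def by blast
  obtain E where E: "\<And>n. norm (En (f n)) \<le> E"
    using convergent_imp_Bseq[OF convergentI[OF h(3)]] unfolding Bseq_def by blast
  have M0: "M \<ge> 0" using M[of 0] by (meson norm_ge_zero order_trans)
  have "sqn (f n) \<le> 4 * (C * M\<^sup>2 + E)" for n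
  proof -
    have "(wt (f n))\<^sup>2 \<le> M\<^sup>2" using M[of n] by (simp add: abs_le_square_iff[symmetric] M0)
    then have "C * (wt (f n))\<^sup>2 \<le> C * M\<^sup>2" using C by (intro mult_left_mono)
    then show ?thesis using C(2)[OF h(1), of n] E[of n] by (simp add: abs_le_iff)
  qed
  moreover have "wt (f n) \<le> M" for n using M[of n] by simp
  moreover have "0 \<le> 4 * (C * M\<^sup>2 + E)" using sqn_nonneg[of "f 0"] calculation(1)[of 0] by linarith
  ultimately show ?thesis using M0 by blast
qed

lemma maximizing_eventually:
  assumes "maximizing f \<mu>" "0 < \<epsilon>"
  shows "eventually (\<lambda>n. \<mu> / 2 \<le> wt (f n) \<and> cstar * (wt (f n))\<^sup>2 - En (f n) \<le> \<epsilon>) sequentially"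
proof -
  have h: "0 < \<mu>" "(\<lambda>n. wt (f n)) \<longlonglongrightarrow> \<mu>" "(\<lambda>n. En (f n)) \<longlonglongrightarrow> cstar * \<mu>\<^sup>2"
    using assms by (auto simp: maximizing_def)
  have "(\<lambda>n. cstar * (wt (f n))\<^sup>2 - En (f n)) \<longlonglongrightarrow> cstar * \<mu>\<^sup>2 - cstar * \<mu>\<^sup>2"
    by (intro tendsto_intros h)
  then have "eventually (\<lambda>n. cstar * (wt (f n))\<^sup>2 - En (f n) < \<epsilon>) sequentially"
    using assms(2) by (intro order_tendstoD) auto
  moreover have "eventually (\<lambda>n. \<mu> / 2 < wt (f n)) sequentially"
    using h by (intro order_tendstoD) auto
  ultimately show ?thesis by eventually_elim auto
qed

text \<open>
  By \<open>kern_le_high\<close>, what lies above a great height interacts weakly with the whole, so \<open>removal\<close>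
  applies to it.
\<close>

lemma vertical_tightness:
  assumes max: "maximizing f \<mu>" and "0 < \<epsilon>"
  shows "\<exists>H. eventually (\<lambda>n. wt (cut (f n) {x. H < x $ 2}) \<le> \<epsilon>) sequentially"
proof -
  have v: "\<And>n. vort (f n)" and \<mu>: "0 < \<mu>" using max by (auto simp: maximizing_def)
  note p = vortD(1)[OF v]
  obtain Q M where QM: "Q \<ge> 0" "M \<ge> 0" "\<And>n. sqn (f n) \<le> Q" "\<And>n. wt (f n) \<le> M"
    using maximizing_bounded[OF max] by blast
  \<comment> \<open>Once \<open>\<mu> / 2 \<le> wt (f n)\<close>, an error of \<open>2 * e\<close> in \<open>removal\<close> bounds the impulse by \<open>\<epsilon>\<close>.\<close>
  define e where "e = cstar * (\<mu> / 2) * \<epsilon> / 2"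
  have e: "e > 0" using cstar_pos \<mu> \<open>0 < \<epsilon>\<close> by (simp add: e_def)
  obtain r where r: "r > 0" "near_mass r \<le> e / (2 * (Q + 1))"
    using near_mass_small[of "e / (2 * (Q + 1))"] e QM by auto
  define \<delta> where "\<delta> = e / (2 * (M\<^sup>2 + 1))"
  have \<delta>: "\<delta> > 0" using e by (simp add: \<delta>_def add_nonneg_pos)
  obtain H where H: "\<And>x y. H < x $ 2 \<Longrightarrow> 0 < x $ 2 \<Longrightarrow> 0 < y $ 2 \<Longrightarrow> kern x y \<le> near r (x - y) + \<delta> * (x $ 2 * y $ 2)"
    using kern_le_high[OF r(1) \<delta>] by blast
  define A where "A = {x::real^2. H < x $ 2}"
  have A: "A \<in> sets borel" by (simp add: A_def)
  have small: "bil kern (f n) (cut (f n) A) \<le> e" for n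
  proof -
    have pA: "profile (cut (f n) A)" using p A profile_restrict by blast
    have "\<bar>bil kern (cut (f n) A) (f n)\<bar>
        \<le> 1 * near_mass r / 2 * (sqn (cut (f n) A) + sqn (f n)) + \<delta> * (wt (cut (f n) A) * wt (f n))"
    proof (rule bil_bound(2)[OF pA p kern_measurable r(1)])
      fix x y
      assume h: "cut (f n) A x \<noteq> 0" "f n y \<noteq> 0" "0 < x $ 2" "0 < y $ 2"
      then have "H < x $ 2" by (auto simp: A_def indicator_def split: if_splits)
      then show "\<bar>kern x y\<bar> \<le> 1 * near r (x - y) + \<delta> * (x $ 2 * y $ 2)"
        using H kern_nonneg h by simp
    qed simp
    also have "\<dots> \<le> e / (2 * (Q + 1)) / 2 * (2 * (Q + 1)) + \<delta> * (M * M)"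
      using r QM(1,2) QM(3,4)[of n] near_mass_nonneg[of r] \<delta> sqn_cut_le[OF p A, of n] wt_cut_le[OF p A, of n] e
        wt_nonneg[OF p, of n] wt_nonneg[OF pA]
      by (intro add_mono mult_mono mult_left_mono divide_right_mono) auto
    also have "e / (2 * (Q + 1)) / 2 * (2 * (Q + 1)) = e / 2"
    proof -
      have "e / (2 * R) / 2 * (2 * R) = e / 2" if "R > 0" for R using that by simp
      from this[of "Q + 1"] show ?thesis using QM by simp
    qed
    also have "\<delta> * (M * M) \<le> \<delta> * (M\<^sup>2 + 1)" using \<delta> by (intro mult_left_mono) (auto simp: power2_eq_square)
    also have "\<delta> * (M\<^sup>2 + 1) = e / 2"
    proof -
      have "e / (2 * R) * R = e / 2" if "R > 0" for R using that by simp
      from this[of "M\<^sup>2 + 1"] show ?thesis by (simp add: \<delta>_def add_nonneg_pos)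
    qed
    finally show ?thesis using bil_commute[OF pA p, of n] by simp
  qed
  have "eventually (\<lambda>n. wt (cut (f n) A) \<le> \<epsilon>) sequentially"
    using maximizing_eventually[OF max e]
  proof eventually_elim
    case (elim n)
    have w: "0 \<le> wt (cut (f n) A)" using wt_nonneg[OF profile_restrict[OF p A]] .
    have "cstar * (\<mu> / 2 * wt (cut (f n) A)) \<le> cstar * (wt (f n) * wt (cut (f n) A))"
      using elim w cstar_pos by (intro mult_left_mono mult_right_mono) auto
    also have "\<dots> \<le> e + e"
      using removal[OF v A, of n] elim small[of n] sqn_nonneg[of "cut (f n) A"] by linarith
    also have "\<dots> = cstar * (\<mu> / 2 * \<epsilon>)" by (simp add: e_def)
    finally show ?case using cstar_pos \<mu> by (simp add: mult_le_cancel_left_pos)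
  qed
  then show ?thesis by (auto simp: A_def)
qed

text \<open>
  In a wide window, wherever it lies, some slab of the fixed width \<open>l\<close> carries little impulse.  Cutting
  there makes all error terms of \<open>gap_splitting\<close> small.
\<close>

lemma product_tightness:
  assumes max: "maximizing f \<mu>" and "0 < \<epsilon>"
  shows "\<exists>W>0. eventually (\<lambda>n. \<forall>a. wt (cut (f n) {x. x $ 1 \<le> a}) * wt (cut (f n) {x. a + W < x $ 1}) \<le> \<epsilon>) sequentially"
proof -
  have v: "\<And>n. vort (f n)" and \<mu>: "0 < \<mu>" using max by (auto simp: maximizing_def)
  note p = vortD(1)[OF v]
  obtain Q M where QM: "Q \<ge> 0" "M \<ge> 0" "\<And>n. sqn (f n) \<le> Q" "\<And>n. wt (f n) \<le> M"
    using maximizing_bounded[OF max] by blast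
  define e where "e = 2 * cstar * \<epsilon> / 3"
  have e: "e > 0" using cstar_pos \<open>0 < \<epsilon>\<close> by (simp add: e_def)
  have M1: "M\<^sup>2 + 1 > 0" by (simp add: add_nonneg_pos)
  obtain l where l: "l > 0" "far_const l \<le> e / (M\<^sup>2 + 1)"
    using far_const_small[of "e / (M\<^sup>2 + 1)"] e M1 by auto
  have lM: "far_const l * (wt (f n))\<^sup>2 \<le> e" for n
  proof -
    have "(wt (f n))\<^sup>2 \<le> M\<^sup>2 + 1" using QM(4)[of n] wt_nonneg[OF p, of n] by (simp add: power_mono add_increasing2)
    then have "far_const l * (wt (f n))\<^sup>2 \<le> e / (M\<^sup>2 + 1) * (M\<^sup>2 + 1)"
      using l far_const_nonneg e M1 by (intro mult_mono) auto
    then show ?thesis using M1 by simp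
  qed
  obtain \<delta> where \<delta>: "\<delta> > 0" "\<And>f g. profile f \<Longrightarrow> profile g \<Longrightarrow> sqn f \<le> Q \<Longrightarrow> sqn g \<le> Q \<Longrightarrow> wt f \<le> M \<Longrightarrow>
      wt g \<le> \<delta> \<Longrightarrow> \<bar>bil kern f g\<bar> \<le> e"
    using bil_small[OF QM(1,2) e] by blast
  obtain L0 where L0: "M / \<delta> < real L0" using reals_Archimedean2 by blast
  define L where "L = Suc L0"
  have L: "M / real L \<le> \<delta>"
  proof -
    have "M / \<delta> \<le> real L" using L0 by (simp add: L_def)
    then have "M \<le> \<delta> * real L" using \<delta>(1) by (simp add: field_simps)
    then show ?thesis by (simp add: L_def field_simps)
  qed
  have Lpos: "0 < L" by (simp add: L_def)
  define W where "W = real L * l"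
  have W: "W > 0" using Lpos l by (simp add: W_def)
  have "eventually (\<lambda>n. \<forall>a. wt (cut (f n) {x. x $ 1 \<le> a}) * wt (cut (f n) {x. a + W < x $ 1}) \<le> \<epsilon>) sequentially"
    using maximizing_eventually[OF max e]
  proof eventually_elim
    case (elim n)
    show ?case
    proof
      fix a
      obtain j where j: "j < L" "wt (cut (f n) {x. a + real j * l < x $ 1 \<and> x $ 1 \<le> a + (real j + 1) * l}) \<le> wt (f n) / L"
        using thin_slab[OF p l(1) Lpos, of n a] by auto
      define b where "b = a + real j * l"
      define N where "N = {x::real^2. b < x $ 1 \<and> x $ 1 \<le> b + l}"
      have N: "N \<in> sets borel" by (simp add: N_def)
      have bl: "a + (real j + 1) * l = b + l" by (simp add: b_def algebra_simps)
      have "wt (cut (f n) N) \<le> wt (f n) / L" using j(2) unfolding N_def bl b_def[symmetric] .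
      also have "\<dots> \<le> M / L" using QM(4) by (intro divide_right_mono) auto
      finally have "wt (cut (f n) N) \<le> \<delta>" using L by linarith
      then have "\<bar>bil kern (f n) (cut (f n) N)\<bar> \<le> e"
        using order_trans[OF sqn_cut_le[OF p N] QM(3)] QM(3,4) by (intro \<delta>(2) profile_restrict p N)
      moreover have "far_const (b + l - b) * (wt (f n))\<^sup>2 \<le> e" using lM[of n] by simp
      ultimately have "2 * cstar * (wt (cut (f n) {x. x $ 1 \<le> b}) * wt (cut (f n) {x. b + l < x $ 1})) \<le> 3 * e"
        using gap_splitting[OF v, of b "b + l" n] l(1) elim unfolding N_def by linarith
      also have "3 * e = 2 * cstar * \<epsilon>" by (simp add: e_def)
      finally have "wt (cut (f n) {x. x $ 1 \<le> b}) * wt (cut (f n) {x. b + l < x $ 1}) \<le> \<epsilon>"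
        using cstar_pos by (simp add: mult_le_cancel_left_pos)
      moreover have "wt (cut (f n) {x. x $ 1 \<le> a}) * wt (cut (f n) {x. a + W < x $ 1})
        \<le> wt (cut (f n) {x. x $ 1 \<le> b}) * wt (cut (f n) {x. b + l < x $ 1})"
      proof (intro mult_mono wt_cut_mono p wt_nonneg profile_restrict)
        have "a \<le> b" using l by (simp add: b_def)
        then show "{x::real^2. x $ 1 \<le> a} \<subseteq> {x. x $ 1 \<le> b}" by auto
        have "real j + 1 \<le> real L" using j(1) by linarith
        then have "(real j + 1) * l \<le> W" unfolding W_def using l by (intro mult_right_mono) auto
        then have "b + l \<le> a + W" by (simp add: b_def algebra_simps)
        then show "{x::real^2. a + W < x $ 1} \<subseteq> {x. b + l < x $ 1}" by auto
      qed auto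
      ultimately show "wt (cut (f n) {x. x $ 1 \<le> a}) * wt (cut (f n) {x. a + W < x $ 1}) \<le> \<epsilon>" by linarith
    qed
  qed
  then show ?thesis using W by blast
qed

text \<open>
  Each side of a median keeps half of the impulse, so by \<open>product_tightness\<close> almost nothing is left far
  away on the other side.
\<close>

lemma horizontal_tightness:
  assumes max: "maximizing f \<mu>"
  shows "\<exists>t. \<forall>\<epsilon>>0. \<exists>T. eventually (\<lambda>n. wt (cut (f n) {x. T < \<bar>x $ 1 - t n\<bar>}) \<le> \<epsilon>) sequentially"
proof -
  have v: "\<And>n. vort (f n)" and \<mu>: "0 < \<mu>" using max by (auto simp: maximizing_def)
  note p = vortD(1)[OF v]
  have "\<forall>n. \<exists>t. 0 < wt (f n) \<longrightarrow> wt (f n) / 2 \<le> wt (cut (f n) {x. x $ 1 \<le> t}) \<and>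
      wt (f n) / 2 \<le> wt (cut (f n) {x. t - 1 < x $ 1})"
    using median_slab[OF p] by blast
  from choice[OF this] obtain t where "\<forall>n. 0 < wt (f n) \<longrightarrow> wt (f n) / 2 \<le> wt (cut (f n) {x. x $ 1 \<le> t n}) \<and>
      wt (f n) / 2 \<le> wt (cut (f n) {x. t n - 1 < x $ 1})" ..
  then have t: "\<And>n. 0 < wt (f n) \<Longrightarrow> wt (f n) / 2 \<le> wt (cut (f n) {x. x $ 1 \<le> t n})"
    "\<And>n. 0 < wt (f n) \<Longrightarrow> wt (f n) / 2 \<le> wt (cut (f n) {x. t n - 1 < x $ 1})"
    by simp_all
  have "\<exists>T. eventually (\<lambda>n. wt (cut (f n) {x. T < \<bar>x $ 1 - t n\<bar>}) \<le> \<epsilon>) sequentially" if \<epsilon>: "0 < \<epsilon>" for \<epsilon>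
  proof -
    have pos: "0 < \<mu> / 4 * (\<epsilon> / 2)" using \<mu> \<epsilon> by simp
    obtain W where W: "W > 0" "eventually (\<lambda>n. \<forall>a. wt (cut (f n) {x. x $ 1 \<le> a}) * wt (cut (f n) {x. a + W < x $ 1})
         \<le> \<mu> / 4 * (\<epsilon> / 2)) sequentially"
      using product_tightness[OF max pos] by blast
    have "eventually (\<lambda>n. wt (cut (f n) {x. W + 1 < \<bar>x $ 1 - t n\<bar>}) \<le> \<epsilon>) sequentially"
      using W(2) maximizing_eventually[OF max zero_less_one]
    proof eventually_elim
      case (elim n)
      have wn: "0 < wt (f n)" using elim \<mu> by linarith
      define R where "R = {x::real^2. t n + W < x $ 1}"
      define L where "L = {x::real^2. x $ 1 \<le> t n - 1 - W}"
      have m: "R \<in> sets borel" "L \<in> sets borel" by (simp_all add: R_def L_def)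
      have wR: "0 \<le> wt (cut (f n) R)" and wL: "0 \<le> wt (cut (f n) L)"
        using p m by (auto intro!: wt_nonneg profile_restrict)
      have "\<mu> / 4 * wt (cut (f n) R) \<le> wt (cut (f n) {x. x $ 1 \<le> t n}) * wt (cut (f n) R)"
        using t(1)[OF wn] elim wR by (intro mult_right_mono) auto
      also have "\<dots> \<le> \<mu> / 4 * (\<epsilon> / 2)" using elim by (simp add: R_def)
      finally have R: "wt (cut (f n) R) \<le> \<epsilon> / 2" using \<mu> by (simp add: mult_le_cancel_left_pos)
      have "\<mu> / 4 * wt (cut (f n) L) \<le> wt (cut (f n) {x. t n - 1 < x $ 1}) * wt (cut (f n) L)"
        using t(2)[OF wn] elim wL by (intro mult_right_mono) auto
      also have "\<dots> = wt (cut (f n) {x. x $ 1 \<le> t n - 1 - W}) * wt (cut (f n) {x. (t n - 1 - W) + W < x $ 1})"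
        by (simp add: L_def mult.commute)
      also have "\<dots> \<le> \<mu> / 4 * (\<epsilon> / 2)" using elim by blast
      finally have L: "wt (cut (f n) L) \<le> \<epsilon> / 2" using \<mu> by (simp add: mult_le_cancel_left_pos)
      have "wt (cut (f n) {x. W + 1 < \<bar>x $ 1 - t n\<bar>}) \<le> wt (cut (f n) (R \<union> L))"
        using p m W by (intro wt_cut_mono) (auto simp: R_def L_def)
      also have "\<dots> = wt (cut (f n) R) + wt (cut (f n) L)"
        using p m W by (intro wt_disjoint_sum) (auto simp: R_def L_def)
      finally show ?case using R L by linarith
    qed
    then show ?thesis by blast
  qed
  then show ?thesis by blast
qed

end

section \<open>Limits of tight sequences\<close>

definition box_region :: "real \<Rightarrow> (real^2) set" where
  "box_region T = cbox (vector [- T, 0]) (vector [T, T])"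

lemma mem_box_region: "x \<in> box_region T \<longleftrightarrow> - T \<le> x $ 1 \<and> x $ 1 \<le> T \<and> 0 \<le> x $ 2 \<and> x $ 2 \<le> T"
  by (auto simp: box_region_def mem_box_cart forall_2)

lemma box_region_borel [measurable, simp]: "box_region T \<in> sets borel"
  by (simp add: box_region_def)

lemma compact_box_region: "compact (box_region T)"
  by (simp add: box_region_def)

lemma box_region_integrable: "integrable lborel (indicator (box_region T) :: real^2 \<Rightarrow> real)"
  unfolding box_region_def
  by (rule integrable_real_indicator[OF _ emeasure_lborel_cbox_finite]) simp

abbreviation vol_box :: "real \<Rightarrow> real" where
  "vol_box T \<equiv> measure lborel (box_region T)"

lemma cut_box_integrable:
  assumes f: "profile f"
  shows "integrable lborel (cut f (box_region T))"
    and "(\<integral>x. \<bar>cut f (box_region T) x\<bar> \<partial>lborel) \<le> (sqn f + vol_box T) / 2"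
proof -
  have [measurable]: "f \<in> borel_measurable borel" using f by auto
  have int: "integrable lborel (\<lambda>x. ((f x)\<^sup>2 + indicator (box_region T) x) / 2)"
    using f box_region_integrable by (intro integrable_divide Bochner_Integration.integrable_add) auto
  have le: "\<bar>cut f (box_region T) x\<bar> \<le> ((f x)\<^sup>2 + indicator (box_region T) x) / 2" for x
    using sum_squares_bound[of "\<bar>f x\<bar>" 1] by (auto simp: indicator_def)
  show i: "integrable lborel (cut f (box_region T))"
  proof (rule Bochner_Integration.integrable_bound[OF int])
    show "AE x in lborel. norm (cut f (box_region T) x) \<le> norm (((f x)\<^sup>2 + indicator (box_region T) x) / 2)"
      using le by (intro AE_I2) (auto intro: order_trans)
  qed measurable
  have "(\<integral>x. \<bar>cut f (box_region T) x\<bar> \<partial>lborel) \<le> (\<integral>x. ((f x)\<^sup>2 + indicator (box_region T) x) / 2 \<partial>lborel)"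
    using i int le by (intro integral_mono) auto
  also have "\<dots> = (sqn f + vol_box T) / 2"
    using profileD(3)[OF f] box_region_integrable[of T] by (simp add: sqn_def Bochner_Integration.integral_add)
  finally show "(\<integral>x. \<bar>cut f (box_region T) x\<bar> \<partial>lborel) \<le> (sqn f + vol_box T) / 2" .
qed

text \<open>
  On a box the impulse is controlled by the squared norm: the right-hand side is small for large
  \<open>\<eta>\<close> and then small \<open>sqn d\<close>.
\<close>

lemma wt_cut_box_le:
  assumes d: "profile d" and "0 < T" "0 < \<eta>"
  shows "wt (cut d (box_region T)) \<le> T / 2 * (\<eta> * sqn d + vol_box T / \<eta>)"
proof -
  have pt: "x $ 2 * \<bar>cut d (box_region T) x\<bar> \<le> T / 2 * (\<eta> * (d x)\<^sup>2 + indicator (box_region T) x / \<eta>)" for x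
  proof (cases "x \<in> box_region T")
    case True
    have "2 * \<bar>d x\<bar> \<le> \<eta> * (d x)\<^sup>2 + 1 / \<eta>"
    proof -
      have "0 \<le> (\<eta> * \<bar>d x\<bar> - 1)\<^sup>2 / \<eta>" using \<open>0 < \<eta>\<close> by simp
      also have "\<dots> = \<eta> * (d x)\<^sup>2 + 1 / \<eta> - 2 * \<bar>d x\<bar>"
        using \<open>0 < \<eta>\<close> by (simp add: power2_eq_square field_simps)
      finally show ?thesis by simp
    qed
    then have "T * \<bar>d x\<bar> \<le> T / 2 * (\<eta> * (d x)\<^sup>2 + 1 / \<eta>)"
      using mult_left_mono[of "2 * \<bar>d x\<bar>" "\<eta> * (d x)\<^sup>2 + 1 / \<eta>" "T / 2"] \<open>0 < T\<close> by simp
    moreover have "x $ 2 * \<bar>d x\<bar> \<le> T * \<bar>d x\<bar>"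
      using True by (intro mult_right_mono) (auto simp: mem_box_region)
    ultimately show ?thesis using True by simp
  qed (use assms in simp)
  have int: "integrable lborel (\<lambda>x. T / 2 * (\<eta> * (d x)\<^sup>2 + indicator (box_region T) x / \<eta>))"
    using d box_region_integrable by (intro integrable_mult_right integrable_divide Bochner_Integration.integrable_add) auto
  have "wt (cut d (box_region T)) \<le> (\<integral>x. T / 2 * (\<eta> * (d x)\<^sup>2 + indicator (box_region T) x / \<eta>) \<partial>lborel)"
    unfolding wt_def using int pt profile_integrable_wt[OF profile_restrict[OF d box_region_borel]]
    by (intro integral_mono) auto
  also have "\<dots> = T / 2 * (\<eta> * sqn d + vol_box T / \<eta>)"
    using profileD(3)[OF d] box_region_integrable[of T] by (simp add: sqn_def Bochner_Integration.integral_add)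
  finally show ?thesis .
qed

lemma wt_cut_Un_le:
  assumes "profile f" "A \<in> sets borel" "B \<in> sets borel"
  shows "wt (cut f (A \<union> B)) \<le> wt (cut f A) + wt (cut f B)"
  using assms by (intro wt_triangle profile_restrict) (auto simp: indicator_def)

definition tight :: "(nat \<Rightarrow> real^2 \<Rightarrow> real) \<Rightarrow> bool" where
  "tight h \<longleftrightarrow> (\<forall>\<epsilon>>0. \<exists>T>0. eventually (\<lambda>n. wt (cut (h n) (- box_region T)) \<le> \<epsilon>) sequentially)"

lemma nn_fatou:
  fixes \<phi> :: "nat \<Rightarrow> real^2 \<Rightarrow> real"
  assumes [measurable]: "\<And>k. \<phi> k \<in> borel_measurable borel" "\<psi> \<in> borel_measurable borel"
    and lim: "AE x in lborel. (\<lambda>k. \<phi> k x) \<longlonglongrightarrow> \<psi> x"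
    and nonneg: "\<And>k x. 0 \<le> \<phi> k x" "\<And>x. 0 \<le> \<psi> x"
    and int: "\<And>k. integrable lborel (\<phi> k)"
    and bound: "eventually (\<lambda>k. (\<integral>x. \<phi> k x \<partial>lborel) \<le> c) sequentially"
  shows "integrable lborel \<psi>" "(\<integral>x. \<psi> x \<partial>lborel) \<le> c"
proof -
  have "AE x in lborel. ennreal (\<psi> x) = liminf (\<lambda>k. ennreal (\<phi> k x))"
    using lim by eventually_elim (intro lim_imp_Liminf[symmetric] tendsto_ennrealI, auto)
  then have "(\<integral>\<^sup>+x. ennreal (\<psi> x) \<partial>lborel) = (\<integral>\<^sup>+x. liminf (\<lambda>k. ennreal (\<phi> k x)) \<partial>lborel)"
    by (intro nn_integral_cong_AE)
  also have "\<dots> \<le> liminf (\<lambda>k. \<integral>\<^sup>+x. ennreal (\<phi> k x) \<partial>lborel)"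
    by (intro nn_integral_liminf) measurable
  also have "\<dots> \<le> liminf (\<lambda>k. ennreal c)"
  proof (rule Liminf_mono)
    show "eventually (\<lambda>k. (\<integral>\<^sup>+x. ennreal (\<phi> k x) \<partial>lborel) \<le> ennreal c) sequentially"
      using bound
    proof eventually_elim
      case (elim k)
      have "(\<integral>\<^sup>+x. ennreal (\<phi> k x) \<partial>lborel) = ennreal (\<integral>x. \<phi> k x \<partial>lborel)"
        using int nonneg by (intro nn_integral_eq_integral) auto
      then show ?case using elim by (simp add: ennreal_leI)
    qed
  qed
  also have "\<dots> = ennreal c" by (simp add: Liminf_const)
  finally have le: "(\<integral>\<^sup>+x. ennreal (\<psi> x) \<partial>lborel) \<le> ennreal c" .
  show i: "integrable lborel \<psi>"
  proof (rule integrableI_bounded)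
    show "(\<integral>\<^sup>+x. ennreal (norm (\<psi> x)) \<partial>lborel) < \<infinity>"
      using le nonneg by (simp add: top.not_eq_extremum[symmetric]) (metis ennreal_neq_top neq_top_trans)
  qed measurable
  obtain k where "(\<integral>x. \<phi> k x \<partial>lborel) \<le> c" using bound by (auto dest!: eventually_happens)
  then have "0 \<le> c" using Bochner_Integration.integral_nonneg[of lborel "\<phi> k"] nonneg by (meson order_trans)
  then show "(\<integral>x. \<psi> x \<partial>lborel) \<le> c"
    using le i nonneg by (simp add: nn_integral_eq_integral)
qed

text \<open>
  This is the argument of Riesz and Fischer.  For consecutive differences \<open>d k\<close> with
  \<open>sqn (d k) \<le> (1/8) ^ k\<close> the series of \<open>2 ^ k * (d k x)\<^sup>2\<close> converges almost everywhere, and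
  \<open>2 * \<bar>d k x\<bar> \<le> 2 ^ k * (d k x)\<^sup>2 + (1/2) ^ k\<close> makes the differences absolutely summable.  Fatou's lemma
  turns the pointwise limit into a limit in the norm.
\<close>

lemma L2_cauchy_limit:
  fixes u :: "nat \<Rightarrow> real^2 \<Rightarrow> real"
  assumes p: "\<And>k. profile (u k)" and nn: "\<And>k x. 0 \<le> u k x"
    and bd: "\<And>k. wt (u k) \<le> M"
    and cauchy: "\<And>\<epsilon>. 0 < \<epsilon> \<Longrightarrow> \<exists>N. \<forall>i\<ge>N. \<forall>j\<ge>N. sqn (\<lambda>x. u i x - u j x) \<le> \<epsilon>"
  shows "\<exists>r g. strict_mono (r::nat \<Rightarrow> nat) \<and> profile g \<and> (\<forall>x. 0 \<le> g x) \<and>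
    (AE x in lborel. (\<lambda>k. u (r k) x) \<longlonglongrightarrow> g x) \<and> (\<lambda>k. sqn (\<lambda>x. u (r k) x - g x)) \<longlonglongrightarrow> 0"
proof -
  have [measurable]: "\<And>k. u k \<in> borel_measurable borel" using p by auto
  have "\<forall>k. \<exists>N. \<forall>i\<ge>N. \<forall>j\<ge>N. sqn (\<lambda>x. u i x - u j x) \<le> (1/8) ^ k"
    using cauchy by simp
  from choice[OF this] obtain N where N: "\<And>k i j. N k \<le> i \<Longrightarrow> N k \<le> j \<Longrightarrow> sqn (\<lambda>x. u i x - u j x) \<le> (1/8) ^ k"
    by blast
  \<comment> \<open>A strictly increasing sequence above \<open>N\<close>.\<close>
  define r where "r = (\<lambda>k. (\<Sum>l\<le>k. N l) + k)"
  have r: "strict_mono r" by (intro strict_monoI_Suc) (simp add: r_def)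
  have rN: "N k \<le> r k" for k
    using member_le_sum[of k "{..k}" N] by (simp add: r_def)
  define d where "d k x = u (r (Suc k)) x - u (r k) x" for k x
  have dm [measurable]: "d k \<in> borel_measurable borel" for k unfolding d_def by measurable
  have pd: "profile (d k)" for k unfolding d_def using p by (intro profile_diff)
  have dk: "sqn (d k) \<le> (1/8) ^ k" for k
    unfolding d_def using rN[of k] strict_monoD[OF r, of k "Suc k"] by (intro N) auto
  have "(\<integral>\<^sup>+x. (\<Sum>k. ennreal (2 ^ k * (d k x)\<^sup>2)) \<partial>lborel) = (\<Sum>k. \<integral>\<^sup>+x. ennreal (2 ^ k * (d k x)\<^sup>2) \<partial>lborel)"
    by (rule nn_integral_suminf) measurable
  also have "\<dots> \<le> (\<Sum>k. ennreal ((1/4) ^ k))"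
  proof (intro suminf_le)
    fix k
    have "(\<integral>\<^sup>+x. ennreal (2 ^ k * (d k x)\<^sup>2) \<partial>lborel) = ennreal (2 ^ k * sqn (d k))"
      using profileD(3)[OF pd, of k] by (subst nn_integral_eq_integral) (auto simp: sqn_def)
    also have "\<dots> \<le> ennreal (2 ^ k * (1/8) ^ k)" using dk[of k] by (intro ennreal_leI mult_left_mono) auto
    also have "2 ^ k * (1/8) ^ k = (1/4::real) ^ k" by (simp flip: power_mult_distrib)
    finally show "(\<integral>\<^sup>+x. ennreal (2 ^ k * (d k x)\<^sup>2) \<partial>lborel) \<le> ennreal ((1/4) ^ k)" .
  qed auto
  also have "\<dots> = ennreal (1 / (1 - 1/4))"
  proof (rule suminf_ennreal_eq)
    show "(\<lambda>k. (1/4) ^ k) sums (1 / (1 - 1/4 :: real))" by (rule geometric_sums) simp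
  qed simp
  finally have "(\<integral>\<^sup>+x. (\<Sum>k. ennreal (2 ^ k * (d k x)\<^sup>2)) \<partial>lborel) \<noteq> \<infinity>"
    by (metis ennreal_neq_top infinity_ennreal_def neq_top_trans)
  then have "AE x in lborel. (\<Sum>k. ennreal (2 ^ k * (d k x)\<^sup>2)) \<noteq> \<infinity>"
    by (intro nn_integral_noteq_infinite) measurable
  then have conv: "AE x in lborel. convergent (\<lambda>k. u (r k) x)"
  proof eventually_elim
    case (elim x)
    then have s: "summable (\<lambda>k. 2 ^ k * (d k x)\<^sup>2)"
      by (intro summable_suminf_not_top) auto
    have "summable (\<lambda>k. (2 ^ k * (d k x)\<^sup>2 + (1/2) ^ k) / 2)"
      using s by (intro summable_divide summable_add summable_geometric) auto
    then have "summable (\<lambda>k. d k x)"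
    proof (rule summable_comparison_test')
      fix k :: nat
      have "0 \<le> (2 ^ k * \<bar>d k x\<bar> - 1)\<^sup>2 / 2 ^ k" by simp
      also have "\<dots> = 2 ^ k * (d k x)\<^sup>2 + (1/2) ^ k - 2 * \<bar>d k x\<bar>"
        by (simp add: power2_eq_square field_simps)
      finally show "norm (d k x) \<le> (2 ^ k * (d k x)\<^sup>2 + (1/2) ^ k) / 2" by simp
    qed
    then have "(\<lambda>n. \<Sum>k<n. d k x) \<longlonglongrightarrow> (\<Sum>k. d k x)" by (rule summable_LIMSEQ)
    moreover have "(\<Sum>k<n. d k x) = u (r n) x - u (r 0) x" for n
      unfolding d_def by (rule sum_lessThan_telescope)
    ultimately have "(\<lambda>n. u (r n) x - u (r 0) x + u (r 0) x) \<longlonglongrightarrow> (\<Sum>k. d k x) + u (r 0) x"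
      by (intro tendsto_add) auto
    then show ?case by (auto simp: convergent_def)
  qed
  define g where "g x = \<bar>lim (\<lambda>k. u (r k) x)\<bar> * indicator {x. 0 < x $ 2} x" for x
  have gm [measurable]: "g \<in> borel_measurable borel" unfolding g_def by measurable
  have gn: "0 \<le> g x" for x by (simp add: g_def)
  have lim: "AE x in lborel. (\<lambda>k. u (r k) x) \<longlonglongrightarrow> g x"
    using conv
  proof eventually_elim
    case (elim x)
    show ?case
    proof (cases "x $ 2 \<le> 0")
      case True
      then show ?thesis using profileD(2)[OF p] by (simp add: g_def)
    next
      case False
      have l: "(\<lambda>k. u (r k) x) \<longlonglongrightarrow> lim (\<lambda>k. u (r k) x)" using elim by (simp add: convergent_LIMSEQ_iff)
      then have "0 \<le> lim (\<lambda>k. u (r k) x)" using nn by (intro LIMSEQ_le_const) auto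
      then show ?thesis using l False by (simp add: g_def)
    qed
  qed
  have diff: "integrable lborel (\<lambda>x. (u (r k) x - g x)\<^sup>2) \<and> sqn (\<lambda>x. u (r k) x - g x) \<le> (1/8) ^ m"
    if "m \<le> k" for k m
  proof -
    have ev: "eventually (\<lambda>j. (\<integral>x. (u (r k) x - u (r j) x)\<^sup>2 \<partial>lborel) \<le> (1/8) ^ m) sequentially"
      using eventually_ge_at_top[of m]
    proof eventually_elim
      case (elim j)
      have "N m \<le> r k" "N m \<le> r j"
        using rN[of m] that elim strict_mono_less_eq[OF r] by (auto intro: order_trans)
      then show ?case using N unfolding sqn_def by blast
    qed
    have "AE x in lborel. (\<lambda>j. (u (r k) x - u (r j) x)\<^sup>2) \<longlonglongrightarrow> (u (r k) x - g x)\<^sup>2"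
      using lim by eventually_elim (intro tendsto_intros)
    from nn_fatou[OF _ _ this _ _ _ ev] show ?thesis
      using profileD(3)[OF profile_diff[OF p p]] by (auto simp: sqn_def)
  qed
  have gw: "integrable lborel (\<lambda>x. x $ 2 * \<bar>g x\<bar>)"
  proof (rule nn_fatou(1)[where \<phi> = "\<lambda>k x. x $ 2 * \<bar>u (r k) x\<bar>" and c = M])
    show "AE x in lborel. (\<lambda>k. x $ 2 * \<bar>u (r k) x\<bar>) \<longlonglongrightarrow> x $ 2 * \<bar>g x\<bar>"
      using lim by eventually_elim (intro tendsto_intros)
    show "0 \<le> x $ 2 * \<bar>u (r k) x\<bar>" for k x by (rule profile_wt_nonneg_pt[OF p])
    show "0 \<le> x $ 2 * \<bar>g x\<bar>" for x by (auto simp: g_def indicator_def)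
    show "integrable lborel (\<lambda>x. x $ 2 * \<bar>u (r k) x\<bar>)" for k by (rule profile_integrable_wt[OF p])
    show "eventually (\<lambda>k. (\<integral>x. x $ 2 * \<bar>u (r k) x\<bar> \<partial>lborel) \<le> M) sequentially"
      using bd by (simp add: wt_def)
  qed measurable
  have "integrable lborel (\<lambda>x. (g x)\<^sup>2)"
  proof (rule Bochner_Integration.integrable_bound)
    show "integrable lborel (\<lambda>x. 2 * (u (r 0) x)\<^sup>2 + 2 * (u (r 0) x - g x)\<^sup>2)"
      using diff[of 0 0] profileD(3)[OF p] by (intro Bochner_Integration.integrable_add integrable_mult_right) auto
    show "AE x in lborel. norm ((g x)\<^sup>2) \<le> norm (2 * (u (r 0) x)\<^sup>2 + 2 * (u (r 0) x - g x)\<^sup>2)"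
    proof (intro AE_I2)
      fix x
      have "0 \<le> (2 * u (r 0) x - g x)\<^sup>2" by simp
      also have "\<dots> = 2 * (u (r 0) x)\<^sup>2 + 2 * (u (r 0) x - g x)\<^sup>2 - (g x)\<^sup>2"
        by (simp add: power2_eq_square algebra_simps)
      finally show "norm ((g x)\<^sup>2) \<le> norm (2 * (u (r 0) x)\<^sup>2 + 2 * (u (r 0) x - g x)\<^sup>2)" by simp
    qed
  qed measurable
  then have pg: "profile g" using gw gn by (auto simp: profile_def g_def)
  have "(\<lambda>k. sqn (\<lambda>x. u (r k) x - g x)) \<longlonglongrightarrow> 0"
  proof (rule tendsto_sandwich[OF _ _ tendsto_const])
    show "eventually (\<lambda>k. sqn (\<lambda>x. u (r k) x - g x) \<le> (1/8) ^ k) sequentially" using diff by simp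
    show "(\<lambda>k. (1/8::real) ^ k) \<longlonglongrightarrow> 0" by (rule LIMSEQ_power_zero) simp
  qed simp
  then show ?thesis using r pg gn lim by blast
qed

text \<open>
  Tightness controls the impulse outside of a box, convergence of the norms the impulse inside.
\<close>

lemma wt_tendsto_of_sqn:
  assumes p: "\<And>k. profile (u k)" and g: "profile g"
    and lim: "AE x in lborel. (\<lambda>k. u k x) \<longlonglongrightarrow> g x"
    and sq: "(\<lambda>k. sqn (\<lambda>x. u k x - g x)) \<longlonglongrightarrow> 0" and tt: "tight u"
  shows "(\<lambda>k. wt (\<lambda>x. u k x - g x)) \<longlonglongrightarrow> 0"
proof (rule LIMSEQ_I)
  fix \<epsilon> :: real assume \<epsilon>: "0 < \<epsilon>"
  have [measurable]: "\<And>k. u k \<in> borel_measurable borel" "g \<in> borel_measurable borel" using p g by auto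
  obtain T where T: "T > 0" "eventually (\<lambda>n. wt (cut (u n) (- box_region T)) \<le> \<epsilon> / 5) sequentially"
    using tt \<epsilon> unfolding tight_def by (meson divide_pos_pos zero_less_numeral)
  have mB: "- box_region T \<in> sets borel" by simp
  have gT: "wt (cut g (- box_region T)) \<le> \<epsilon> / 5"
    unfolding wt_def
  proof (rule nn_fatou(2)[where \<phi> = "\<lambda>k x. x $ 2 * \<bar>cut (u k) (- box_region T) x\<bar>"])
    show "AE x in lborel. (\<lambda>k. x $ 2 * \<bar>cut (u k) (- box_region T) x\<bar>) \<longlonglongrightarrow> x $ 2 * \<bar>cut g (- box_region T) x\<bar>"
      using lim by eventually_elim (intro tendsto_intros)
    show "0 \<le> x $ 2 * \<bar>cut (u k) (- box_region T) x\<bar>" for k x by (rule profile_wt_nonneg_pt[OF profile_restrict[OF p mB]])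
    show "0 \<le> x $ 2 * \<bar>cut g (- box_region T) x\<bar>" for x by (rule profile_wt_nonneg_pt[OF profile_restrict[OF g mB]])
    show "integrable lborel (\<lambda>x. x $ 2 * \<bar>cut (u k) (- box_region T) x\<bar>)" for k
      by (rule profile_integrable_wt[OF profile_restrict[OF p mB]])
    show "eventually (\<lambda>k. (\<integral>x. x $ 2 * \<bar>cut (u k) (- box_region T) x\<bar> \<partial>lborel) \<le> \<epsilon> / 5) sequentially"
      using T(2) by (simp add: wt_def)
  qed measurable
  define V where "V = vol_box T"
  have V: "V \<ge> 0" by (simp add: V_def)
  define \<eta> where "\<eta> = T * (V + 1) * 5 / (2 * \<epsilon>)"
  have \<eta>: "\<eta> > 0" using T V \<epsilon> by (simp add: \<eta>_def)
  have Tv: "T / 2 * (V / \<eta>) \<le> \<epsilon> / 5"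
  proof -
    have "T / 2 * (V / \<eta>) \<le> T / 2 * ((V + 1) / \<eta>)" using T \<eta> by (intro mult_left_mono divide_right_mono) auto
    also have "\<dots> = \<epsilon> / 5" using T V \<epsilon> \<eta> by (simp add: \<eta>_def field_simps)
    finally show ?thesis .
  qed
  have "(\<lambda>k. T / 2 * (\<eta> * sqn (\<lambda>x. u k x - g x))) \<longlonglongrightarrow> T / 2 * (\<eta> * 0)"
    by (intro tendsto_intros sq)
  from order_tendstoD(2)[OF this, of "\<epsilon> / 5"] \<epsilon>
  have "eventually (\<lambda>k. T / 2 * (\<eta> * sqn (\<lambda>x. u k x - g x)) < \<epsilon> / 5) sequentially"
    by simp
  then have "eventually (\<lambda>k. norm (wt (\<lambda>x. u k x - g x) - 0) < \<epsilon>) sequentially"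
    using T(2)
  proof eventually_elim
    case (elim k)
    define d where "d = (\<lambda>x. u k x - g x)"
    have d: "profile d" unfolding d_def by (intro profile_diff p g)
    have "wt d = wt (cut d (box_region T)) + wt (cut d (- box_region T))" by (rule wt_split[OF d]) simp
    also have "wt (cut d (- box_region T)) \<le> wt (cut (u k) (- box_region T)) + wt (cut g (- box_region T))"
      by (intro wt_triangle profile_restrict p g d mB) (auto simp: d_def indicator_def)
    also have "wt (cut d (box_region T)) \<le> T / 2 * (\<eta> * sqn d + V / \<eta>)"
      unfolding V_def by (rule wt_cut_box_le[OF d T(1) \<eta>])
    finally have "wt d < \<epsilon>" using elim gT Tv \<epsilon> by (simp add: d_def distrib_left)
    then show ?case using wt_nonneg[OF d] by (simp add: d_def)
  qed
  then show "\<exists>no. \<forall>n\<ge>no. norm (wt (\<lambda>x. u n x - g x) - 0) < \<epsilon>"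
    by (simp add: eventually_sequentially)
qed

lemma sqn_tendsto:
  assumes p: "\<And>k. profile (u k)" and g: "profile g"
    and sq: "(\<lambda>k. sqn (\<lambda>x. u k x - g x)) \<longlonglongrightarrow> 0"
  shows "(\<lambda>k. sqn (u k)) \<longlonglongrightarrow> sqn g"
proof (rule LIMSEQ_I)
  fix \<epsilon> :: real assume \<epsilon>: "0 < \<epsilon>"
  define \<eta> where "\<eta> = \<epsilon> / (2 * (sqn g + 1))"
  have sg: "0 < sqn g + 1" using sqn_nonneg[of g] by linarith
  have \<eta>: "\<eta> > 0" using \<epsilon> sg by (simp add: \<eta>_def)
  have e2: "\<eta> * sqn g \<le> \<epsilon> / 2"
  proof -
    have "\<eta> * sqn g \<le> \<eta> * (sqn g + 1)" using \<eta> by (intro mult_left_mono) auto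
    also have "\<dots> = \<epsilon> / 2"
    proof -
      have "\<epsilon> / (2 * R) * R = \<epsilon> / 2" if "0 < R" for R using that by simp
      from this[OF sg] show ?thesis by (simp add: \<eta>_def)
    qed
    finally show ?thesis .
  qed
  have "(\<lambda>k. (1 / \<eta> + 1) * sqn (\<lambda>x. u k x - g x)) \<longlonglongrightarrow> (1 / \<eta> + 1) * 0"
    by (intro tendsto_intros sq)
  then have "eventually (\<lambda>k. (1 / \<eta> + 1) * sqn (\<lambda>x. u k x - g x) < \<epsilon> / 2) sequentially"
    using \<epsilon> by (intro order_tendstoD) auto
  then have "eventually (\<lambda>k. norm (sqn (u k) - sqn g) < \<epsilon>) sequentially"
  proof eventually_elim
    case (elim k)
    define d where "d = (\<lambda>x. u k x - g x)"
    have d: "profile d" unfolding d_def by (intro profile_diff p g)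
    have "u k = (\<lambda>x. 1 * g x + 1 * d x)" by (simp add: d_def)
    then have "sqn (u k) = sqn g + 2 * (\<integral>x. g x * d x \<partial>lborel) + sqn d"
      using sqn_lincomb[OF g d, of 1 1] by simp
    moreover have "\<bar>2 * (\<integral>x. g x * d x \<partial>lborel)\<bar> \<le> \<eta> * sqn g + 1 / \<eta> * sqn d"
    proof -
      have "0 \<le> \<eta>\<^sup>2 * sqn g + 2 * \<eta> * (\<integral>x. g x * d x \<partial>lborel) + sqn d"
        using sqn_nonneg[of "\<lambda>x. \<eta> * g x + 1 * d x"] unfolding sqn_lincomb[OF g d] by simp
      moreover have "0 \<le> \<eta>\<^sup>2 * sqn g - 2 * \<eta> * (\<integral>x. g x * d x \<partial>lborel) + sqn d"
        using sqn_nonneg[of "\<lambda>x. \<eta> * g x + (-1) * d x"] unfolding sqn_lincomb[OF g d] by simp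
      ultimately have "\<eta> * \<bar>2 * (\<integral>x. g x * d x \<partial>lborel)\<bar> \<le> \<eta>\<^sup>2 * sqn g + sqn d"
        using \<eta> by (simp add: abs_if)
      then have "\<bar>2 * (\<integral>x. g x * d x \<partial>lborel)\<bar> \<le> (\<eta>\<^sup>2 * sqn g + sqn d) / \<eta>"
        using \<eta> by (simp add: pos_le_divide_eq mult.commute)
      then show ?thesis using \<eta> by (simp add: add_divide_distrib power2_eq_square)
    qed
    moreover have "(1 / \<eta> + 1) * sqn d = 1 / \<eta> * sqn d + sqn d" by (simp add: distrib_right)
    moreover have "0 \<le> sqn d" by (rule sqn_nonneg)
    ultimately have "\<bar>sqn (u k) - sqn g\<bar> \<le> \<eta> * sqn g + (1 / \<eta> + 1) * sqn d"
      by linarith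
    then have "\<bar>sqn (u k) - sqn g\<bar> < \<epsilon>" using elim e2 unfolding d_def by linarith
    then show ?case by simp
  qed
  then show "\<exists>no. \<forall>n\<ge>no. norm (sqn (u n) - sqn g) < \<epsilon>" by (simp add: eventually_sequentially)
qed

lemma wt_tendsto:
  assumes p: "\<And>k. profile (u k)" and g: "profile g"
    and w: "(\<lambda>k. wt (\<lambda>x. u k x - g x)) \<longlonglongrightarrow> 0"
  shows "(\<lambda>k. wt (u k)) \<longlonglongrightarrow> wt g"
proof -
  have "\<bar>wt (u k) - wt g\<bar> \<le> wt (\<lambda>x. u k x - g x)" for k
  proof -
    have d: "profile (\<lambda>x. u k x - g x)" by (intro profile_diff p g)
    have "wt (u k) \<le> wt g + wt (\<lambda>x. u k x - g x)" by (intro wt_triangle p g d) auto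
    moreover have "wt g \<le> wt (u k) + wt (\<lambda>x. u k x - g x)" by (intro wt_triangle p g d) auto
    ultimately show ?thesis by linarith
  qed
  then have "(\<lambda>k. wt (u k) - wt g) \<longlonglongrightarrow> 0"
    by (intro Lim_null_comparison[OF _ w]) auto
  then show ?thesis by (simp add: LIM_zero_iff)
qed

section \<open>Strong compactness of maximizing sequences\<close>

context half_plane_kernel
begin

lemma En_tendsto:
  assumes p: "\<And>k. profile (u k)" and g: "profile g"
    and sq: "(\<lambda>k. sqn (\<lambda>x. u k x - g x)) \<longlonglongrightarrow> 0"
    and w: "(\<lambda>k. wt (\<lambda>x. u k x - g x)) \<longlonglongrightarrow> 0"
  shows "(\<lambda>k. En (u k)) \<longlonglongrightarrow> En g"
proof -
  define d where "d k = (\<lambda>x. u k x - g x)" for k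
  have d: "profile (d k)" for k unfolding d_def by (intro profile_diff p g)
  have small: "(\<lambda>k. bil kern (v k) (d k)) \<longlonglongrightarrow> 0"
    if v: "\<And>k. profile (v k)" and vs: "Bseq (\<lambda>k. sqn (v k))" and vw: "Bseq (\<lambda>k. wt (v k))" for v
  proof (rule LIMSEQ_I)
    fix \<epsilon> :: real assume \<epsilon>: "0 < \<epsilon>"
    have "Bseq (\<lambda>k. sqn (d k))" using sq by (intro convergent_imp_Bseq convergentI) (simp add: d_def)
    then obtain K1 where K1: "K1 > 0" "\<And>k. norm (sqn (d k)) \<le> K1" by (auto simp: Bseq_def)
    obtain K2 where K2: "K2 > 0" "\<And>k. norm (sqn (v k)) \<le> K2" using vs by (auto simp: Bseq_def)
    obtain M where M: "M > 0" "\<And>k. norm (wt (v k)) \<le> M" using vw by (auto simp: Bseq_def)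
    have "0 \<le> max K1 K2" "0 \<le> M" "0 < \<epsilon> / 2" using K1 M \<epsilon> by auto
    from bil_small[OF this] obtain \<delta> where \<delta>: "\<delta> > 0" "\<And>f g. profile f \<Longrightarrow> profile g \<Longrightarrow> sqn f \<le> max K1 K2 \<Longrightarrow>
        sqn g \<le> max K1 K2 \<Longrightarrow> wt f \<le> M \<Longrightarrow> wt g \<le> \<delta> \<Longrightarrow> \<bar>bil kern f g\<bar> \<le> \<epsilon> / 2"
      by blast
    have "eventually (\<lambda>k. wt (d k) < \<delta>) sequentially"
      using order_tendstoD(2)[OF w \<delta>(1)] by (simp add: d_def)
    then have "eventually (\<lambda>k. norm (bil kern (v k) (d k) - 0) < \<epsilon>) sequentially"
    proof eventually_elim
      case (elim k)
      have "sqn (v k) \<le> K2" "sqn (d k) \<le> K1" "wt (v k) \<le> M"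
        using K1(2)[of k] K2(2)[of k] M(2)[of k] by auto
      then have "\<bar>bil kern (v k) (d k)\<bar> \<le> \<epsilon> / 2"
        using elim by (intro \<delta>(2) v d) auto
      then show ?case using \<epsilon> by simp
    qed
    then show "\<exists>no. \<forall>n\<ge>no. norm (bil kern (v n) (d n) - 0) < \<epsilon>" by (simp add: eventually_sequentially)
  qed
  have eq: "bil kern (u k) (u k) = bil kern g g + bil kern (u k) (d k) + bil kern g (d k)" for k
  proof -
    have "u k = (\<lambda>x. g x + d k x)" by (simp add: d_def)
    then have "bil kern (u k) (u k) = bil kern (u k) g + bil kern (u k) (d k)"
      using bil_add_right[OF g d p[of k], of k] by simp
    moreover have "bil kern (u k) g = bil kern g g + bil kern (d k) g"
      using \<open>u k = _\<close> bil_add_left[OF g d g, of k] by simp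
    ultimately show ?thesis using bil_commute[OF d g, of k] by simp
  qed
  have "(\<lambda>k. bil kern g g + bil kern (u k) (d k) + bil kern g (d k)) \<longlonglongrightarrow> bil kern g g + 0 + 0"
  proof (intro tendsto_add tendsto_const small)
    show "Bseq (\<lambda>k. sqn (u k))" using sqn_tendsto[OF p g sq] by (intro convergent_imp_Bseq convergentI)
    show "Bseq (\<lambda>k. wt (u k))" using wt_tendsto[OF p g w] by (intro convergent_imp_Bseq convergentI)
  qed (use p g in auto)
  then have "(\<lambda>k. bil kern (u k) (u k)) \<longlonglongrightarrow> bil kern g g" by (simp add: eq)
  then show ?thesis unfolding En_def using sqn_tendsto[OF p g sq] by (intro tendsto_intros) auto
qed

text \<open>
  The energy of \<open>u + v\<close> is at most \<open>cstar * (wt u + wt v)\<^sup>2\<close>, so by the parallelogram identity the energy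
  of \<open>u - v\<close> is bounded below in terms of the defects of \<open>u\<close> and \<open>v\<close>.  The near part of the interaction of \<open>u - v\<close>
  with itself is at most half of its squared norm and is absorbed on the left.  What remains on the
  right is a smoothing operator, and this is the source of strong compactness.
\<close>

lemma quadratic_defect:
  assumes u: "vort u" and v: "vort v" and r: "0 < r" "near_mass r \<le> 1/2"
  shows "sqn (\<lambda>x. u x - v x) \<le> 2 * bil (far r) (\<lambda>x. u x - v x) (\<lambda>x. u x - v x)
     + 8 * (cstar * (wt u)\<^sup>2 - En u) + 8 * (cstar * (wt v)\<^sup>2 - En v)"
proof -
  define d where "d = (\<lambda>x. u x - v x)"
  note pu = vortD(1)[OF u] and pv = vortD(1)[OF v]
  have d: "profile d" unfolding d_def by (intro profile_diff pu pv)
  define a where "a = wt u"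
  define b where "b = wt v"
  have "En (\<lambda>x. u x + v x) \<le> cstar * (a + b)\<^sup>2"
    using En_le_cstar[OF vort_add[OF u v]] wt_add[OF pu pv] u v by (simp add: vort_def a_def b_def)
  also have "\<dots> \<le> cstar * (2 * a\<^sup>2 + 2 * b\<^sup>2)"
  proof (intro mult_left_mono)
    have "0 \<le> (a - b)\<^sup>2" by simp
    then show "(a + b)\<^sup>2 \<le> 2 * a\<^sup>2 + 2 * b\<^sup>2" by (simp add: power2_eq_square algebra_simps)
  qed (use cstar_pos in simp)
  finally have "En d \<ge> 2 * En u + 2 * En v - cstar * (2 * a\<^sup>2 + 2 * b\<^sup>2)"
    using En_parallelogram[OF pu pv] by (simp add: d_def)
  then have 1: "sqn d \<le> bil kern d d + 4 * (cstar * a\<^sup>2 - En u) + 4 * (cstar * b\<^sup>2 - En v)"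
    by (simp add: En_def[of d] algebra_simps)
  have "\<bar>bil (\<lambda>x y. kern x y - far r x y) d d\<bar> \<le> 1 * near_mass r / 2 * (sqn d + sqn d) + 0 * (wt d * wt d)"
    using kern_far_diff r by (intro bil_bound(2)[OF d d]) auto
  also have "\<dots> \<le> 1/2 * sqn d" using r mult_right_mono[OF r(2), of "sqn d"] by simp
  finally have 2: "bil (\<lambda>x y. kern x y - far r x y) d d \<le> 1/2 * sqn d" by simp
  have "bil kern d d = bil (\<lambda>x y. kern x y - far r x y) d d + bil (far r) d d"
  proof -
    have "bil (\<lambda>x y. kern x y - far r x y) d d = (\<integral>p. d (fst p) * kern (fst p) (snd p) * d (snd p)
        - d (fst p) * far r (fst p) (snd p) * d (snd p) \<partial>(lborel \<Otimes>\<^sub>M lborel))"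
      unfolding bil_def by (intro Bochner_Integration.integral_cong) (auto simp: algebra_simps)
    also have "\<dots> = bil kern d d - bil (far r) d d"
      unfolding bil_def using controlled_integrable[OF controlled_kern d d] controlled_integrable[OF controlled_far[OF r(1)] d d]
      by (intro Bochner_Integration.integral_diff)
    finally show ?thesis by simp
  qed
  then have "sqn d \<le> 2 * bil (far r) d d + 8 * (cstar * a\<^sup>2 - En u) + 8 * (cstar * b\<^sup>2 - En v)"
    using 1 2 by linarith
  then show ?thesis by (simp add: d_def a_def b_def)
qed

definition potential :: "real \<Rightarrow> (real^2 \<Rightarrow> real) \<Rightarrow> real^2 \<Rightarrow> real" where
  "potential r u x = (\<integral>y. far r x y * u y \<partial>lborel)"

lemma far_section_measurable [measurable]: "far r x \<in> borel_measurable borel"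
  unfolding far_def by measurable

lemma far_mult_integrable:
  assumes "0 < r" "integrable lborel u"
  shows "integrable lborel (\<lambda>y. far r x y * u y)"
proof (rule Bochner_Integration.integrable_bound)
  show "integrable lborel (\<lambda>y. c2 s * r powr (2 * s - 2) * \<bar>u y\<bar>)" using assms by auto
  have [measurable]: "u \<in> borel_measurable borel" using assms by auto
  show "(\<lambda>y. far r x y * u y) \<in> borel_measurable lborel" by measurable
  show "AE y in lborel. norm (far r x y * u y) \<le> norm (c2 s * r powr (2 * s - 2) * \<bar>u y\<bar>)"
    using far_le_const[OF assms(1)] c2_pos by (intro AE_I2) (auto simp: abs_mult intro!: mult_right_mono)
qed

lemma potential_bounded:
  assumes "0 < r" "integrable lborel u"
  shows "\<bar>potential r u x\<bar> \<le> c2 s * r powr (2 * s - 2) * (\<integral>y. \<bar>u y\<bar> \<partial>lborel)"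
proof -
  have "\<bar>potential r u x\<bar> \<le> (\<integral>y. \<bar>far r x y * u y\<bar> \<partial>lborel)"
    unfolding potential_def by (rule integral_abs_bound)
  also have "\<dots> \<le> (\<integral>y. c2 s * r powr (2 * s - 2) * \<bar>u y\<bar> \<partial>lborel)"
  proof (rule integral_mono)
    show "\<bar>far r x y * u y\<bar> \<le> c2 s * r powr (2 * s - 2) * \<bar>u y\<bar>" for y
      unfolding abs_mult by (intro mult_right_mono far_le_const assms) auto
  qed (use far_mult_integrable[OF assms, of x] assms in \<open>auto simp del: abs_mult\<close>)
  finally show ?thesis by simp
qed

lemma potential_lipschitz:
  assumes "0 < r" "integrable lborel u"
  shows "\<bar>potential r u x - potential r u y\<bar>
     \<le> 2 * c2 s * (2 - 2 * s) * r powr (2 * s - 3) * norm (x - y) * (\<integral>z. \<bar>u z\<bar> \<partial>lborel)"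
proof -
  define L where "L = 2 * c2 s * (2 - 2 * s) * r powr (2 * s - 3) * norm (x - y)"
  note ints = far_mult_integrable[OF assms]
  have "potential r u x - potential r u y = (\<integral>z. far r x z * u z - far r y z * u z \<partial>lborel)"
    unfolding potential_def using ints by (intro Bochner_Integration.integral_diff[symmetric])
  then have "\<bar>potential r u x - potential r u y\<bar> \<le> (\<integral>z. \<bar>far r x z * u z - far r y z * u z\<bar> \<partial>lborel)"
    by (simp only: integral_abs_bound)
  also have "\<dots> \<le> (\<integral>z. L * \<bar>u z\<bar> \<partial>lborel)"
  proof (rule integral_mono)
    show "\<bar>far r x z * u z - far r y z * u z\<bar> \<le> L * \<bar>u z\<bar>" for z
      using far_lipschitz[OF assms(1), of x z y] unfolding L_def left_diff_distrib[symmetric] abs_mult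
      by (intro mult_right_mono) auto
  qed (use ints assms in auto)
  finally show ?thesis by (simp add: L_def)
qed

lemma potential_diff:
  assumes "0 < r" "integrable lborel u" "integrable lborel v"
  shows "potential r (\<lambda>y. u y - v y) x = potential r u x - potential r v x"
proof -
  have "potential r (\<lambda>y. u y - v y) x = (\<integral>y. far r x y * u y - far r x y * v y \<partial>lborel)"
    unfolding potential_def by (simp add: right_diff_distrib)
  then show ?thesis
    unfolding potential_def using far_mult_integrable assms by (simp add: Bochner_Integration.integral_diff)
qed

lemma bil_far_potential:
  assumes "0 < r" "profile f" "profile g"
  shows "bil (far r) f g = (\<integral>x. f x * potential r g x \<partial>lborel)"
proof -
  have "bil (far r) f g = (\<integral>x. \<integral>y. f x * far r x y * g y \<partial>lborel \<partial>lborel)"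
    unfolding bil_def
    using lborel_pair.integral_fst'[OF controlled_integrable[OF controlled_far[OF assms(1)] assms(2,3)]] by simp
  then show ?thesis unfolding potential_def by (simp add: mult.assoc)
qed

lemma bil_far_weight:
  assumes "0 < r" "profile f" "profile g"
  shows "\<bar>bil (far r) f g\<bar> \<le> far_const r * (wt f * wt g)"
  using bil_bound(2)[OF assms(2,3) far_measurable[of r] assms(1), of 0 "far_const r"] far_le far_nonneg assms(1)
  by simp

text \<open>
  The far kernel is bounded and Lipschitz continuous, so the potentials are uniformly bounded and
  equicontinuous, and the theorem of Arzela and Ascoli applies.
\<close>

lemma potential_subsequence:
  assumes r: "0 < r" and p: "\<And>n. profile (u n)" and Q: "\<And>n. sqn (u n) \<le> Q" and "0 < \<tau>"
  shows "\<exists>k N. strict_mono (k::nat \<Rightarrow> nat) \<and> (\<forall>i\<ge>N. \<forall>j\<ge>N. \<forall>x\<in>box_region T.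
     \<bar>potential r (cut (u (k i)) (box_region T)) x - potential r (cut (u (k j)) (box_region T)) x\<bar> \<le> \<tau>)"
proof -
  define m where "m = (Q + vol_box T) / 2"
  define F where "F n = potential r (cut (u n) (box_region T))" for n
  have int: "integrable lborel (cut (u n) (box_region T))" for n by (rule cut_box_integrable(1)[OF p])
  have mass: "(\<integral>x. \<bar>cut (u n) (box_region T) x\<bar> \<partial>lborel) \<le> m" for n
    using cut_box_integrable(2)[OF p, of n T] Q[of n] by (simp add: m_def)
  have m0: "m \<ge> 0" by (rule order_trans[OF Bochner_Integration.integral_nonneg mass[of 0]]) simp
  define B where "B = c2 s * r powr (2 * s - 2) * m"
  define L where "L = 2 * c2 s * (2 - 2 * s) * r powr (2 * s - 3) * m"
  have L: "L \<ge> 0" using c2_pos s_less m0 by (simp add: L_def)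
  have bounded: "norm (F n x) \<le> B" for n x
  proof -
    have "norm (F n x) \<le> c2 s * r powr (2 * s - 2) * (\<integral>x. \<bar>cut (u n) (box_region T) x\<bar> \<partial>lborel)"
      unfolding F_def using potential_bounded[OF r int, of n x] by simp
    also have "\<dots> \<le> B" unfolding B_def using mass[of n] c2_pos by (intro mult_left_mono) auto
    finally show ?thesis .
  qed
  have lip: "norm (F n x - F n y) \<le> L * norm (x - y)" for n x y
  proof -
    have "norm (F n x - F n y) \<le> 2 * c2 s * (2 - 2 * s) * r powr (2 * s - 3) * norm (x - y) *
        (\<integral>x. \<bar>cut (u n) (box_region T) x\<bar> \<partial>lborel)"
      unfolding F_def using potential_lipschitz[OF r int, of n x y] by simp
    also have "\<dots> \<le> 2 * c2 s * (2 - 2 * s) * r powr (2 * s - 3) * norm (x - y) * m"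
      using mass[of n] c2_pos s_less by (intro mult_left_mono) auto
    finally show ?thesis by (simp add: L_def mult_ac)
  qed
  have equi: "\<exists>d>0. \<forall>n y. y \<in> box_region T \<and> norm (x - y) < d \<longrightarrow> norm (F n x - F n y) < e" if "0 < e" for x e
  proof (intro exI[of _ "e / (L + 1)"] conjI allI impI)
    show "0 < e / (L + 1)" using that L by simp
    fix n y assume "y \<in> box_region T \<and> norm (x - y) < e / (L + 1)"
    then have "(L + 1) * norm (x - y) < e" using L by (simp add: field_simps)
    moreover have "L * norm (x - y) \<le> (L + 1) * norm (x - y)" by (intro mult_right_mono) auto
    ultimately show "norm (F n x - F n y) < e" using lip[of n x y] by linarith
  qed
  have "\<exists>G k. strict_mono (k :: nat \<Rightarrow> nat) \<and>
      (\<forall>e>0. \<exists>N. \<forall>n x. n \<ge> N \<and> x \<in> box_region T \<longrightarrow> norm (F (k n) x - G x) < e)"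
    by (rule Arzela_Ascoli[OF compact_box_region bounded equi]) blast+
  then obtain G k where k: "strict_mono (k :: nat \<Rightarrow> nat)"
    and G: "\<And>e. 0 < e \<Longrightarrow> \<exists>N. \<forall>n x. n \<ge> N \<and> x \<in> box_region T \<longrightarrow> norm (F (k n) x - G x) < e"
    by blast
  obtain N where N: "\<And>n x. n \<ge> N \<Longrightarrow> x \<in> box_region T \<Longrightarrow> norm (F (k n) x - G x) < \<tau> / 2"
    using G[of "\<tau> / 2"] \<open>0 < \<tau>\<close> by auto
  have "\<bar>F (k i) x - F (k j) x\<bar> \<le> \<tau>" if "N \<le> i" "N \<le> j" "x \<in> box_region T" for i j x
    using N[OF that(1,3)] N[OF that(2,3)] by (simp add: abs_if split: if_splits)
  then show ?thesis using k unfolding F_def by blast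
qed

text \<open>
  In \<open>quadratic_defect\<close> the defects tend to zero.  The part of \<open>u - v\<close> outside of a large box contributes
  little by tightness.  Inside the box the interaction is the integral of \<open>u - v\<close> against a difference
  of two potentials, which is uniformly small along the subsequence.
\<close>

lemma maximizing_almost_cauchy:
  assumes max: "maximizing h \<mu>" and tt: "tight h" and "0 < \<epsilon>" and s: "strict_mono (\<sigma> :: nat \<Rightarrow> nat)"
  shows "\<exists>k. strict_mono (k :: nat \<Rightarrow> nat) \<and>
     (\<exists>N. \<forall>i\<ge>N. \<forall>j\<ge>N. sqn (\<lambda>x. h (\<sigma> (k i)) x - h (\<sigma> (k j)) x) \<le> \<epsilon>)"
proof -
  have v: "\<And>n. vort (h n)" using max by (auto simp: maximizing_def)
  note p = vortD(1)[OF v]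
  obtain Q M where QM: "Q \<ge> 0" "M \<ge> 0" "\<And>n. sqn (h n) \<le> Q" "\<And>n. wt (h n) \<le> M"
    using maximizing_bounded[OF max] by blast
  obtain r where r: "r > 0" "near_mass r \<le> 1/2" using near_mass_small[of "1/2"] by auto
  define C where "C = far_const r * M + 1"
  have C: "C > 0" using far_const_nonneg[of r] QM(2) by (simp add: C_def add_nonneg_pos)
  \<comment> \<open>The budget is \<open>\<epsilon> / 2\<close> for twice the far interaction and \<open>\<epsilon> / 8\<close> for each of the two defects.\<close>
  define \<eta> where "\<eta> = \<epsilon> / (64 * C)"
  have \<eta>: "\<eta> > 0" using C \<open>0 < \<epsilon>\<close> by (simp add: \<eta>_def)
  obtain T where T: "T > 0" "eventually (\<lambda>n. wt (cut (h n) (- box_region T)) \<le> \<eta>) sequentially"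
    using tt \<eta> unfolding tight_def by blast
  define m where "m = (Q + vol_box T) / 2"
  have m: "m \<ge> 0" using QM(1) by (simp add: m_def)
  define \<tau> where "\<tau> = \<epsilon> / (16 * (m + 1))"
  have \<tau>: "\<tau> > 0" using \<open>0 < \<epsilon>\<close> m by (simp add: \<tau>_def)
  obtain k N where k: "strict_mono (k::nat \<Rightarrow> nat)"
    and N: "\<And>i j x. i \<ge> N \<Longrightarrow> j \<ge> N \<Longrightarrow> x \<in> box_region T \<Longrightarrow>
     \<bar>potential r (cut (h (\<sigma> (k i))) (box_region T)) x - potential r (cut (h (\<sigma> (k j))) (box_region T)) x\<bar> \<le> \<tau>"
    using potential_subsequence[where u = "\<lambda>n. h (\<sigma> n)" and T = T, OF r(1) p QM(3) \<tau>] by blast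
  have "eventually (\<lambda>n. wt (cut (h n) (- box_region T)) \<le> \<eta> \<and> cstar * (wt (h n))\<^sup>2 - En (h n) \<le> \<epsilon> / 64) sequentially"
  proof -
    have "0 < \<epsilon> / 64" using \<open>0 < \<epsilon>\<close> by simp
    from maximizing_eventually[OF max this] T(2) show ?thesis by eventually_elim auto
  qed
  then obtain N' where N': "\<And>n. n \<ge> N' \<Longrightarrow> wt (cut (h n) (- box_region T)) \<le> \<eta>"
    "\<And>n. n \<ge> N' \<Longrightarrow> cstar * (wt (h n))\<^sup>2 - En (h n) \<le> \<epsilon> / 64"
    by (auto simp: eventually_sequentially)
  have "sqn (\<lambda>x. h (\<sigma> (k i)) x - h (\<sigma> (k j)) x) \<le> \<epsilon>" if ij: "i \<ge> max N N'" "j \<ge> max N N'" for i j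
  proof -
    define u where "u = h (\<sigma> (k i))"
    define w where "w = h (\<sigma> (k j))"
    have vu: "vort u" "vort w" using v by (simp_all add: u_def w_def)
    note pu = vortD(1)[OF vu(1)] and pw = vortD(1)[OF vu(2)]
    have "\<sigma> (k i) \<ge> N'" "\<sigma> (k j) \<ge> N'"
      using ij seq_suble[OF s, of "k i"] seq_suble[OF s, of "k j"] seq_suble[OF k, of i] seq_suble[OF k, of j] by auto
    then have tu: "wt (cut u (- box_region T)) \<le> \<eta>" "wt (cut w (- box_region T)) \<le> \<eta>"
      and du: "cstar * (wt u)\<^sup>2 - En u \<le> \<epsilon> / 64" "cstar * (wt w)\<^sup>2 - En w \<le> \<epsilon> / 64"
      using N' by (simp_all add: u_def w_def)
    define d where "d = (\<lambda>x. u x - w x)"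
    have d: "profile d" unfolding d_def by (intro profile_diff pu pw)
    define a where "a = cut d (box_region T)"
    define b where "b = cut d (- box_region T)"
    have mB: "- box_region T \<in> sets borel" by simp
    have pab: "profile a" "profile b" using d profile_restrict by (auto simp: a_def b_def)
    have wd: "wt d \<le> 2 * M"
      using wt_diff_le[OF pu pw] QM(4)[of "\<sigma> (k i)"] QM(4)[of "\<sigma> (k j)"] by (simp add: d_def u_def w_def)
    have wa: "wt a \<le> wt d" unfolding a_def by (rule wt_cut_le[OF d]) simp
    have "wt b \<le> wt (cut u (- box_region T)) + wt (cut w (- box_region T))"
      unfolding b_def by (intro wt_triangle profile_restrict d pu pw mB) (auto simp: d_def indicator_def)
    then have wb: "wt b \<le> 2 * \<eta>" using tu by linarith
    have dab: "d = (\<lambda>x. 1 * a x + 1 * b x)" by (auto simp: a_def b_def indicator_def)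
    have "bil (far r) d d = bil (far r) a d + bil (far r) b d"
      using dab bil_lincomb_left[OF controlled_far[OF r(1)] pab d, of 1 1] by simp
    also have "bil (far r) a d = bil (far r) a a + bil (far r) a b"
      using dab bil_lincomb_right[OF controlled_far[OF r(1)] pab pab(1), of 1 1] by simp
    finally have split: "bil (far r) d d = bil (far r) a a + bil (far r) a b + bil (far r) b d" .
    have fb: "far_const r * (x * wt b) \<le> \<epsilon> / 16" if "0 \<le> x" "x \<le> 2 * M" for x
    proof -
      have "far_const r * (x * wt b) \<le> far_const r * ((2 * M) * (2 * \<eta>))"
        using that wb QM(2) wt_nonneg[OF pab(2)] far_const_nonneg by (intro mult_left_mono mult_mono) auto
      also have "\<dots> \<le> 4 * (C * \<eta>)" using \<eta> by (simp add: C_def algebra_simps)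
      also have "\<dots> = \<epsilon> / 16" using C by (simp add: \<eta>_def)
      finally show ?thesis .
    qed
    have t1: "bil (far r) a b \<le> \<epsilon> / 16"
      using bil_far_weight[OF r(1) pab] fb[of "wt a"] wa wd wt_nonneg[OF pab(1)] by linarith
    have t2: "bil (far r) b d \<le> \<epsilon> / 16"
      using bil_far_weight[OF r(1) pab(2) d] fb[of "wt d"] wd wt_nonneg[OF d] by (simp add: mult.commute)
    have t3: "bil (far r) a a \<le> \<epsilon> / 8"
    proof -
      define u' where "u' = cut u (box_region T)"
      define w' where "w' = cut w (box_region T)"
      have iu: "integrable lborel u'" "integrable lborel w'"
        unfolding u'_def w'_def by (intro cut_box_integrable pu pw)+
      have eq: "a = (\<lambda>x. u' x - w' x)" by (auto simp: a_def d_def u'_def w'_def left_diff_distrib)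
      have ia: "integrable lborel a" unfolding a_def by (rule cut_box_integrable(1)[OF d])
      have mass: "(\<integral>x. \<bar>a x\<bar> \<partial>lborel) \<le> 2 * m"
      proof -
        have "(\<integral>x. \<bar>a x\<bar> \<partial>lborel) \<le> (\<integral>x. \<bar>u' x\<bar> + \<bar>w' x\<bar> \<partial>lborel)"
          using ia iu unfolding eq by (intro integral_mono) auto
        also have "\<dots> = (\<integral>x. \<bar>u' x\<bar> \<partial>lborel) + (\<integral>x. \<bar>w' x\<bar> \<partial>lborel)" using iu by (intro Bochner_Integration.integral_add) auto
        also have "\<dots> \<le> m + m"
          using cut_box_integrable(2)[OF pu, of T] cut_box_integrable(2)[OF pw, of T] QM(3)[of "\<sigma> (k i)"] QM(3)[of "\<sigma> (k j)"]
          by (simp add: m_def u'_def w'_def u_def w_def)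
        finally show ?thesis by simp
      qed
      have pot: "potential r a x = potential r u' x - potential r w' x" for x
        unfolding eq by (rule potential_diff[OF r(1) iu])
      have "integrable lborel (\<lambda>x. a x * potential r a x)"
      proof -
        have "integrable lborel (\<lambda>x. \<integral>y. a x * far r x y * a y \<partial>lborel)"
          using lborel_pair.integrable_fst'[OF controlled_integrable[OF controlled_far[OF r(1)] pab(1) pab(1)]] by simp
        then show ?thesis by (simp add: potential_def mult.assoc)
      qed
      then have "bil (far r) a a \<le> (\<integral>x. \<tau> * \<bar>a x\<bar> \<partial>lborel)"
        unfolding bil_far_potential[OF r(1) pab(1) pab(1)]
      proof (intro integral_mono)
        show "a x * potential r a x \<le> \<tau> * \<bar>a x\<bar>" for x
        proof (cases "x \<in> box_region T")
          case True
          have "\<bar>potential r a x\<bar> \<le> \<tau>"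
            unfolding pot u'_def w'_def u_def w_def using ij True by (intro N) auto
          then have "\<bar>a x\<bar> * \<bar>potential r a x\<bar> \<le> \<bar>a x\<bar> * \<tau>" by (intro mult_left_mono) auto
          then show ?thesis using abs_ge_self[of "a x * potential r a x"] by (simp add: abs_mult mult.commute)
        qed (simp add: a_def)
      qed (use ia in auto)
      also have "\<dots> \<le> \<tau> * (2 * m)" using mass \<tau> by simp
      also have "\<dots> \<le> \<tau> * (2 * (m + 1))" using \<tau> by (intro mult_left_mono) auto
      also have "\<dots> = \<epsilon> / 8"
      proof -
        have "\<epsilon> / (16 * R) * (2 * R) = \<epsilon> / 8" if "R > 0" for R using that by simp
        from this[of "m + 1"] m show ?thesis by (simp add: \<tau>_def)
      qed
      finally show ?thesis .
    qed
    have "sqn d \<le> 2 * bil (far r) d d + 8 * (cstar * (wt u)\<^sup>2 - En u) + 8 * (cstar * (wt w)\<^sup>2 - En w)"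
      unfolding d_def by (rule quadratic_defect[OF vu r])
    moreover have "2 * bil (far r) d d \<le> \<epsilon> / 2" using split t1 t2 t3 by simp
    moreover have "8 * (cstar * (wt u)\<^sup>2 - En u) \<le> \<epsilon> / 8" "8 * (cstar * (wt w)\<^sup>2 - En w) \<le> \<epsilon> / 8"
      using du by simp_all
    ultimately have "sqn d \<le> \<epsilon>" using \<open>0 < \<epsilon>\<close> by linarith
    then show ?thesis by (simp add: d_def u_def w_def)
  qed
  then show ?thesis using k by blast
qed

text \<open>
  The box, hence the subsequence, depends on \<open>\<epsilon>\<close>; a diagonal sequence serves all \<open>\<epsilon>\<close>.
\<close>

lemma maximizing_cauchy_subsequence:
  assumes max: "maximizing h \<mu>" and tt: "tight h"
  shows "\<exists>k. strict_mono (k :: nat \<Rightarrow> nat) \<and>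
     (\<forall>\<epsilon>>0. \<exists>N. \<forall>i\<ge>N. \<forall>j\<ge>N. sqn (\<lambda>x. h (k i) x - h (k j) x) \<le> \<epsilon>)"
proof -
  define P where "P n \<sigma> \<longleftrightarrow> (\<exists>N. \<forall>i\<ge>N. \<forall>j\<ge>N. sqn (\<lambda>x. h (\<sigma> i) x - h (\<sigma> j) x) \<le> (1/2) ^ n)"
    for n :: nat and \<sigma> :: "nat \<Rightarrow> nat"
  interpret subseqs P
  proof
    fix n and \<sigma> :: "nat \<Rightarrow> nat" assume "strict_mono \<sigma>"
    from maximizing_almost_cauchy[OF max tt _ this, of "(1/2) ^ n"]
    show "\<exists>r'. strict_mono r' \<and> P n (\<sigma> \<circ> r')" by (simp add: P_def)
  qed
  have stable: "P n (\<sigma> \<circ> r)" if rs: "strict_mono r" "P n \<sigma>" for r \<sigma> n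
  proof -
    obtain N where "\<forall>i\<ge>N. \<forall>j\<ge>N. sqn (\<lambda>x. h (\<sigma> i) x - h (\<sigma> j) x) \<le> (1/2) ^ n"
      using rs(2) unfolding P_def by blast
    moreover have "N \<le> i \<Longrightarrow> N \<le> r i" for i using seq_suble[OF rs(1), of i] by simp
    ultimately have "\<forall>i\<ge>N. \<forall>j\<ge>N. sqn (\<lambda>x. h (\<sigma> (r i)) x - h (\<sigma> (r j)) x) \<le> (1/2) ^ n" by simp
    then show ?thesis unfolding P_def o_def by blast
  qed
  have "\<exists>N. \<forall>i\<ge>N. \<forall>j\<ge>N. sqn (\<lambda>x. h (diagseq i) x - h (diagseq j) x) \<le> \<epsilon>" if "0 < \<epsilon>" for \<epsilon>
  proof -
    obtain n where n: "(1/2) ^ n < \<epsilon>" using real_arch_pow_inv[of \<epsilon> "1/2"] \<open>0 < \<epsilon>\<close> by auto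
    have "P n (diagseq \<circ> (+) (Suc n))" using stable by (rule diagseq_holds)
    then obtain N where N: "\<And>i j. i \<ge> N \<Longrightarrow> j \<ge> N \<Longrightarrow>
        sqn (\<lambda>x. h (diagseq (Suc n + i)) x - h (diagseq (Suc n + j)) x) \<le> (1/2) ^ n"
      unfolding P_def o_def by blast
    have "sqn (\<lambda>x. h (diagseq i) x - h (diagseq j) x) \<le> \<epsilon>" if ij: "i \<ge> Suc n + N" "j \<ge> Suc n + N" for i j
    proof -
      have "N \<le> i - Suc n" "N \<le> j - Suc n" using ij by linarith+
      from N[OF this] show ?thesis using ij n by simp
    qed
    then show ?thesis by blast
  qed
  then show ?thesis using subseq_diagseq by blast
qed

lemma centered_maximizing:
  assumes max: "maximizing f \<mu>"
  shows "\<exists>t. maximizing (\<lambda>n x. f n (x + t n *\<^sub>R e1)) \<mu> \<and> tight (\<lambda>n x. f n (x + t n *\<^sub>R e1))"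
proof -
  have v: "\<And>n. vort (f n)" using max by (auto simp: maximizing_def)
  note p = vortD(1)[OF v]
  obtain t where t: "\<And>\<epsilon>. \<epsilon> > 0 \<Longrightarrow> \<exists>T. eventually (\<lambda>n. wt (cut (f n) {x. T < \<bar>x $ 1 - t n\<bar>}) \<le> \<epsilon>) sequentially"
    using horizontal_tightness[OF max] by blast
  define h where "h n = (\<lambda>x. f n (x + t n *\<^sub>R e1))" for n
  have "maximizing h \<mu>"
    using max p vort_translate[OF v] wt_translate[OF p] En_translate[OF p] by (simp add: maximizing_def h_def)
  moreover have "tight h"
    unfolding tight_def
  proof (intro allI impI)
    fix \<epsilon> :: real assume \<epsilon>: "0 < \<epsilon>"
    obtain T1 where T1: "eventually (\<lambda>n. wt (cut (f n) {x. T1 < \<bar>x $ 1 - t n\<bar>}) \<le> \<epsilon> / 2) sequentially"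
      using t[of "\<epsilon> / 2"] \<epsilon> by auto
    obtain H where H: "eventually (\<lambda>n. wt (cut (f n) {x. H < x $ 2}) \<le> \<epsilon> / 2) sequentially"
      using vertical_tightness[OF max, of "\<epsilon> / 2"] \<epsilon> by auto
    define T where "T = max 1 (max T1 H)"
    have "eventually (\<lambda>n. wt (cut (h n) (- box_region T)) \<le> \<epsilon>) sequentially"
      using T1 H
    proof eventually_elim
      case (elim n)
      define A where "A = {x::real^2. T1 < \<bar>x $ 1 - t n\<bar>}"
      define B where "B = {x::real^2. H < x $ 2}"
      have m: "A \<in> sets borel" "B \<in> sets borel" by (simp_all add: A_def B_def)
      have pAB: "profile (cut (f n) (A \<union> B))" using p m by (intro profile_restrict) auto
      have "wt (cut (h n) (- box_region T)) \<le> wt (\<lambda>x. cut (f n) (A \<union> B) (x + t n *\<^sub>R e1))"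
      proof (rule wt_mono)
        show "profile (cut (h n) (- box_region T))" unfolding h_def using p by (intro profile_restrict profile_translate) auto
        show "profile (\<lambda>x. cut (f n) (A \<union> B) (x + t n *\<^sub>R e1))" using pAB by (intro profile_translate) auto
        fix x
        show "\<bar>cut (h n) (- box_region T) x\<bar> \<le> \<bar>cut (f n) (A \<union> B) (x + t n *\<^sub>R e1)\<bar>"
        proof (cases "x \<in> box_region T \<or> x $ 2 \<le> 0")
          case True
          then show ?thesis
          proof
            assume "x $ 2 \<le> 0"
            then have "h n x = 0" using profileD(2)[OF p, of "x + t n *\<^sub>R e1" n] by (simp add: h_def)
            then show ?thesis by simp
          qed simp
        next
          case False
          then have "x + t n *\<^sub>R e1 \<in> A \<union> B" by (auto simp: mem_box_region A_def B_def T_def)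
          then show ?thesis by (simp add: h_def indicator_def)
        qed
      qed
      also have "\<dots> = wt (cut (f n) (A \<union> B))" by (rule wt_translate[OF pAB]) simp
      also have "\<dots> \<le> wt (cut (f n) A) + wt (cut (f n) B)" by (rule wt_cut_Un_le[OF p m])
      finally show ?case using elim by (simp add: A_def B_def)
    qed
    then show "\<exists>T>0. eventually (\<lambda>n. wt (cut (h n) (- box_region T)) \<le> \<epsilon>) sequentially"
      by (intro exI[of _ T]) (simp add: T_def)
  qed
  ultimately show ?thesis unfolding h_def by blast
qed

text \<open>
  Without a bound on the mass, maximizing sequences are compact up to horizontal translations.  This is
  used twice: for a maximizer of the homogeneous problem, and for the given sequence.
\<close>

theorem maximizing_compactness:
  assumes max: "maximizing f \<mu>"
  shows "\<exists>k t g. strict_mono (k :: nat \<Rightarrow> nat) \<and> vort g \<and> wt g = \<mu> \<and> En g = cstar * \<mu>\<^sup>2 \<and>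
    (AE x in lborel. (\<lambda>n. f (k n) (x + t n *\<^sub>R e1)) \<longlonglongrightarrow> g x) \<and>
    (\<lambda>n. sqn (\<lambda>x. f (k n) (x + t n *\<^sub>R e1) - g x)) \<longlonglongrightarrow> 0 \<and>
    (\<lambda>n. wt (\<lambda>x. f (k n) (x + t n *\<^sub>R e1) - g x)) \<longlonglongrightarrow> 0"
proof -
  obtain t where t: "maximizing (\<lambda>n x. f n (x + t n *\<^sub>R e1)) \<mu>" "tight (\<lambda>n x. f n (x + t n *\<^sub>R e1))"
    using centered_maximizing[OF max] by blast
  define h where "h n = (\<lambda>x. f n (x + t n *\<^sub>R e1))" for n
  have mh: "maximizing h \<mu>" and th: "tight h" using t by (simp_all add: h_def[abs_def])
  obtain k where k: "strict_mono (k :: nat \<Rightarrow> nat)"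
    and c: "\<And>\<epsilon>. 0 < \<epsilon> \<Longrightarrow> \<exists>N. \<forall>i\<ge>N. \<forall>j\<ge>N. sqn (\<lambda>x. h (k i) x - h (k j) x) \<le> \<epsilon>"
    using maximizing_cauchy_subsequence[OF mh th] by blast
  have v: "\<And>n. vort (h n)" using mh by (auto simp: maximizing_def)
  note p = vortD(1)[OF v] and nn = vortD(2)[OF v]
  obtain M where M: "\<And>n. wt (h n) \<le> M" using maximizing_bounded[OF mh] by blast
  obtain r g where r: "strict_mono (r :: nat \<Rightarrow> nat)" and g: "profile g" "\<And>x. 0 \<le> g x"
    and ae: "AE x in lborel. (\<lambda>n. h (k (r n)) x) \<longlonglongrightarrow> g x"
    and sq: "(\<lambda>n. sqn (\<lambda>x. h (k (r n)) x - g x)) \<longlonglongrightarrow> 0"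
    using L2_cauchy_limit[of "\<lambda>n. h (k n)" M, OF p nn M c] by blast
  define q where "q = k \<circ> r"
  have q: "strict_mono q" unfolding q_def by (rule strict_mono_o[OF k r])
  have fl: "filterlim q sequentially sequentially" by (rule filterlim_subseq[OF q])
  have tq: "tight (\<lambda>n. h (q n))"
    using th eventually_compose_filterlim[OF _ fl] unfolding tight_def by blast
  have w: "(\<lambda>n. wt (\<lambda>x. h (q n) x - g x)) \<longlonglongrightarrow> 0"
    by (rule wt_tendsto_of_sqn[OF p g(1) _ _ tq]) (use ae sq in \<open>simp_all add: q_def\<close>)
  have sq': "(\<lambda>n. sqn (\<lambda>x. h (q n) x - g x)) \<longlonglongrightarrow> 0" using sq by (simp add: q_def)
  have "(\<lambda>n. wt (h (q n))) \<longlonglongrightarrow> \<mu>" "(\<lambda>n. En (h (q n))) \<longlonglongrightarrow> cstar * \<mu>\<^sup>2"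
    using mh LIMSEQ_subseq_LIMSEQ[OF _ q] by (auto simp: maximizing_def o_def)
  then have "wt g = \<mu>" "En g = cstar * \<mu>\<^sup>2"
    using wt_tendsto[OF p g(1) w] En_tendsto[OF p g(1) sq' w] LIMSEQ_unique by blast+
  then show ?thesis
    using q g ae sq' w unfolding vort_def
    by (intro exI[of _ q] exI[of _ "t \<circ> q"] exI[of _ g]) (auto simp: h_def q_def)
qed

end

section \<open>A maximizer of finite mass\<close>

definition strip :: "real \<Rightarrow> real \<Rightarrow> (real^2) set" where
  "strip a b = cbox (vector [a, 0]) (vector [b, 1])"

lemma mem_strip: "x \<in> strip a b \<longleftrightarrow> a \<le> x $ 1 \<and> x $ 1 \<le> b \<and> 0 \<le> x $ 2 \<and> x $ 2 \<le> 1"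
  by (auto simp: strip_def mem_box_cart forall_2)

lemma strip_borel [measurable, simp]: "strip a b \<in> sets borel"
  by (simp add: strip_def)

lemma emeasure_strip:
  assumes "a \<le> b" shows "emeasure lborel (strip a b) = ennreal (b - a)"
  using assms unfolding strip_def
  by (subst emeasure_lborel_cbox) (auto simp: Basis_vec_def UNIV_2 inner_axis axis_eq_axis)

context half_plane_kernel
begin

lemma maximizer_exists: "\<exists>g. vort g \<and> wt g = 1 \<and> En g = cstar"
proof -
  obtain f0 where f0: "vort f0" "0 < En f0" using exists_positive_energy by blast
  then have "wt f0 \<noteq> 0" using En_le_cstar[OF f0(1)] by auto
  then have "0 < wt f0" using wt_nonneg[OF vortD(1)[OF f0(1)]] by simp
  then have "vort (\<lambda>x. inverse (wt f0) * f0 x)" "wt (\<lambda>x. inverse (wt f0) * f0 x) = 1"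
    using f0 by (auto simp: wt_cmult intro!: vort_cmult)
  then have ne: "En ` {f. vort f \<and> wt f = 1} \<noteq> {}" by blast
  have "\<exists>f. vort f \<and> wt f = 1 \<and> cstar - 1 / (real n + 1) < En f" for n
  proof -
    have "cstar - 1 / (real n + 1) < Sup (En ` {f. vort f \<and> wt f = 1})" by (simp add: cstar_def[symmetric])
    from less_cSupE[OF this ne] show ?thesis by auto
  qed
  then have "\<forall>n. \<exists>f. vort f \<and> wt f = 1 \<and> cstar - 1 / (real n + 1) < En f" by blast
  from choice[OF this] obtain f where f: "\<And>n. vort (f n)" "\<And>n. wt (f n) = 1" "\<And>n. cstar - 1 / (real n + 1) < En (f n)"
    by blast
  have "(\<lambda>n. En (f n)) \<longlonglongrightarrow> cstar"
  proof (rule tendsto_sandwich[OF _ _ _ tendsto_const])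
    show "eventually (\<lambda>n. cstar - 1 / (real n + 1) \<le> En (f n)) sequentially" using f(3) by (intro always_eventually) (auto intro: less_imp_le)
    show "eventually (\<lambda>n. En (f n) \<le> cstar) sequentially" using En_le_cstar[OF f(1)] f(2) by simp
    have "(\<lambda>n. 1 / (real n + 1)) \<longlonglongrightarrow> 0"
      using LIMSEQ_inverse_real_of_nat by (simp add: inverse_eq_divide add.commute)
    then have "(\<lambda>n. cstar - 1 / (real n + 1)) \<longlonglongrightarrow> cstar - 0"
      by (intro tendsto_intros)
    then show "(\<lambda>n. cstar - 1 / (real n + 1)) \<longlonglongrightarrow> cstar" by simp
  qed
  then have "maximizing f 1" using f by (simp add: maximizing_def)
  from maximizing_compactness[OF this] show ?thesis by auto
qed

abbreviation tail :: "real \<Rightarrow> (real^2) set" where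
  "tail a \<equiv> {x. a < \<bar>x $ 1\<bar>}"

text \<open>
  For a maximizer \<open>removal\<close> bounds \<open>cstar * wt \<eta> + sqn \<eta> / 2\<close> by the interaction of \<open>g\<close> with its tail
  \<open>\<eta>\<close>.  The first term pays for everything at distance \<open>R\<close> and, since the tail of \<open>g\<close> one step before
  has small impulse, for the far interaction with it.  This leaves the near interaction, which is at most
  a fraction of the squared norms of \<open>\<eta>\<close> and of that previous tail.
\<close>

lemma maximizer_tail_decay:
  assumes g: "vort g" and wg: "wt g = 1" and Eg: "En g = cstar"
  shows "\<exists>a R. 0 \<le> a \<and> 0 < R \<and> (\<forall>k. sqn (cut g (tail (a + real k * R))) \<le> (1/3) ^ k * sqn g)"
proof -
  note p = vortD(1)[OF g]
  obtain r where r: "r > 0" "near_mass r \<le> 1/4" using near_mass_small[of "1/4"] by auto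
  obtain R where R: "R > 0" "far_const R \<le> cstar / 2" using far_const_small[of "cstar / 2"] cstar_pos by auto
  define \<delta> where "\<delta> = cstar / (2 * (far_const r + 1))"
  have fr: "far_const r + 1 > 0" using far_const_nonneg[of r] by linarith
  have \<delta>: "\<delta> > 0" using cstar_pos fr by (simp add: \<delta>_def)
  have "(\<lambda>n. wt (cut g (tail (real n)))) \<longlonglongrightarrow> 0"
  proof (rule wt_cut_vanish[OF p])
    show "eventually (\<lambda>n. x \<notin> tail (real n)) sequentially" for x
      using eventually_gt_at_top[of "nat \<lceil>\<bar>x $ 1\<bar>\<rceil>"] by eventually_elim (auto, linarith)
  qed auto
  then have "eventually (\<lambda>n. wt (cut g (tail (real n))) < \<delta>) sequentially" by (rule order_tendstoD(2)[OF _ \<delta>])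
  then obtain n where n: "wt (cut g (tail (real n))) < \<delta>" by (auto dest!: eventually_happens)
  define a where "a = real n"
  have step: "sqn (cut g (tail (b + R))) \<le> 1/3 * sqn (cut g (tail b))" if b: "a \<le> b" for b
  proof -
    define S where "S = tail b"
    define \<eta> where "\<eta> = cut g (tail (b + R))"
    have S: "S \<in> sets borel" by (simp add: S_def)
    have v\<eta>: "vort \<eta>" unfolding \<eta>_def by (rule vort_cut[OF g]) simp
    note p\<eta> = vortD(1)[OF v\<eta>]
    have pS: "profile (cut g S)" "profile (cut g (- S))" using p S profile_restrict by auto
    have w\<eta>: "0 \<le> wt \<eta>" by (rule wt_nonneg[OF p\<eta>])
    have "cstar * (wt g * wt \<eta>) + sqn \<eta> / 2 \<le> cstar * (wt g)\<^sup>2 - En g + bil kern g \<eta>"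
      unfolding \<eta>_def by (rule removal[OF g]) simp
    then have 1: "cstar * wt \<eta> + sqn \<eta> / 2 \<le> bil kern (cut g S) \<eta> + bil kern (cut g (- S)) \<eta>"
      using wg Eg bil_cut_left[OF p p\<eta> S] by simp
    have "\<bar>bil kern (cut g (- S)) \<eta>\<bar> \<le> far_const R * (wt (cut g (- S)) * wt \<eta>)"
    proof (rule bil_bound_separated[OF pS(2) p\<eta> R(1)])
      fix x y assume "cut g (- S) x \<noteq> 0" "\<eta> y \<noteq> 0"
      then have "\<bar>x $ 1\<bar> \<le> b" "b + R < \<bar>y $ 1\<bar>" by (auto simp: \<eta>_def S_def indicator_def split: if_splits)
      moreover have "\<bar>(x - y) $ 1\<bar> \<le> norm (x - y)" by (rule component_le_norm_cart)
      ultimately show "R \<le> norm (x - y)" by simp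
    qed
    also have "\<dots> \<le> (cstar / 2) * (1 * wt \<eta>)"
      using R far_const_nonneg w\<eta> wt_cut_le[OF p, of "- S"] S wg wt_nonneg[OF pS(2)] cstar_pos
      by (intro mult_mono mult_right_mono) auto
    finally have 2: "bil kern (cut g (- S)) \<eta> \<le> cstar / 2 * wt \<eta>" by simp
    have "\<bar>bil kern (cut g S) \<eta>\<bar> \<le> near_mass r / 2 * (sqn (cut g S) + sqn \<eta>) + far_const r * (wt (cut g S) * wt \<eta>)"
      by (rule bil_bound_near_far[OF pS(1) p\<eta> r(1)])
    moreover have "near_mass r / 2 * (sqn (cut g S) + sqn \<eta>) \<le> 1/4 / 2 * (sqn (cut g S) + sqn \<eta>)"
      using r by (intro mult_right_mono) auto
    moreover have "far_const r * (wt (cut g S) * wt \<eta>) \<le> (far_const r + 1) * (\<delta> * wt \<eta>)"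
    proof -
      have "wt (cut g S) \<le> wt (cut g (tail a))" unfolding S_def using b by (intro wt_cut_mono p) auto
      then show ?thesis
        using n w\<eta> wt_nonneg[OF pS(1)] far_const_nonneg[of r] \<delta> by (intro mult_mono) (auto simp: a_def)
    qed
    moreover have "(far_const r + 1) * (\<delta> * wt \<eta>) = cstar / 2 * wt \<eta>"
    proof -
      have "F * (cstar / (2 * F) * wt \<eta>) = cstar / 2 * wt \<eta>" if "F > 0" for F using that by simp
      from this[OF fr] show ?thesis by (simp add: \<delta>_def)
    qed
    ultimately have "sqn \<eta> / 2 \<le> 1/8 * (sqn (cut g S) + sqn \<eta>)" using 1 2 by linarith
    then show ?thesis by (simp add: \<eta>_def S_def)
  qed
  have "sqn (cut g (tail (a + real k * R))) \<le> (1/3) ^ k * sqn g" for k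
  proof (induction k)
    case 0
    have "sqn (cut g (tail a)) \<le> sqn g" by (rule sqn_cut_le[OF p]) simp
    then show ?case by simp
  next
    case (Suc k)
    have eq: "a + real (Suc k) * R = (a + real k * R) + R" by (simp add: algebra_simps)
    have "sqn (cut g (tail (a + real (Suc k) * R))) \<le> 1/3 * sqn (cut g (tail (a + real k * R)))"
      unfolding eq by (rule step) (use R in simp)
    also have "\<dots> \<le> 1/3 * ((1/3) ^ k * sqn g)" using Suc by (intro mult_left_mono) auto
    finally show ?case by simp
  qed
  then show ?thesis using R by (intro exI[of _ a] exI[of _ R]) (auto simp: a_def)
qed

text \<open>
  Above height one the mass is at most the impulse, and on bounded sets it is controlled by the norm.
  On the remaining strips, \<open>2 * g x \<le> 2 ^ k * (g x)\<^sup>2 + (1/2) ^ k\<close> on the pair with index \<open>k\<close>; the squared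
  norms decay like \<open>(1/3) ^ k\<close> and the areas are constant, so both series converge.
\<close>

lemma maximizer_integrable:
  assumes g: "vort g" and wg: "wt g = 1" and Eg: "En g = cstar"
  shows "integrable lborel g"
proof -
  note p = vortD(1)[OF g] and nn = vortD(2)[OF g]
  have [measurable]: "g \<in> borel_measurable borel" using p by auto
  obtain a R where a: "0 \<le> a" and R: "0 < R"
    and decay: "\<And>k. sqn (cut g (tail (a + real k * R))) \<le> (1/3) ^ k * sqn g"
    using maximizer_tail_decay[OF assms] by blast
  define \<alpha> where "\<alpha> k = a + real k * R" for k
  define q where "q k x = (2 ^ k * (cut g (tail (\<alpha> k)) x)\<^sup>2 + (1/2) ^ k *
    (indicator (strip (\<alpha> k) (\<alpha> (Suc k))) x + indicator (strip (- \<alpha> (Suc k)) (- \<alpha> k)) x)) / 2" for k x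
  define q0 where "q0 x = ((g x)\<^sup>2 + indicator (strip (- a) a) x) / 2" for x
  have [measurable]: "q k \<in> borel_measurable borel" for k unfolding q_def by measurable
  have [measurable]: "q0 \<in> borel_measurable borel" unfolding q0_def by measurable
  have q_nonneg: "0 \<le> q k x" for k x by (simp add: q_def)
  have q0_nonneg: "0 \<le> q0 x" for x by (simp add: q0_def)
  have sint: "integrable lborel (indicator (strip b c) :: real^2 \<Rightarrow> real)" for b c
    unfolding strip_def by (rule integrable_real_indicator[OF _ emeasure_lborel_cbox_finite]) simp
  have smeas: "(\<integral>x. indicator (strip b c) x \<partial>lborel) = c - b" if "b \<le> c" for b c
    using emeasure_strip[OF that] that by (simp add: measure_def)
  have pt: "ennreal (g x) \<le> ennreal (x $ 2 * \<bar>g x\<bar>) + ennreal (q0 x) + (\<Sum>k. ennreal (q k x))" for x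
  proof -
    consider "x $ 2 \<le> 0" | "1 < x $ 2" | "0 < x $ 2" "x $ 2 \<le> 1" "\<bar>x $ 1\<bar> \<le> a" | "0 < x $ 2" "x $ 2 \<le> 1" "a < \<bar>x $ 1\<bar>"
      by linarith
    then show ?thesis
    proof cases
      case 1
      then show ?thesis using profileD(2)[OF p] by simp
    next
      case 2
      then have "g x \<le> x $ 2 * \<bar>g x\<bar>" using nn[of x] by (simp add: mult_le_cancel_right1)
      then have "ennreal (g x) \<le> ennreal (x $ 2 * \<bar>g x\<bar>)" by (rule ennreal_leI)
      then show ?thesis by (simp add: add.assoc add_increasing2)
    next
      case 3
      then have "x \<in> strip (- a) a" by (auto simp: mem_strip)
      then have "g x \<le> q0 x" using sum_squares_bound[of "g x" 1] by (simp add: q0_def)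
      then have "ennreal (g x) \<le> ennreal (q0 x)" by (rule ennreal_leI)
      then show ?thesis by (simp add: add_increasing add_increasing2)
    next
      case 4
      define P where "P n \<longleftrightarrow> \<bar>x $ 1\<bar> \<le> \<alpha> n" for n
      obtain n where "\<bar>x $ 1\<bar> / R < real n" using reals_Archimedean2 by blast
      then have "\<bar>x $ 1\<bar> < real n * R" using R by (simp add: field_simps)
      then have "P n" using a by (simp add: P_def \<alpha>_def)
      then have PL: "P (LEAST n. P n)" by (rule LeastI)
      moreover have "\<not> P 0" using 4 by (simp add: P_def \<alpha>_def)
      ultimately obtain k where k: "(LEAST n. P n) = Suc k" by (cases "LEAST n. P n") auto
      then have "\<not> P k" using not_less_Least[of k P] by simp
      then have x1: "\<alpha> k < \<bar>x $ 1\<bar>" "\<bar>x $ 1\<bar> \<le> \<alpha> (Suc k)" using PL k by (auto simp: P_def)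
      then have "x \<in> strip (\<alpha> k) (\<alpha> (Suc k)) \<or> x \<in> strip (- \<alpha> (Suc k)) (- \<alpha> k)"
        using 4 by (auto simp: mem_strip)
      then have ind: "1 \<le> indicator (strip (\<alpha> k) (\<alpha> (Suc k))) x + (indicator (strip (- \<alpha> (Suc k)) (- \<alpha> k)) x :: real)"
        by (auto simp: indicator_def)
      have "0 \<le> (2 ^ k * g x - 1)\<^sup>2 / 2 ^ k" by simp
      also have "\<dots> = 2 ^ k * (g x)\<^sup>2 + (1/2) ^ k - 2 * g x" by (simp add: power2_eq_square field_simps)
      finally have "g x \<le> (2 ^ k * (g x)\<^sup>2 + (1/2) ^ k * 1) / 2" by simp
      also have "\<dots> \<le> q k x"
        unfolding q_def using x1(1) ind by (intro divide_right_mono add_mono mult_left_mono) auto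
      finally have "ennreal (g x) \<le> ennreal (q k x)" by (rule ennreal_leI)
      also have "\<dots> \<le> (\<Sum>k. ennreal (q k x))"
        using sum_le_suminf[of "\<lambda>k. ennreal (q k x)" "{k}"] by simp
      finally show ?thesis by (simp add: add_increasing)
    qed
  qed
  have qint: "(\<integral>\<^sup>+x. ennreal (q k x) \<partial>lborel) \<le> ennreal ((2/3) ^ k * sqn g + (1/2) ^ k * R)" for k
  proof -
    have pc: "integrable lborel (\<lambda>x. (cut g (tail (\<alpha> k)) x)\<^sup>2)"
      by (rule profileD(3)[OF profile_restrict[OF p]]) simp
    have le: "\<alpha> k \<le> \<alpha> (Suc k)" "\<alpha> (Suc k) - \<alpha> k = R" using R by (auto simp: \<alpha>_def algebra_simps)
    have hb: "has_bochner_integral lborel (q k) ((2 ^ k * sqn (cut g (tail (\<alpha> k))) + (1/2) ^ k * (R + R)) / 2)"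
      unfolding q_def
    proof (intro has_bochner_integral_divide_zero has_bochner_integral_add has_bochner_integral_mult_right)
      show "has_bochner_integral lborel (\<lambda>x. (cut g (tail (\<alpha> k)) x)\<^sup>2) (sqn (cut g (tail (\<alpha> k))))"
        using pc by (simp add: has_bochner_integral_iff sqn_def)
      show "has_bochner_integral lborel (indicator (strip (\<alpha> k) (\<alpha> (Suc k))) :: real^2 \<Rightarrow> real) R"
        "has_bochner_integral lborel (indicator (strip (- \<alpha> (Suc k)) (- \<alpha> k)) :: real^2 \<Rightarrow> real) R"
        using sint smeas[of "\<alpha> k" "\<alpha> (Suc k)"] smeas[of "- \<alpha> (Suc k)" "- \<alpha> k"] le
        by (auto simp: has_bochner_integral_iff)
    qed
    then have "(\<integral>\<^sup>+x. ennreal (q k x) \<partial>lborel) = ennreal ((2 ^ k * sqn (cut g (tail (\<alpha> k))) + (1/2) ^ k * (R + R)) / 2)"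
      using q_nonneg has_bochner_integral_integral_eq[OF hb]
      by (subst nn_integral_eq_integral) (auto simp only: has_bochner_integral_iff intro: AE_I2)
    also have "\<dots> \<le> ennreal ((2/3) ^ k * sqn g + (1/2) ^ k * R)"
    proof (rule ennreal_leI)
      have "2 ^ k * sqn (cut g (tail (\<alpha> k))) \<le> 2 ^ k * ((1/3) ^ k * sqn g)"
        using decay[of k] unfolding \<alpha>_def by (intro mult_left_mono) auto
      also have "\<dots> = (2/3) ^ k * sqn g" by (simp flip: mult.assoc power_mult_distrib)
      finally have "2 ^ k * sqn (cut g (tail (\<alpha> k))) \<le> (2/3) ^ k * sqn g" .
      moreover have "0 \<le> (2/3) ^ k * sqn g" by simp
      ultimately have "2 ^ k * sqn (cut g (tail (\<alpha> k))) \<le> 2 * ((2/3) ^ k * sqn g)" by linarith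
      then show "(2 ^ k * sqn (cut g (tail (\<alpha> k))) + (1/2) ^ k * (R + R)) / 2 \<le> (2/3) ^ k * sqn g + (1/2) ^ k * R"
        by (simp add: field_simps)
    qed
    finally show ?thesis .
  qed
  have "(\<integral>\<^sup>+x. ennreal (g x) \<partial>lborel) \<le> (\<integral>\<^sup>+x. ennreal (x $ 2 * \<bar>g x\<bar>) + ennreal (q0 x) + (\<Sum>k. ennreal (q k x)) \<partial>lborel)"
    using pt by (intro nn_integral_mono) auto
  also have "\<dots> = (\<integral>\<^sup>+x. ennreal (x $ 2 * \<bar>g x\<bar>) \<partial>lborel) + (\<integral>\<^sup>+x. ennreal (q0 x) \<partial>lborel) + (\<Sum>k. \<integral>\<^sup>+x. ennreal (q k x) \<partial>lborel)"
    by (subst nn_integral_add, measurable, subst nn_integral_add, measurable, subst nn_integral_suminf, measurable)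
  also have "\<dots> < \<infinity>"
  proof -
    have "(\<integral>\<^sup>+x. ennreal (x $ 2 * \<bar>g x\<bar>) \<partial>lborel) < \<infinity>"
      using profile_integrable_wt[OF p] profile_wt_nonneg_pt[OF p] by (subst nn_integral_eq_integral) auto
    moreover have "integrable lborel q0"
      unfolding q0_def[abs_def] using sint profileD(3)[OF p] by (intro integrable_divide Bochner_Integration.integrable_add) auto
    then have "(\<integral>\<^sup>+x. ennreal (q0 x) \<partial>lborel) < \<infinity>"
      using q0_nonneg by (subst nn_integral_eq_integral) auto
    moreover have "(\<Sum>k. \<integral>\<^sup>+x. ennreal (q k x) \<partial>lborel) < \<infinity>"
    proof -
      have "(\<Sum>k. \<integral>\<^sup>+x. ennreal (q k x) \<partial>lborel) \<le> (\<Sum>k. ennreal ((2/3) ^ k * sqn g + (1/2) ^ k * R))"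
        using qint by (intro suminf_le) auto
      also have "\<dots> = ennreal (1 / (1 - 2/3) * sqn g + 1 / (1 - 1/2) * R)"
      proof (rule suminf_ennreal_eq)
        show "(\<lambda>k. (2/3) ^ k * sqn g + (1/2) ^ k * R) sums (1 / (1 - 2/3) * sqn g + 1 / (1 - 1/2) * R)"
          by (intro sums_add sums_mult2 geometric_sums) auto
      qed (use R in auto)
      also have "\<dots> < \<infinity>" by simp
      finally show ?thesis .
    qed
    ultimately show ?thesis by simp
  qed
  finally show ?thesis using nn by (intro integrableI_bounded) auto
qed

text \<open>
  Deleting the set where a maximizer exceeds a large number keeps its mass bound and changes its energy
  little.  Boundedness is needed for admissibility when \<open>s \<le> 1/2\<close>.
\<close>

lemma bounded_near_maximizer:
  "\<exists>m\<ge>0. \<forall>\<epsilon>>0. \<exists>h K. vort h \<and> (\<forall>x. h x \<le> K) \<and> integrable lborel h \<and> (\<integral>x. h x \<partial>lborel) \<le> m \<and>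
     1 - \<epsilon> \<le> wt h \<and> wt h \<le> 1 \<and> cstar - \<epsilon> \<le> En h"
proof -
  obtain g where g: "vort g" "wt g = 1" "En g = cstar" using maximizer_exists by blast
  note p = vortD(1)[OF g(1)] and nn = vortD(2)[OF g(1)]
  have [measurable]: "g \<in> borel_measurable borel" using p by auto
  have gi: "integrable lborel g" by (rule maximizer_integrable[OF g])
  define m where "m = (\<integral>x. g x \<partial>lborel)"
  have "m \<ge> 0" unfolding m_def using nn by (intro Bochner_Integration.integral_nonneg)
  moreover have "\<exists>h K. vort h \<and> (\<forall>x. h x \<le> K) \<and> integrable lborel h \<and> (\<integral>x. h x \<partial>lborel) \<le> m \<and>
     1 - \<epsilon> \<le> wt h \<and> wt h \<le> 1 \<and> cstar - \<epsilon> \<le> En h" if \<epsilon>: "0 < \<epsilon>" for \<epsilon>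
  proof -
    have "0 \<le> sqn g" "0 \<le> (1::real)" by auto
    from bil_small[OF this \<epsilon>] obtain \<delta> where \<delta>: "\<delta> > 0" "\<And>f h. profile f \<Longrightarrow> profile h \<Longrightarrow> sqn f \<le> sqn g \<Longrightarrow>
        sqn h \<le> sqn g \<Longrightarrow> wt f \<le> 1 \<Longrightarrow> wt h \<le> \<delta> \<Longrightarrow> \<bar>bil kern f h\<bar> \<le> \<epsilon>" by blast
    have "(\<lambda>n. wt (cut g {x. real n < g x})) \<longlonglongrightarrow> 0"
    proof (rule wt_cut_vanish[OF p])
      show "eventually (\<lambda>n. x \<notin> {x. real n < g x}) sequentially" for x
        using eventually_gt_at_top[of "nat \<lceil>g x\<rceil>"] by eventually_elim (auto, linarith)
    qed measurable
    then have "eventually (\<lambda>n. wt (cut g {x. real n < g x}) < min \<delta> \<epsilon>) sequentially"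
      using \<delta> \<epsilon> by (intro order_tendstoD(2)) auto
    then obtain n where n: "wt (cut g {x. real n < g x}) < min \<delta> \<epsilon>" by (auto dest!: eventually_happens)
    define A where "A = {x. real n < g x}"
    have A: "A \<in> sets borel" unfolding A_def by measurable
    have pA: "profile (cut g A)" by (rule profile_restrict[OF p A])
    define h where "h = cut g (- A)"
    have "vort h" unfolding h_def using A by (intro vort_cut g) auto
    moreover have "h x \<le> real n" for x using nn[of x] by (auto simp: h_def A_def indicator_def)
    moreover have hi: "integrable lborel h"
      unfolding h_def using A by (intro integrable_mult_indicator[OF _ gi, simplified mult.commute[of "indicator _ _"] real_scaleR_def] ) auto
    moreover have "(\<integral>x. h x \<partial>lborel) \<le> m"
      unfolding m_def using hi gi nn by (intro integral_mono) (auto simp: h_def indicator_def)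
    moreover have "wt h = 1 - wt (cut g A)" using wt_split[OF p A] g(2) by (simp add: h_def)
    moreover have "0 \<le> wt (cut g A)" by (rule wt_nonneg[OF pA])
    moreover have "cstar - \<epsilon> \<le> En h"
    proof -
      have "\<bar>bil kern g (cut g A)\<bar> \<le> \<epsilon>"
        using n g(2) sqn_cut_le[OF p A] by (intro \<delta>(2) p pA) (auto simp: A_def)
      moreover have "0 \<le> bil kern (cut g A) (cut g A)"
        using vortD(2)[OF vort_cut[OF g(1) A]] by (intro bil_nonneg pA) auto
      moreover have "0 \<le> sqn (cut g A)" by (rule sqn_nonneg)
      ultimately show ?thesis using En_cut[OF p A] g(3) unfolding h_def by linarith
    qed
    ultimately show ?thesis using n by (intro exI[of _ h] exI[of _ "real n"]) (auto simp: A_def)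
  qed
  ultimately show ?thesis by blast
qed

end

section \<open>Borel representatives\<close>

lemma half_plane_borel [measurable, simp]: "half_plane \<in> sets borel"
  unfolding half_plane_def by measurable

lemma mem_half_plane: "x \<in> half_plane \<longleftrightarrow> 0 < x $ 2"
  by (simp add: half_plane_def)

lemma half_plane_lebesgue [simp]: "half_plane \<inter> space lebesgue \<in> sets lebesgue"
  by (simp add: sets_completionI_sets)

lemma AE_half_plane: "(AE x in half_plane_measure. P x) \<longleftrightarrow> (AE x in lborel. 0 < x $ 2 \<longrightarrow> P x)"
  by (subst AE_restrict_space_iff) (simp_all add: AE_completion_iff mem_half_plane)

lemma AE_lborel_translate:
  fixes v :: "'a::euclidean_space"
  assumes "AE x in lborel. P x"
  shows "AE x in lborel. P (x + v)"
proof -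
  obtain N where N: "N \<in> null_sets lborel" "{x. \<not> P x} \<subseteq> N"
    using assms by (auto simp: eventually_ae_filter)
  have "AE x in distr lborel borel ((+) v). x \<notin> N"
    unfolding lborel_distr_plus by (rule AE_not_in[OF N(1)])
  then have "AE x in lborel. v + x \<notin> N"
    using N(1) by (subst (asm) AE_distr_iff) auto
  then show ?thesis by eventually_elim (use N(2) in \<open>auto simp: add.commute\<close>)
qed

lemma nn_integral_half_plane:
  fixes f :: "real^2 \<Rightarrow> ennreal"
  assumes ae: "AE x in half_plane_measure. F x = f x" and off: "\<And>x. x $ 2 \<le> 0 \<Longrightarrow> f x = 0"
  shows "(\<integral>\<^sup>+x. F x \<partial>half_plane_measure) = (\<integral>\<^sup>+x. f x \<partial>lborel)"
proof -
  have "(\<integral>\<^sup>+x. F x \<partial>half_plane_measure) = (\<integral>\<^sup>+x. f x \<partial>half_plane_measure)"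
    by (rule nn_integral_cong_AE[OF ae])
  also have "\<dots> = (\<integral>\<^sup>+x. f x * indicator half_plane x \<partial>lebesgue)"
    by (rule nn_integral_restrict_space) simp
  also have "(\<lambda>x. f x * indicator half_plane x) = f"
    using off by (auto simp: indicator_def mem_half_plane not_less)
  finally show ?thesis by (simp add: nn_integral_completion)
qed

lemma integral_half_plane:
  fixes f :: "real^2 \<Rightarrow> real"
  assumes ae: "AE x in half_plane_measure. F x = f x" and off: "\<And>x. x $ 2 \<le> 0 \<Longrightarrow> f x = 0"
    and F: "F \<in> borel_measurable half_plane_measure" and f: "f \<in> borel_measurable borel"
  shows "(\<integral>x. F x \<partial>half_plane_measure) = (\<integral>x. f x \<partial>lborel)"
proof -
  have f': "f \<in> borel_measurable half_plane_measure"
    using f by (intro measurable_restrict_space1 measurable_completion) simp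
  have "(\<integral>x. F x \<partial>half_plane_measure) = (\<integral>x. f x \<partial>half_plane_measure)"
    by (rule integral_cong_AE[OF F f' ae])
  also have "\<dots> = (\<integral>x. indicator half_plane x *\<^sub>R f x \<partial>lebesgue)"
    by (rule integral_restrict_space) simp
  also have "(\<lambda>x. indicator half_plane x *\<^sub>R f x) = f"
  proof
    show "indicator half_plane x *\<^sub>R f x = f x" for x
      using off[of x] by (cases "x $ 2 \<le> 0") (auto simp: indicator_def mem_half_plane)
  qed
  finally show ?thesis using f by (simp add: integral_completion)
qed

lemma measurable_half_plane_AE:
  fixes F :: "real^2 \<Rightarrow> real"
  assumes ae: "AE x in half_plane_measure. F x = f x" and f: "f \<in> borel_measurable borel"
  shows "F \<in> borel_measurable half_plane_measure"
proof -
  define G where "G x = indicator half_plane x *\<^sub>R F x" for x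
  define g where "g x = indicator half_plane x *\<^sub>R f x" for x
  have g: "g \<in> borel_measurable lebesgue"
    unfolding g_def using f by (intro measurable_completion) simp
  have ae': "AE x in lebesgue. g x = G x"
    using ae unfolding AE_half_plane AE_completion_iff
    by eventually_elim (auto simp: g_def G_def indicator_def mem_half_plane)
  have "G \<in> borel_measurable lebesgue"
  proof (rule measurableI)
    fix A :: "real set" assume A: "A \<in> sets borel"
    show "G -` A \<inter> space lebesgue \<in> sets lebesgue"
    proof (rule completion.in_sets_AE)
      show "AE x in lebesgue. (x \<in> g -` A \<inter> space lebesgue) = (x \<in> G -` A \<inter> space lebesgue)"
        using ae' by eventually_elim auto
      show "g -` A \<inter> space lebesgue \<in> sets lebesgue" using g A by (rule measurable_sets)
    qed auto
  qed simp
  then show ?thesis unfolding G_def by (subst borel_measurable_restrict_space_iff) auto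
qed

lemma borel_representative:
  fixes \<omega> :: "real^2 \<Rightarrow> real"
  assumes \<omega>: "\<omega> \<in> borel_measurable half_plane_measure" and nn: "AE x in half_plane_measure. 0 \<le> \<omega> x"
  shows "\<exists>f. f \<in> borel_measurable borel \<and> (\<forall>x. 0 \<le> f x) \<and> (\<forall>x. x $ 2 \<le> 0 \<longrightarrow> f x = 0) \<and>
    (AE x in half_plane_measure. \<omega> x = f x)"
proof -
  have "(\<lambda>x. indicator half_plane x *\<^sub>R \<omega> x) \<in> borel_measurable lebesgue"
    using \<omega> by (subst (asm) borel_measurable_restrict_space_iff) auto
  from completion_ex_borel_measurable_real[OF this] obtain g where
    g: "g \<in> borel_measurable lborel" "AE x in lborel. indicator half_plane x *\<^sub>R \<omega> x = g x" by blast
  define f where "f x = \<bar>g x\<bar> * indicator half_plane x" for x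
  have "AE x in half_plane_measure. \<omega> x = f x"
    using g(2) nn unfolding AE_half_plane
    by eventually_elim (auto simp: f_def indicator_def mem_half_plane split: if_splits)
  moreover have "f \<in> borel_measurable borel"
    unfolding f_def using g(1) by simp
  ultimately show ?thesis by (intro exI[of _ f]) (auto simp: f_def mem_half_plane indicator_def)
qed

lemma AE_half_plane_translate:
  assumes "AE x in half_plane_measure. F x = f x" "v $ 2 = 0"
  shows "AE x in half_plane_measure. F (x + v) = f (x + v)"
  using AE_lborel_translate[of "\<lambda>x. 0 < x $ 2 \<longrightarrow> F x = f x" v] assms unfolding AE_half_plane by simp

lemma Lp_norm_2:
  assumes ae: "AE x in half_plane_measure. F x = f x" and f: "profile f"
  shows "Lp_norm half_plane_measure 2 F = ennreal (sqrt (sqn f))"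
proof -
  have "(\<integral>\<^sup>+x. ennreal (\<bar>F x\<bar> powr 2) \<partial>half_plane_measure) = (\<integral>\<^sup>+x. ennreal ((f x)\<^sup>2) \<partial>lborel)"
  proof (rule nn_integral_half_plane)
    show "AE x in half_plane_measure. ennreal (\<bar>F x\<bar> powr 2) = ennreal ((f x)\<^sup>2)"
      using ae by eventually_elim (simp add: powr_numeral)
  qed (use profileD(2)[OF f] in simp)
  also have "\<dots> = ennreal (sqn f)"
    unfolding sqn_def using profileD(3)[OF f] by (intro nn_integral_eq_integral) auto
  finally show ?thesis by (simp add: Lp_norm_def powr_half_sqrt)
qed

lemma Lp_norm_1_weight:
  assumes ae: "AE x in half_plane_measure. F x = x $ 2 * f x" and f: "profile f"
  shows "Lp_norm half_plane_measure 1 F = ennreal (wt f)"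
proof -
  have "(\<integral>\<^sup>+x. ennreal (\<bar>F x\<bar> powr 1) \<partial>half_plane_measure) = (\<integral>\<^sup>+x. ennreal (x $ 2 * \<bar>f x\<bar>) \<partial>lborel)"
  proof (rule nn_integral_half_plane)
    show "AE x in half_plane_measure. ennreal (\<bar>F x\<bar> powr 1) = ennreal (x $ 2 * \<bar>f x\<bar>)"
      using ae by eventually_elim (simp add: profile_abs_weight[OF f])
  qed (use profileD(2)[OF f] in simp)
  also have "\<dots> = ennreal (wt f)"
    unfolding wt_def using profile_integrable_wt[OF f] profile_wt_nonneg_pt[OF f] by (intro nn_integral_eq_integral) auto
  finally show ?thesis using wt_nonneg[OF f] by (simp add: Lp_norm_def)
qed

context half_plane_kernel
begin

lemma green_op_eq:
  assumes ae: "AE x in half_plane_measure. \<omega> x = f x" and \<omega>: "\<omega> \<in> borel_measurable half_plane_measure" and f: "profile f"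
  shows "green_op s \<omega> x = (\<integral>y. kern x y * f y \<partial>lborel)"
  unfolding green_op_def
proof (rule integral_half_plane)
  have [measurable]: "f \<in> borel_measurable borel" using f by auto
  have gm: "(\<lambda>y. green s x y) \<in> borel_measurable borel" unfolding green_def by measurable
  have km [measurable]: "(\<lambda>y. kern x y) \<in> borel_measurable borel" unfolding kern_def green_def by measurable
  have "AE y in half_plane_measure. y \<noteq> x"
    unfolding AE_half_plane using AE_lborel_singleton[of x] by eventually_elim auto
  with ae show "AE y in half_plane_measure. green s x y * \<omega> y = kern x y * f y"
    by eventually_elim (auto simp: kern_def)
  show "kern x y * f y = 0" if "y $ 2 \<le> 0" for y using profileD(2)[OF f that] by simp
  have "(\<lambda>y. green s x y) \<in> borel_measurable half_plane_measure"
    using gm by (intro measurable_restrict_space1 measurable_completion) simp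
  then show "(\<lambda>y. green s x y * \<omega> y) \<in> borel_measurable half_plane_measure"
    using \<omega> by (rule borel_measurable_times)
  show "(\<lambda>y. kern x y * f y) \<in> borel_measurable borel" by measurable
qed

lemma energy_eq:
  assumes ae: "AE x in half_plane_measure. \<omega> x = f x" and \<omega>: "\<omega> \<in> borel_measurable half_plane_measure" and f: "profile f"
  shows "energy s \<omega> = En f"
proof -
  have [measurable]: "f \<in> borel_measurable borel" using f by auto
  have fh: "f \<in> borel_measurable half_plane_measure"
    using profileD(1)[OF f] by (intro measurable_restrict_space1 measurable_completion) simp
  define U where "U x = (\<integral>y. kern x y * f y \<partial>lborel)" for x
  have op: "green_op s \<omega> = U" using green_op_eq[OF assms] by (auto simp: U_def)
  have int: "integrable (lborel \<Otimes>\<^sub>M lborel) (\<lambda>p. f (fst p) * kern (fst p) (snd p) * f (snd p))"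
    by (rule controlled_integrable[OF controlled_kern f f])
  have Um [measurable]: "U \<in> borel_measurable borel"
  proof -
    have "(\<lambda>p. kern (fst p) (snd p) * f (snd p)) \<in> borel_measurable (lborel \<Otimes>\<^sub>M lborel)" by measurable
    then have "(\<lambda>(x, y). kern x y * f y) \<in> borel_measurable (lborel \<Otimes>\<^sub>M lborel)"
      by (simp add: case_prod_beta')
    then have "(\<lambda>x. \<integral>y. kern x y * f y \<partial>lborel) \<in> borel_measurable lborel"
      by (rule lborel.borel_measurable_lebesgue_integral)
    then show ?thesis by (simp add: U_def[abs_def])
  qed
  have Uh: "U \<in> borel_measurable half_plane_measure"
    using Um by (intro measurable_restrict_space1 measurable_completion) simp
  have "(\<integral>x. \<omega> x * green_op s \<omega> x \<partial>half_plane_measure) = (\<integral>x. f x * U x \<partial>lborel)"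
  proof (rule integral_half_plane)
    show "AE x in half_plane_measure. \<omega> x * green_op s \<omega> x = f x * U x"
      using ae by eventually_elim (simp add: op)
    show "(\<lambda>x. \<omega> x * green_op s \<omega> x) \<in> borel_measurable half_plane_measure"
      unfolding op using \<omega> Uh by (rule borel_measurable_times)
    show "(\<lambda>x. f x * U x) \<in> borel_measurable borel" by measurable
  qed (use profileD(2)[OF f] in simp)
  also have "\<dots> = bil kern f f"
    unfolding bil_def U_def using lborel_pair.integral_fst'[OF int] by (simp add: mult.assoc)
  finally have 1: "(\<integral>x. \<omega> x * green_op s \<omega> x \<partial>half_plane_measure) = bil kern f f" .
  have "(\<integral>x. (\<omega> x)\<^sup>2 \<partial>half_plane_measure) = sqn f"
    unfolding sqn_def
  proof (rule integral_half_plane)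
    show "AE x in half_plane_measure. (\<omega> x)\<^sup>2 = (f x)\<^sup>2" using ae by eventually_elim simp
    show "(\<lambda>x. (\<omega> x)\<^sup>2) \<in> borel_measurable half_plane_measure" using \<omega> by (rule borel_measurable_power)
    show "(\<lambda>x. (f x)\<^sup>2) \<in> borel_measurable borel" by measurable
  qed (use profileD(2)[OF f] in simp)
  then show ?thesis using 1 by (simp add: energy_def kinetic_energy_def En_def)
qed

lemma mass_eq:
  assumes ae: "AE x in half_plane_measure. \<omega> x = f x" and "\<And>x. x $ 2 \<le> 0 \<Longrightarrow> f x = 0"
  shows "mass \<omega> = (\<integral>\<^sup>+x. ennreal (f x) \<partial>lborel)"
  unfolding mass_def
  by (rule nn_integral_half_plane) (use assms in \<open>auto elim!: eventually_mono\<close>)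

lemma impulse_eq:
  assumes ae: "AE x in half_plane_measure. \<omega> x = f x" and "\<And>x. x $ 2 \<le> 0 \<Longrightarrow> f x = 0"
  shows "impulse \<omega> = (\<integral>\<^sup>+x. ennreal (x $ 2 * f x) \<partial>lborel)"
  unfolding impulse_def
  by (rule nn_integral_half_plane) (use assms in \<open>auto elim!: eventually_mono\<close>)

lemma impulse_vort:
  assumes ae: "AE x in half_plane_measure. \<omega> x = f x" and f: "vort f"
  shows "impulse \<omega> = ennreal (wt f)"
proof -
  have "impulse \<omega> = (\<integral>\<^sup>+x. ennreal (x $ 2 * \<bar>f x\<bar>) \<partial>lborel)"
    using impulse_eq[OF ae] f vortD by auto
  also have "\<dots> = ennreal (wt f)"
    unfolding wt_def using profile_integrable_wt[OF vortD(1)[OF f]] profile_wt_nonneg_pt[OF vortD(1)[OF f]]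
    by (intro nn_integral_eq_integral) auto
  finally show ?thesis .
qed

text \<open>
  When \<open>s \<le> 1/2\<close>, square integrability follows from the essential bound \<open>K\<close> and the mass, because
  \<open>(f x)\<^sup>2 \<le> K * f x\<close>.
\<close>

lemma vort_representative:
  assumes Lp: "\<omega> \<in> Lp half_plane_measure (p_exp s)" and nn: "AE x in half_plane_measure. 0 \<le> \<omega> x"
    and m: "mass \<omega> \<le> 1" and i: "impulse \<omega> < \<infinity>"
  shows "\<exists>f. vort f \<and> (AE x in half_plane_measure. \<omega> x = f x)"
proof -
  have \<omega>: "\<omega> \<in> borel_measurable half_plane_measure" and fin: "Lp_norm half_plane_measure (p_exp s) \<omega> < \<infinity>"
    using Lp by (auto simp: Lp_def)
  obtain f where f [measurable]: "f \<in> borel_measurable borel" and fn: "\<And>x. 0 \<le> f x"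
    and off: "\<And>x. x $ 2 \<le> 0 \<Longrightarrow> f x = 0" and ae: "AE x in half_plane_measure. \<omega> x = f x"
    using borel_representative[OF \<omega> nn] by blast
  have imp: "impulse \<omega> = (\<integral>\<^sup>+x. ennreal (x $ 2 * f x) \<partial>lborel)"
    using ae off by (rule impulse_eq)
  have "(\<integral>\<^sup>+x. ennreal (norm (x $ 2 * f x)) \<partial>lborel) = impulse \<omega>"
    unfolding imp
  proof (rule nn_integral_cong)
    show "ennreal (norm (x $ 2 * f x)) = ennreal (x $ 2 * f x)" for x
      using fn[of x] off[of x] by (cases "x $ 2 \<le> 0") auto
  qed
  then have w: "integrable lborel (\<lambda>x. x $ 2 * f x)"
    using i by (intro integrableI_bounded) auto
  have sq: "(\<integral>\<^sup>+x. ennreal ((f x)\<^sup>2) \<partial>lborel) < \<infinity>"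
  proof (cases "s \<le> 1/2")
    case True
    define K where "K = esssup half_plane_measure (\<lambda>x. ennreal \<bar>\<omega> x\<bar>)"
    have K: "K < \<infinity>" using fin True by (simp add: K_def Lp_norm_def p_exp_def)
    have "AE x in half_plane_measure. ennreal \<bar>\<omega> x\<bar> \<le> K" unfolding K_def by (rule esssup_AE)
    with ae have "AE x in half_plane_measure. ennreal (f x) \<le> K"
      by eventually_elim (use fn in auto)
    then have "AE x in lborel. ennreal (f x) \<le> K"
      unfolding AE_half_plane by eventually_elim (use off in \<open>auto simp: not_less\<close>)
    then have "(\<integral>\<^sup>+x. ennreal ((f x)\<^sup>2) \<partial>lborel) \<le> (\<integral>\<^sup>+x. K * ennreal (f x) \<partial>lborel)"
    proof (intro nn_integral_mono_AE, eventually_elim)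
      case (elim x)
      from elim(2) have "ennreal (f x) * ennreal (f x) \<le> K * ennreal (f x)" by (rule mult_right_mono) simp
      then show ?case using fn[of x] by (simp add: ennreal_mult power2_eq_square)
    qed
    also have "\<dots> = K * mass \<omega>"
    proof -
      have ms: "mass \<omega> = (\<integral>\<^sup>+x. ennreal (f x) \<partial>lborel)" using ae off by (rule mass_eq)
      show ?thesis unfolding ms by (rule nn_integral_cmult) simp
    qed
    also have "\<dots> \<le> K * 1" using m by (rule mult_left_mono) simp
    finally show ?thesis using K by simp
  next
    case False
    have eq: "(\<integral>\<^sup>+x. ennreal (\<bar>\<omega> x\<bar> powr 2) \<partial>half_plane_measure) = (\<integral>\<^sup>+x. ennreal ((f x)\<^sup>2) \<partial>lborel)"
    proof (rule nn_integral_half_plane)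
      show "AE x in half_plane_measure. ennreal (\<bar>\<omega> x\<bar> powr 2) = ennreal ((f x)\<^sup>2)"
        using ae by eventually_elim (simp add: powr_numeral)
    qed (use off in simp)
    show ?thesis
    proof (rule ccontr)
      assume "\<not> ?thesis"
      then have "(\<integral>\<^sup>+x. ennreal (\<bar>\<omega> x\<bar> powr 2) \<partial>half_plane_measure) = \<infinity>" using eq by (simp add: not_less top_unique)
      then show False using fin False by (simp add: Lp_norm_def p_exp_def)
    qed
  qed
  have "integrable lborel (\<lambda>x. (f x)\<^sup>2)"
    using sq by (intro integrableI_bounded) auto
  then have "vort f" using w fn off f by (auto simp: vort_def profile_def)
  then show ?thesis using ae by blast
qed

lemma bounded_vort_in_Lp:
  assumes f: "vort f" and K: "s \<le> 1/2 \<Longrightarrow> AE x in lborel. f x \<le> K"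
  shows "f \<in> Lp half_plane_measure (p_exp s)"
proof -
  note p = vortD(1)[OF f]
  have m: "f \<in> borel_measurable half_plane_measure"
    using profileD(1)[OF p] by (intro measurable_restrict_space1 measurable_completion) simp
  have "Lp_norm half_plane_measure (p_exp s) f < \<infinity>"
  proof (cases "s \<le> 1/2")
    case True
    have "esssup half_plane_measure (\<lambda>x. ennreal \<bar>f x\<bar>) \<le> ennreal K"
    proof (rule esssup_I)
      show "(\<lambda>x. ennreal \<bar>f x\<bar>) \<in> borel_measurable half_plane_measure" using m by simp
      show "AE x in half_plane_measure. ennreal \<bar>f x\<bar> \<le> ennreal K"
        unfolding AE_half_plane using K[OF True] by eventually_elim (use vortD(2)[OF f] in \<open>auto intro: ennreal_leI\<close>)
    qed
    also have "\<dots> < \<infinity>" by simp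
    finally show ?thesis using True by (simp add: Lp_norm_def p_exp_def)
  next
    case False
    then show ?thesis using Lp_norm_2[OF _ p, of f] by (simp add: p_exp_def)
  qed
  then show ?thesis using m by (simp add: Lp_def)
qed

lemma admissible_representative:
  assumes "\<omega> \<in> admissible s \<mu>" "0 \<le> \<mu>"
  shows "\<exists>f. vort f \<and> wt f = \<mu> \<and> energy s \<omega> = En f"
proof -
  have \<omega>: "\<omega> \<in> Lp half_plane_measure (p_exp s)" "AE x in half_plane_measure. 0 \<le> \<omega> x"
    "mass \<omega> \<le> 1" "impulse \<omega> = ennreal \<mu>" using assms by (auto simp: admissible_def)
  then obtain f where f: "vort f" "AE x in half_plane_measure. \<omega> x = f x"
    using vort_representative[of \<omega>] by auto
  have "ennreal (wt f) = ennreal \<mu>" using impulse_vort[OF f(2,1)] \<omega>(4) by simp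
  then have "wt f = \<mu>" using wt_nonneg[OF vortD(1)[OF f(1)]] assms(2) by (simp add: ennreal_inj)
  moreover have "energy s \<omega> = En f" using energy_eq[OF f(2) _ vortD(1)[OF f(1)]] \<omega>(1) by (simp add: Lp_def)
  ultimately show ?thesis using f by blast
qed

section \<open>The constrained problem for small impulse\<close>

text \<open>
  This is where the impulse has to be small.  Scaling a near-maximizer of mass at most \<open>m\<close> from impulse
  at least \<open>1/2\<close> to impulse \<open>\<mu>\<close> gives mass at most \<open>2 * \<mu> * m\<close>.  If this is at most one, the bound on the
  mass does not lower the supremum.
\<close>

lemma max_energy_eq:
  "\<exists>\<mu>\<^sub>0>0. \<forall>\<mu>. 0 < \<mu> \<and> \<mu> \<le> \<mu>\<^sub>0 \<longrightarrow> max_energy s \<mu> = ereal (cstar * \<mu>\<^sup>2)"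
proof -
  obtain m where m: "m \<ge> 0" and ex: "\<And>\<epsilon>. 0 < \<epsilon> \<Longrightarrow> \<exists>h K. vort h \<and> (\<forall>x. h x \<le> K) \<and> integrable lborel h \<and> (\<integral>x. h x \<partial>lborel) \<le> m \<and>
     1 - \<epsilon> \<le> wt h \<and> wt h \<le> 1 \<and> cstar - \<epsilon> \<le> En h"
    using bounded_near_maximizer by blast
  define \<mu>0 where "\<mu>0 = 1 / (2 * (m + 1))"
  have "max_energy s \<mu> = ereal (cstar * \<mu>\<^sup>2)" if \<mu>: "0 < \<mu>" "\<mu> \<le> \<mu>0" for \<mu>
  proof (rule antisym)
    show "max_energy s \<mu> \<le> ereal (cstar * \<mu>\<^sup>2)"
      unfolding max_energy_def
    proof (rule SUP_least)
      fix \<omega> assume "\<omega> \<in> admissible s \<mu>"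
      then obtain f where "vort f" "wt f = \<mu>" "energy s \<omega> = En f" using admissible_representative \<mu> by fastforce
      then show "ereal (energy s \<omega>) \<le> ereal (cstar * \<mu>\<^sup>2)" using En_le_cstar[of f] by simp
    qed
    show "ereal (cstar * \<mu>\<^sup>2) \<le> max_energy s \<mu>"
    proof (rule ereal_le_epsilon2)
      fix e :: real assume e: "0 < e"
      define \<epsilon> where "\<epsilon> = min (1/2) (min cstar (e / \<mu>\<^sup>2))"
      have \<epsilon>: "0 < \<epsilon>" using e \<mu> cstar_pos by (simp add: \<epsilon>_def)
      obtain h K where h: "vort h" "\<And>x. h x \<le> K" "integrable lborel h" "(\<integral>x. h x \<partial>lborel) \<le> m"
        "1 - \<epsilon> \<le> wt h" "wt h \<le> 1" "cstar - \<epsilon> \<le> En h"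
        using ex[OF \<epsilon>] by blast
      have wh: "1/2 \<le> wt h" using h(5) by (simp add: \<epsilon>_def min_def split: if_splits)
      define b where "b = \<mu> / wt h"
      have b: "0 < b" "\<mu> \<le> b" "b \<le> 2 * \<mu>" using \<mu> wh h(6) by (auto simp: b_def field_simps)
      define f where "f = (\<lambda>x. b * h x)"
      have f: "vort f" unfolding f_def using b by (intro vort_cmult h) auto
      have wf: "wt f = \<mu>" using b wh by (simp add: f_def wt_cmult) (simp add: b_def)
      have Ef: "En f = b\<^sup>2 * En h" unfolding f_def by (rule En_cmult[OF vortD(1)[OF h(1)]])
      have fi: "integrable lborel f" using h(3) by (simp add: f_def)
      have mf: "mass f \<le> 1"
      proof -
        have "mass f = (\<integral>\<^sup>+x. ennreal (f x) \<partial>lborel)"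
          using profileD(2)[OF vortD(1)[OF f]] by (intro mass_eq) auto
        also have "\<dots> = ennreal (\<integral>x. f x \<partial>lborel)"
          using fi vortD(2)[OF f] by (intro nn_integral_eq_integral) auto
        also have "(\<integral>x. f x \<partial>lborel) \<le> 1"
        proof -
          have "(\<integral>x. f x \<partial>lborel) = b * (\<integral>x. h x \<partial>lborel)" by (simp add: f_def)
          also have "\<dots> \<le> (2 * \<mu>0) * (m + 1)"
            using b \<mu> h(4) m vortD(2)[OF h(1)] by (intro mult_mono Bochner_Integration.integral_nonneg) auto
          also have "\<dots> = 1" using m by (simp add: \<mu>0_def)
          finally show ?thesis .
        qed
        finally show ?thesis by (simp add: ennreal_leI)
      qed
      have "f \<in> Lp half_plane_measure (p_exp s)"
        by (rule bounded_vort_in_Lp[OF f, of "b * K"]) (use b h(2) in \<open>auto simp: f_def\<close>)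
      moreover have "impulse f = ennreal \<mu>" using impulse_vort[of f f] f wf by simp
      ultimately have adm: "f \<in> admissible s \<mu>"
        using mf vortD(2)[OF f] by (auto simp: admissible_def)
      have "energy s f = En f"
        using profileD(1)[OF vortD(1)[OF f]]
        by (intro energy_eq vortD(1)[OF f] measurable_restrict_space1 measurable_completion) auto
      then have "ereal (En f) \<le> max_energy s \<mu>"
        unfolding max_energy_def using adm by (metis SUP_upper)
      moreover have "cstar * \<mu>\<^sup>2 \<le> En f + e"
      proof -
        have "\<mu>\<^sup>2 \<le> b\<^sup>2" using b \<mu> by (intro power_mono) auto
        moreover have "0 \<le> cstar - \<epsilon>" by (simp add: \<epsilon>_def)
        ultimately have "\<mu>\<^sup>2 * (cstar - \<epsilon>) \<le> b\<^sup>2 * En h" using h(7) by (intro mult_mono) auto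
        moreover have "\<mu>\<^sup>2 * \<epsilon> \<le> e"
        proof -
          have "\<mu>\<^sup>2 * \<epsilon> \<le> \<mu>\<^sup>2 * (e / \<mu>\<^sup>2)" by (intro mult_left_mono) (auto simp: \<epsilon>_def)
          then show ?thesis using \<mu> by simp
        qed
        ultimately show ?thesis by (simp add: Ef algebra_simps)
      qed
      then have "ereal (cstar * \<mu>\<^sup>2) \<le> ereal (En f) + ereal e" by simp
      ultimately show "ereal (cstar * \<mu>\<^sup>2) \<le> max_energy s \<mu> + ereal e"
        by (meson add_right_mono order_trans)
    qed
  qed
  moreover have "\<mu>0 > 0" using m by (simp add: \<mu>0_def)
  ultimately show ?thesis by blast
qed

lemma maximizing_sequence_converges:
  assumes \<mu>: "0 < \<mu>" and S: "max_energy s \<mu> = ereal (cstar * \<mu>\<^sup>2)"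
    and nn: "\<And>n. AE x in half_plane_measure. 0 \<le> \<omega> n x"
    and Lp: "\<And>n. \<omega> n \<in> Lp half_plane_measure (p_exp s)"
    and mass: "\<And>n. mass (\<omega> n) \<le> 1"
    and C: "\<And>n. Lp_norm half_plane_measure (p_exp s) (\<omega> n) \<le> ennreal C"
    and imp: "(\<lambda>n. impulse (\<omega> n)) \<longlonglongrightarrow> ennreal \<mu>"
    and en: "(\<lambda>n. ereal (energy s (\<omega> n))) \<longlonglongrightarrow> max_energy s \<mu>"
  shows "\<exists>g\<in>maximizers s \<mu>. \<exists>(r :: nat \<Rightarrow> nat) c. strict_mono r \<and>
     tendsto_Lp half_plane_measure 2 (\<lambda>k x. \<omega> (r k) (x + c k *\<^sub>R e1)) g \<and>
     tendsto_Lp half_plane_measure 1 (\<lambda>k x. x $ 2 * \<omega> (r k) (x + c k *\<^sub>R e1)) (\<lambda>x. x $ 2 * g x)"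
proof -
  have \<omega>m: "\<omega> n \<in> borel_measurable half_plane_measure" for n using Lp[of n] by (simp add: Lp_def)
  \<comment> \<open>Finitely many terms may have infinite impulse; they are dropped.\<close>
  have "eventually (\<lambda>n. impulse (\<omega> n) < \<infinity>) sequentially"
    using imp by (rule order_tendstoD) simp
  then obtain N where "\<forall>n\<ge>N. impulse (\<omega> n) < \<infinity>"
    unfolding eventually_sequentially by blast
  then have N: "impulse (\<omega> (N + n)) < \<infinity>" for n by simp
  have "\<forall>n. \<exists>f. vort f \<and> (AE x in half_plane_measure. \<omega> (N + n) x = f x)"
    using vort_representative[OF Lp nn mass N] by blast
  from choice[OF this] obtain f where f: "\<And>n. vort (f n)" "\<And>n. AE x in half_plane_measure. \<omega> (N + n) x = f n x"
    by blast
  note p = vortD(1)[OF f(1)] and fn = vortD(2)[OF f(1)]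
  have wf: "impulse (\<omega> (N + n)) = ennreal (wt (f n))" for n by (rule impulse_vort[OF f(2,1)])
  have Ef: "energy s (\<omega> (N + n)) = En (f n)" for n by (rule energy_eq[OF f(2) \<omega>m p])
  have "(\<lambda>n. ennreal (wt (f n))) \<longlonglongrightarrow> ennreal \<mu>"
    using LIMSEQ_ignore_initial_segment[OF imp, of N] by (simp add: wf[symmetric] add.commute)
  then have w: "(\<lambda>n. wt (f n)) \<longlonglongrightarrow> \<mu>"
    using wt_nonneg[OF p] \<mu> by (subst (asm) tendsto_ennreal_iff) auto
  have "(\<lambda>n. ereal (En (f n))) \<longlonglongrightarrow> ereal (cstar * \<mu>\<^sup>2)"
    using LIMSEQ_ignore_initial_segment[OF en, of N] by (simp add: Ef[symmetric] S add.commute)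
  then have E: "(\<lambda>n. En (f n)) \<longlonglongrightarrow> cstar * \<mu>\<^sup>2" by simp
  have "maximizing f \<mu>" using f w E \<mu> by (simp add: maximizing_def)
  from maximizing_compactness[OF this] obtain k t g where
    k: "strict_mono (k :: nat \<Rightarrow> nat)" and g: "vort g" "wt g = \<mu>" "En g = cstar * \<mu>\<^sup>2"
    and lim: "AE x in lborel. (\<lambda>n. f (k n) (x + t n *\<^sub>R e1)) \<longlonglongrightarrow> g x"
    and sq: "(\<lambda>n. sqn (\<lambda>x. f (k n) (x + t n *\<^sub>R e1) - g x)) \<longlonglongrightarrow> 0"
    and wl: "(\<lambda>n. wt (\<lambda>x. f (k n) (x + t n *\<^sub>R e1) - g x)) \<longlonglongrightarrow> 0"
    by blast
  note pg = vortD(1)[OF g(1)] and gn = vortD(2)[OF g(1)]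
  have [measurable]: "\<And>n. f n \<in> borel_measurable borel" "g \<in> borel_measurable borel" using p pg by auto
  define u where "u n = (\<lambda>x. f (k n) (x + t n *\<^sub>R e1))" for n
  have pu: "profile (u n)" for n unfolding u_def by (intro profile_translate p) simp
  have [measurable]: "\<And>n. u n \<in> borel_measurable borel" using pu by auto
  have limu: "AE x in lborel. (\<lambda>n. u n x) \<longlonglongrightarrow> g x" using lim by (simp add: u_def)
  define r where "r n = N + k n" for n
  have r: "strict_mono r" using k by (auto simp: r_def strict_mono_def)
  have ae: "AE x in half_plane_measure. \<omega> (r n) (x + t n *\<^sub>R e1) = u n x" for n
    unfolding r_def u_def by (intro AE_half_plane_translate f(2)) simp
  have massf: "integrable lborel (f n) \<and> (\<integral>x. f n x \<partial>lborel) \<le> 1" for n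
  proof -
    have le: "(\<integral>\<^sup>+x. ennreal (f n x) \<partial>lborel) \<le> 1"
      using mass[of "N + n"] mass_eq[OF f(2) profileD(2)[OF p]] by simp
    then have i: "integrable lborel (f n)"
      using fn by (intro integrableI_bounded) (auto intro: le_less_trans)
    then have "ennreal (\<integral>x. f n x \<partial>lborel) \<le> ennreal 1"
      using le fn by (simp add: nn_integral_eq_integral)
    then show ?thesis using i by (subst (asm) ennreal_le_iff) auto
  qed
  have gmass: "integrable lborel g" "(\<integral>x. g x \<partial>lborel) \<le> 1"
  proof -
    have ui: "integrable lborel (u n)" "(\<integral>x. u n x \<partial>lborel) \<le> 1" for n
      using massf[of "k n"] lborel_integrable_translate[of "f (k n)"] lborel_integral_translate[of "f (k n)"]
      by (simp_all add: u_def)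
    have "integrable lborel g \<and> (\<integral>x. g x \<partial>lborel) \<le> 1"
      using nn_fatou[OF _ _ limu, of 1] ui gn fn by (simp add: u_def)
    then show "integrable lborel g" "(\<integral>x. g x \<partial>lborel) \<le> 1" by auto
  qed
  have "mass g \<le> 1"
  proof -
    have "mass g = (\<integral>\<^sup>+x. ennreal (g x) \<partial>lborel)" using profileD(2)[OF pg] by (intro mass_eq) auto
    also have "\<dots> = ennreal (\<integral>x. g x \<partial>lborel)" using gmass gn by (intro nn_integral_eq_integral) auto
    finally show ?thesis using gmass(2) by (simp add: ennreal_leI)
  qed
  moreover have "g \<in> Lp half_plane_measure (p_exp s)"
  proof (rule bounded_vort_in_Lp[OF g(1)])
    assume s2: "s \<le> 1/2"
    have fC: "AE x in lborel. f n x \<le> max C 0" for n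
    proof -
      have "esssup half_plane_measure (\<lambda>x. ennreal \<bar>\<omega> (N + n) x\<bar>) \<le> ennreal C"
        using C[of "N + n"] s2 by (simp add: Lp_norm_def p_exp_def)
      moreover have "AE x in half_plane_measure. ennreal \<bar>\<omega> (N + n) x\<bar> \<le> esssup half_plane_measure (\<lambda>x. ennreal \<bar>\<omega> (N + n) x\<bar>)"
        by (rule esssup_AE)
      ultimately have "AE x in half_plane_measure. ennreal \<bar>\<omega> (N + n) x\<bar> \<le> ennreal C"
        by (auto elim!: eventually_mono intro: order_trans)
      with f(2)[of n] have "AE x in half_plane_measure. f n x \<le> max C 0"
      proof eventually_elim
        case (elim x)
        then have "ennreal (f n x) \<le> ennreal C" using fn[of n x] by simp
        then show ?case by (cases "0 \<le> C") (auto simp: ennreal_le_iff ennreal_neg ennreal_eq_0_iff)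
      qed
      then show ?thesis
        unfolding AE_half_plane by eventually_elim (use profileD(2)[OF p] in \<open>auto simp: not_less\<close>)
    qed
    have "AE x in lborel. \<forall>n. u n x \<le> max C 0"
      unfolding AE_all_countable u_def using AE_lborel_translate[OF fC] by blast
    with limu show "AE x in lborel. g x \<le> max C 0"
      by eventually_elim (auto intro: LIMSEQ_le_const2)
  qed
  moreover have "impulse g = ennreal \<mu>" using impulse_vort[of g g] g by simp
  ultimately have "g \<in> admissible s \<mu>" using gn by (simp add: admissible_def)
  moreover have "energy s g = En g"
    using profileD(1)[OF pg] by (intro energy_eq pg measurable_restrict_space1 measurable_completion) auto
  ultimately have gmax: "g \<in> maximizers s \<mu>" by (simp add: maximizers_def S g(3))
  have "tendsto_Lp half_plane_measure 2 (\<lambda>n x. \<omega> (r n) (x + t n *\<^sub>R e1)) g"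
    unfolding tendsto_Lp_def
  proof (intro conjI allI)
    show "(\<lambda>x. \<omega> (r n) (x + t n *\<^sub>R e1)) \<in> Lp half_plane_measure 2" for n
      using measurable_half_plane_AE[OF ae] Lp_norm_2[OF ae pu] by (simp add: Lp_def)
    show "g \<in> Lp half_plane_measure 2"
      using measurable_half_plane_AE[of g g] Lp_norm_2[of g g] pg by (simp add: Lp_def)
    have "Lp_norm half_plane_measure 2 (\<lambda>x. \<omega> (r n) (x + t n *\<^sub>R e1) - g x) = ennreal (sqrt (sqn (\<lambda>x. u n x - g x)))" for n
      using ae[of n] by (intro Lp_norm_2 profile_diff pu pg) (auto elim!: eventually_mono)
    moreover have "(\<lambda>n. ennreal (sqrt (sqn (\<lambda>x. u n x - g x)))) \<longlonglongrightarrow> ennreal (sqrt 0)"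
      using sq by (intro tendsto_ennrealI tendsto_real_sqrt) (simp add: u_def)
    ultimately show "(\<lambda>n. Lp_norm half_plane_measure 2 (\<lambda>x. \<omega> (r n) (x + t n *\<^sub>R e1) - g x)) \<longlonglongrightarrow> 0"
      by simp
  qed
  moreover have "tendsto_Lp half_plane_measure 1 (\<lambda>n x. x $ 2 * \<omega> (r n) (x + t n *\<^sub>R e1)) (\<lambda>x. x $ 2 * g x)"
    unfolding tendsto_Lp_def
  proof (intro conjI allI)
    have ae1: "AE x in half_plane_measure. x $ 2 * \<omega> (r n) (x + t n *\<^sub>R e1) = x $ 2 * u n x" for n
      using ae[of n] by eventually_elim simp
    show "(\<lambda>x. x $ 2 * \<omega> (r n) (x + t n *\<^sub>R e1)) \<in> Lp half_plane_measure 1" for n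
      using measurable_half_plane_AE[OF ae1] Lp_norm_1_weight[OF ae1 pu] by (simp add: Lp_def)
    show "(\<lambda>x. x $ 2 * g x) \<in> Lp half_plane_measure 1"
      using measurable_half_plane_AE[of "\<lambda>x. x $ 2 * g x" "\<lambda>x. x $ 2 * g x"] Lp_norm_1_weight[of "\<lambda>x. x $ 2 * g x" g] pg
      by (simp add: Lp_def)
    have "Lp_norm half_plane_measure 1 (\<lambda>x. x $ 2 * \<omega> (r n) (x + t n *\<^sub>R e1) - x $ 2 * g x) = ennreal (wt (\<lambda>x. u n x - g x))" for n
      using ae[of n] by (intro Lp_norm_1_weight profile_diff pu pg) (auto elim!: eventually_mono simp: right_diff_distrib)
    moreover have "(\<lambda>n. ennreal (wt (\<lambda>x. u n x - g x))) \<longlonglongrightarrow> ennreal 0"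
      using wl by (intro tendsto_ennrealI) (simp add: u_def)
    ultimately show "(\<lambda>n. Lp_norm half_plane_measure 1 (\<lambda>x. x $ 2 * \<omega> (r n) (x + t n *\<^sub>R e1) - x $ 2 * g x)) \<longlonglongrightarrow> 0"
      by simp
  qed
  ultimately show ?thesis using gmax r by blast
qed

end

theorem theorem4p1:
  fixes s :: real
  assumes "0 < s" and "s < 1"
  shows "\<exists>\<mu>\<^sub>0>0. \<forall>\<mu>. 0 < \<mu> \<and> \<mu> \<le> \<mu>\<^sub>0 \<longrightarrow>
    (\<forall>(\<omega>s :: nat \<Rightarrow> real^2 \<Rightarrow> real) (C :: real).
      (\<forall>n. AE x in half_plane_measure. \<omega>s n x \<ge> 0) \<and>
      (\<forall>n. \<omega>s n \<in> Lp half_plane_measure 1 \<inter> Lp half_plane_measure (p_exp s)) \<and>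
      (\<forall>n. mass (\<omega>s n) \<le> 1) \<and>
      (\<forall>n. Lp_norm half_plane_measure (p_exp s) (\<omega>s n) \<le> ennreal C) \<and>
      (\<lambda>n. impulse (\<omega>s n)) \<longlonglongrightarrow> ennreal \<mu> \<and>
      (\<lambda>n. ereal (energy s (\<omega>s n))) \<longlonglongrightarrow> max_energy s \<mu> \<longrightarrow>
      (\<exists>\<omega>\<in>maximizers s \<mu>. \<exists>(r :: nat \<Rightarrow> nat) (c :: nat \<Rightarrow> real).
        strict_mono r \<and>
        tendsto_Lp half_plane_measure 2 (\<lambda>k x. \<omega>s (r k) (x + c k *\<^sub>R e1)) \<omega> \<and>
        tendsto_Lp half_plane_measure 1
          (\<lambda>k x. x $ 2 * \<omega>s (r k) (x + c k *\<^sub>R e1)) (\<lambda>x. x $ 2 * \<omega> x)))"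
proof -
  interpret half_plane_kernel s using assms by unfold_locales
  obtain \<mu>0 where "\<mu>0 > 0" and S: "\<And>\<mu>. 0 < \<mu> \<Longrightarrow> \<mu> \<le> \<mu>0 \<Longrightarrow> max_energy s \<mu> = ereal (cstar * \<mu>\<^sup>2)"
    using max_energy_eq by blast
  show ?thesis
  proof (intro exI[of _ \<mu>0] conjI allI impI \<open>\<mu>0 > 0\<close>, elim conjE)
    fix \<mu> C :: real and \<omega>s :: "nat \<Rightarrow> real^2 \<Rightarrow> real"
    assume \<mu>: "0 < \<mu>" "\<mu> \<le> \<mu>0"
      and h: "\<forall>n. AE x in half_plane_measure. \<omega>s n x \<ge> 0"
        "\<forall>n. \<omega>s n \<in> Lp half_plane_measure 1 \<inter> Lp half_plane_measure (p_exp s)"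
        "\<forall>n. mass (\<omega>s n) \<le> 1"
        "\<forall>n. Lp_norm half_plane_measure (p_exp s) (\<omega>s n) \<le> ennreal C"
        "(\<lambda>n. impulse (\<omega>s n)) \<longlonglongrightarrow> ennreal \<mu>"
        "(\<lambda>n. ereal (energy s (\<omega>s n))) \<longlonglongrightarrow> max_energy s \<mu>"
    show "\<exists>\<omega>\<in>maximizers s \<mu>. \<exists>(r :: nat \<Rightarrow> nat) (c :: nat \<Rightarrow> real).
        strict_mono r \<and>
        tendsto_Lp half_plane_measure 2 (\<lambda>k x. \<omega>s (r k) (x + c k *\<^sub>R e1)) \<omega> \<and>
        tendsto_Lp half_plane_measure 1
          (\<lambda>k x. x $ 2 * \<omega>s (r k) (x + c k *\<^sub>R e1)) (\<lambda>x. x $ 2 * \<omega> x)"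
      using h by (intro maximizing_sequence_converges[OF \<mu>(1) S[OF \<mu>]]) auto
  qed
qed

end
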